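(* Let $n\ge 2$ and $1\le k<n$. For any $\mathbf{x}=(x_1,\dots,x_k)\in\mathrm{Aff}$ with $x_i\ne 0$ for all $1\le i\le k$, define $y_j:=\pi^{-1}(x_j)$ for all $1\le j\le k$. Then $$\int_{(0,\infty)^k}|\mathcal{A}_{\mathbf{t}}f(\mathbf{x})|^2\,W(\mathbf{x},\mathbf{t})\,d\mathbf{t}=\int_{\mathbb{R}^k}|\mathcal{E}f(s_1y_1+\cdots+s_ky_k)|^2\,d\mathbf{s}$$ for any $f\in C_0^\infty(B^n(0,1))$, where $$W(\mathbf{x},\mathbf{t})=\frac{2^k|x_1|^2\cdots|x_k|^2}{t_1\cdots t_k}.$$
   Context: $\mathrm{Aff}\subset(\mathbb{R}^n)^k$ is the set of $\mathbf{x}=(x_1,\dots,x_k)$ whose affine span $A_{\mathbf{x}}=\{\sum_j\lambda_jx_j:\sum_j\lambda_j=1\}$ has dimension $k-1$. For $x\in\mathbb{R}^n\setminus\{0\}$, $\pi^{-1}(x)=\bigl(\frac{-x}{2|x|^2},\frac{1}{4|x|^2}\bigr)\in\mathbb{R}^{n+1}$. The paraboloid extension operator is $\mathcal{E}f(x,t)=\int_{B^n(0,1)}f(z)e^{2\pi i(x\cdot z+t|z|^2)}\,dz$ for $(x,t)\in\mathbb{R}^n\times\mathbb{R}$. Spherical averaging operator. For $\mathbf{x}\in\mathrm{Aff}$ let $d_{\mathbf{x}}(y)=(|x_1-y|,\dots,|x_k-y|)$, and for $\mathbf{t}\in(0,\infty)^k$ let $S^{n-k}(\mathbf{x},\mathbf{t})=\{y\in\mathbb{R}^n:|x_j-y|=t_j,\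 1\le j\le k\}$. Let $D_{\mathbf{x}}(y)=\bigl(\det(\nabla d_{\mathbf{x}}(y)\,\nabla d_{\mathbf{x}}(y)^T)\bigr)^{1/2}$, where $\nabla d_{\mathbf{x}}(y)$ is the $k\times n$ Jacobian matrix. Let $C_{\mathbf{x}}=d_{\mathbf{x}}(A_{\mathbf{x}}\setminus\{x_1,\dots,x_k\})$, the set of $\mathbf{t}$ for which $S^{n-k}(\mathbf{x},\mathbf{t})$ is a single point, and $Z_{\mathbf{x}}$ the set of $\mathbf{t}$ for which $S^{n-k}(\mathbf{x},\mathbf{t})=\emptyset$. For $\mathbf{t}\notin C_{\mathbf{x}}\cup Z_{\mathbf{x}}$, $S^{n-k}(\mathbf{x},\mathbf{t})$ is an $(n-k)$-dimensional sphere on which $D_{\mathbf{x}}>0$, and $$\mathcal{A}_{\mathbf{t}}f(\mathbf{x})=\int_{S^{n-k}(\mathbf{x},\mathbf{t})}f(y)\,\frac{d\mathcal{H}^{n-k}(y)}{D_{\mathbf{x}}(y)},$$ with $\mathcal{H}^{n-k}$ the unnormalized $(n-k)$-dimensional Hausdorff (surface) measure; for $\mathbf{t}\in C_{\mathbf{x}}\cup Z_{\mathbf{x}}$ set $\mathcal{A}_{\mathbf{t}}f(\mathbf{x})=0$. *)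

theory Defs
  imports "HOL-Analysis.Analysis"
begin

text \<open>
  Points of \<open>(\<real>\<^sup>n)\<^sup>k\<close> are matrices of type \<open>real ^ 'n ^ 'k\<close>, the row \<open>x $ j\<close> being the point
  \<open>x\<^sub>j\<close>; thus \<open>n = CARD('n)\<close> and \<open>k = CARD('k)\<close>.  The space \<open>\<real>\<^sup>n\<^sup>+\<^sup>1\<close> is \<open>(real ^ 'n) \<times> real\<close>.
\<close>

subsection \<open>Test functions\<close>

text \<open>
  \<open>C_diff m f\<close> says that \<open>f\<close> is of class \<open>C\<^sup>m\<close> on the whole space: all iterated directional
  derivatives up to order \<open>m\<close> exist and are continuous.
\<close>

primrec C_diff :: "nat \<Rightarrow> ('a::euclidean_space \<Rightarrow> 'b::real_normed_vector) \<Rightarrow> bool" where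
  "C_diff 0 f \<longleftrightarrow> continuous_on UNIV f"
| "C_diff (Suc m) f \<longleftrightarrow>
     (\<forall>x. f differentiable (at x)) \<and> (\<forall>v. C_diff m (\<lambda>x. frechet_derivative f (at x) v))"

text \<open>
  An element of \<open>C\<^sub>0\<^sup>\<infinity>(U)\<close> is represented by its extension by zero to the whole space.
\<close>

definition C0_infty :: "'a::euclidean_space set \<Rightarrow> ('a \<Rightarrow> 'b::real_normed_vector) set" where
  "C0_infty U =
     {f. (\<forall>m. C_diff m f) \<and> compact (closure {z. f z \<noteq> 0}) \<and> closure {z. f z \<noteq> 0} \<subseteq> U}"

subsection \<open>Hausdorff measure\<close>

text \<open>
  The normalising factor \<open>unit_ball_vol m / 2 ^ m\<close> makes \<open>\<H>\<^sup>m\<close> agree with the usual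
  \<open>m\<close>-dimensional surface measure.  The empty set is singled out because \<open>0 ^ 0 = 1\<close> (case
  \<open>m = 0\<close>), and boundedness is required because \<^const>\<open>diameter\<close> is meaningful for bounded sets only.
\<close>

definition hausdorff_content :: "nat \<Rightarrow> real \<Rightarrow> 'a::metric_space set \<Rightarrow> ennreal" where
  "hausdorff_content m \<delta> A =
     (INF U \<in> {U :: nat \<Rightarrow> 'a set. (\<forall>i. bounded (U i) \<and> diameter (U i) \<le> \<delta>) \<and> A \<subseteq> (\<Union>i. U i)}.
        \<Sum>i. if U i = {} then 0 else ennreal (unit_ball_vol (real m) * (diameter (U i) / 2) ^ m))"

definition hausdorff_outer :: "nat \<Rightarrow> 'a::metric_space set \<Rightarrow> ennreal" where
  "hausdorff_outer m A = (SUP \<delta> \<in> {0<..}. hausdorff_content m \<delta> A)"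

text \<open>
  The outer measure is a metric outer measure, hence by Caratheodory's criterion a measure on the
  Borel sets, so that \<^const>\<open>measure_of\<close> does not fall back on the zero measure.
\<close>

definition hausdorff_measure :: "nat \<Rightarrow> 'a::metric_space measure" where
  "hausdorff_measure m = measure_of UNIV (sets borel) (hausdorff_outer m)"

subsection \<open>Extension operator\<close>

definition pi_inv :: "real ^ 'n \<Rightarrow> (real ^ 'n) \<times> real" where
  "pi_inv x = ((- 1 / (2 * (norm x)\<^sup>2)) *\<^sub>R x, 1 / (4 * (norm x)\<^sup>2))"

definition extension_op :: "(real ^ 'n \<Rightarrow> complex) \<Rightarrow> (real ^ 'n) \<times> real \<Rightarrow> complex" where
  "extension_op f p = (case p of (x, t) \<Rightarrow>
     LINT z : ball 0 1 | lborel.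
       f z * exp (2 * complex_of_real pi * \<i> * complex_of_real (x \<bullet> z + t * (norm z)\<^sup>2)))"

subsection \<open>Spherical averaging operator\<close>

definition aff_span :: "real ^ 'n ^ 'k \<Rightarrow> (real ^ 'n) set" where
  "aff_span x = {\<Sum>j\<in>UNIV. l j *\<^sub>R x $ j | l :: 'k \<Rightarrow> real. (\<Sum>j\<in>UNIV. l j) = 1}"

definition Aff :: "(real ^ 'n ^ 'k) set" where
  "Aff = {x. aff_dim (aff_span x) = int CARD('k) - 1}"

definition pos_orthant :: "(real ^ 'k) set" where
  "pos_orthant = {t. \<forall>j. 0 < t $ j}"

definition dist_map :: "real ^ 'n ^ 'k \<Rightarrow> real ^ 'n \<Rightarrow> real ^ 'k" where
  "dist_map x y = (\<chi> j. norm (x $ j - y))"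

definition sph :: "real ^ 'n ^ 'k \<Rightarrow> real ^ 'k \<Rightarrow> (real ^ 'n) set" where
  "sph x t = {y. \<forall>j. norm (x $ j - y) = t $ j}"

definition D_fun :: "real ^ 'n ^ 'k \<Rightarrow> real ^ 'n \<Rightarrow> real" where
  "D_fun x y =
     sqrt (det (jacobian (dist_map x) (at y) ** transpose (jacobian (dist_map x) (at y))))"

definition C_set :: "real ^ 'n ^ 'k \<Rightarrow> (real ^ 'k) set" where
  "C_set x = dist_map x ` (aff_span x - range (\<lambda>j. x $ j))"

definition Z_set :: "real ^ 'n ^ 'k \<Rightarrow> (real ^ 'k) set" where
  "Z_set x = {t \<in> pos_orthant. sph x t = {}}"

definition avg_op :: "real ^ 'k \<Rightarrow> (real ^ 'n \<Rightarrow> complex) \<Rightarrow> real ^ 'n ^ 'k \<Rightarrow> complex" where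
  "avg_op t f x =
     (if t \<in> C_set x \<union> Z_set x then 0
      else LINT y : sph x t | hausdorff_measure (CARD('n) - CARD('k)).
             f y / complex_of_real (D_fun x y))"

definition weight :: "real ^ 'n ^ 'k \<Rightarrow> real ^ 'k \<Rightarrow> real" where
  "weight x t = 2 ^ CARD('k) * (\<Prod>j\<in>UNIV. (norm (x $ j))\<^sup>2) / (\<Prod>j\<in>UNIV. t $ j)"

end

theory Submission
  imports Defs "HOL-Probability.Probability"
begin

text \<open>
Pairing \<open>\<Sum>\<^sub>j s\<^sub>j y\<^sub>j\<close> with the point \<open>(z, |z|\<^sup>2)\<close> of the paraboloid and completing the square gives the
phase \<open>\<Sum>\<^sub>j s\<^sub>j v\<^sub>j(z)\<close> with \<open>v\<^sub>j(z) = (|x\<^sub>j - z|\<^sup>2 - |x\<^sub>j|\<^sup>2) / (4 |x\<^sub>j|\<^sup>2)\<close>.  Hence the extension of \<open>f\<close>, restricted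
to the span of the \<open>y\<^sub>j\<close>, is the Fourier transform on \<open>\<real>\<^sup>k\<close> of the image under \<open>v\<close> of the measure \<open>f(z) dz\<close>,
and by Plancherel the right-hand side is the squared \<open>L\<^sup>2\<close> norm of the density of that image.  The
map \<open>v\<close> is a function of the distances \<open>|x\<^sub>j - z|\<close> alone, so its fibres are the spheres
\<open>S\<^sup>n\<^sup>-\<^sup>k(x, t)\<close>; by the coarea formula the density is \<open>\<A>\<^sub>t f(x)\<close> times Jacobian factors, and passing
from the variable \<open>v\<close> to the variable \<open>t\<close> collects these factors into \<open>W\<close>.

The coarea formula is made explicit by coordinates adapted to the affine span of the \<open>x\<^sub>j\<close>
(locale \<open>frame\<close>).  A point \<open>z\<close> gets coordinates \<open>\<alpha> \<in> \<real>\<^sup>k\<close>, of which \<open>k - 1\<close> run along the affine span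
and the one with index \<open>k0\<close> along a normal, and \<open>\<beta> \<in> \<real>\<^sup>n\<^sup>-\<^sup>k\<close> for the remaining normals.  All distances
\<open>|x\<^sub>j - z|\<close> are functions of \<open>\<xi>\<close>, which consists of the \<open>k - 1\<close> tangential coordinates and of the squared
distance \<open>r\<^sup>2 = \<alpha>\<^sub>k\<^sub>0\<^sup>2 + |\<beta>|\<^sup>2\<close> to the affine span.  Up to a shear the squared distances are an affine
bijection of \<open>\<xi>\<close>, with constant Jacobian determinant \<open>2\<^sup>k\<^sup>-\<^sup>1 V\<close>, where \<open>V = simplex_vol\<close>; a fibre over
\<open>\<xi>\<close> is a sphere of radius \<open>r\<close>, and \<open>D\<^sub>x = r V / \<Prod>\<^sub>j t\<^sub>j\<close> is constant on it.  Replacing \<open>\<alpha>\<^sub>k\<^sub>0\<close> by \<open>r\<^sup>2\<close>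
turns \<open>d\<alpha> d\<beta>\<close> into \<open>d\<xi> d\<beta> / (2 |\<alpha>\<^sub>k\<^sub>0|)\<close> on each of the two half spaces, and \<open>d\<beta> / |\<alpha>\<^sub>k\<^sub>0|\<close> is the surface
measure of the hemisphere divided by \<open>r\<close>.  So the density with respect to \<open>d\<xi>\<close>, the sum of the two
fibre integrals, is \<open>V / (2 \<Prod>\<^sub>j t\<^sub>j) \<A>\<^sub>t f(x)\<close> (lemma \<open>avg_op_fiber\<close>), and the identity
\<open>averages_extension_identity\<close> follows by comparing \<open>dt = V / (2 \<Prod>\<^sub>j t\<^sub>j) d\<xi>\<close> with \<open>dv = \<kappa> d\<xi>\<close>.

Two analytic facts carry this computation.

First, surface measure is Hausdorff measure, defined through coverings.  It is a metric outer
measure, hence a measure on the Borel sets (\<open>measure_space_hausdorff\<close>).  In the full dimension it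
is Lebesgue measure (\<open>hausdorff_outer_eq_lborel\<close>): one inequality is the isodiametric inequality,
proved by Steiner symmetrization, and the other one is Vitali's covering theorem.  Near every point,
the graph of a hemisphere is mapped to flat space with bi-Lipschitz constant as close to \<open>1\<close> as
desired, which yields the area formula for hemispheres (\<open>emeasure_hemisphere\<close>).

Second, Plancherel's identity is needed for a density that is only known to be integrable, as an
equality in \<open>[0, \<infinity>]\<close>; Gaussian mollification and Fatou's lemma give it in this form
(\<open>plancherel_L1\<close>).
\<close>

section \<open>Hausdorff measure as a measure on the Borel sets\<close>

text \<open>
  The volume of an \<open>m\<close>-ball with the diameter of \<open>U\<close>, which is what a covering set contributes to the
  Hausdorff content.
\<close>

definition hcost :: "nat \<Rightarrow> 'a::metric_space set \<Rightarrow> ennreal" where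
  "hcost m U = (if U = {} then 0 else ennreal (unit_ball_vol (real m) * (diameter U / 2) ^ m))"

lemma hcost_empty [simp]: "hcost m {} = 0"
  by (simp add: hcost_def)

lemma hausdorff_content_alt:
  "hausdorff_content m \<delta> A =
     (INF U \<in> {U. (\<forall>i. bounded (U i) \<and> diameter (U i) \<le> \<delta>) \<and> A \<subseteq> (\<Union>i. U i)}. \<Sum>i. hcost m (U i))"
  by (simp add: hausdorff_content_def hcost_def)

lemma hausdorff_content_le:
  assumes "\<And>i. bounded (U i)" "\<And>i. diameter (U i) \<le> \<delta>" "A \<subseteq> (\<Union>i. U i)"
  shows "hausdorff_content m \<delta> A \<le> (\<Sum>i. hcost m (U i))"
  unfolding hausdorff_content_alt by (rule INF_lower) (use assms in auto)

lemma hausdorff_content_ge: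
  assumes "\<And>U. \<lbrakk>\<And>i. bounded (U i); \<And>i. diameter (U i) \<le> \<delta>; A \<subseteq> (\<Union>i. U i)\<rbrakk> \<Longrightarrow> c \<le> (\<Sum>i. hcost m (U i))"
  shows "c \<le> hausdorff_content m \<delta> A"
  unfolding hausdorff_content_alt by (rule INF_greatest) (use assms in auto)

lemma hausdorff_content_mono:
  assumes "A \<subseteq> B" "\<delta> \<le> \<delta>'"
  shows "hausdorff_content m \<delta>' A \<le> hausdorff_content m \<delta> B"
proof (rule hausdorff_content_ge)
  fix U :: "nat \<Rightarrow> 'a set"
  assume "\<And>i. bounded (U i)" "\<And>i. diameter (U i) \<le> \<delta>" "B \<subseteq> (\<Union>i. U i)"
  then show "hausdorff_content m \<delta>' A \<le> (\<Sum>i. hcost m (U i))"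
    using assms by (intro hausdorff_content_le) (auto intro: order_trans)
qed

lemma hausdorff_content_le_outer:
  "0 < \<delta> \<Longrightarrow> hausdorff_content m \<delta> A \<le> hausdorff_outer m A"
  unfolding hausdorff_outer_def by (rule SUP_upper) auto

lemma hausdorff_outer_le:
  "(\<And>\<delta>. 0 < \<delta> \<Longrightarrow> hausdorff_content m \<delta> A \<le> c) \<Longrightarrow> hausdorff_outer m A \<le> c"
  unfolding hausdorff_outer_def by (rule SUP_least) auto

lemma hausdorff_outer_mono: "A \<subseteq> B \<Longrightarrow> hausdorff_outer m A \<le> hausdorff_outer m B"
  by (rule hausdorff_outer_le) (meson hausdorff_content_le_outer hausdorff_content_mono order_refl order_trans)

lemma hausdorff_outer_empty [simp]: "hausdorff_outer m {} = 0"
proof -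
  have "hausdorff_content m \<delta> {} \<le> (\<Sum>i::nat. hcost m {})" if "0 < \<delta>" for \<delta>
    using that hausdorff_content_le[of "\<lambda>_. {}" \<delta> "{}" m] by simp
  then show ?thesis
    by (intro antisym hausdorff_outer_le) auto
qed

text \<open>
  Near-optimal coverings of the \<open>A i\<close>, with errors that add up to \<open>e\<close>, are merged into one sequence by
  a pairing of the indices.
\<close>

lemma hausdorff_content_countably_subadditive:
  "hausdorff_content m \<delta> (\<Union>i::nat. A i) \<le> (\<Sum>i. hausdorff_content m \<delta> (A i))"
proof (rule ennreal_le_epsilon)
  fix e :: real assume e: "0 < e" and fin: "(\<Sum>i. hausdorff_content m \<delta> (A i)) < top"
  have "\<exists>U. (\<forall>j. bounded (U j) \<and> diameter (U j) \<le> \<delta>) \<and> A i \<subseteq> (\<Union>j. U j) \<and>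
      (\<Sum>j. hcost m (U j)) \<le> hausdorff_content m \<delta> (A i) + ennreal (e * (1/2) ^ Suc i)" for i
  proof -
    have "hausdorff_content m \<delta> (A i) \<noteq> top"
      using ennreal_suminf_lessD[OF fin, of i] by simp
    define c where "c = hausdorff_content m \<delta> (A i) + ennreal (e * (1/2) ^ Suc i)"
    have "hausdorff_content m \<delta> (A i) + 0 < c"
      unfolding c_def using e \<open>hausdorff_content m \<delta> (A i) \<noteq> top\<close>
      by (subst ennreal_add_left_cancel_less) (auto simp: less_top)
    then have "hausdorff_content m \<delta> (A i) < c" by simp
    then obtain U :: "nat \<Rightarrow> 'a set" where U: "\<forall>j. bounded (U j) \<and> diameter (U j) \<le> \<delta>" "A i \<subseteq> (\<Union>j. U j)"
        "(\<Sum>j. hcost m (U j)) < c"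
      unfolding hausdorff_content_alt INF_less_iff by blast
    have "(\<Sum>j. hcost m (U j)) \<le> c" using U(3) by (rule less_imp_le)
    with U(1,2) show ?thesis unfolding c_def by (intro exI[of _ U] conjI)
  qed
  then obtain U where U: "\<And>i j. bounded (U i j)" "\<And>i j. diameter (U i j) \<le> \<delta>" 
      "\<And>i. A i \<subseteq> (\<Union>j. U i j)"
      "\<And>i. (\<Sum>j. hcost m (U i j)) \<le> hausdorff_content m \<delta> (A i) + ennreal (e * (1/2) ^ Suc i)"
    by metis
  define V where "V p = (case prod_decode p of (i, j) \<Rightarrow> U i j)" for p
  have "(\<Union>i. A i) \<subseteq> (\<Union>p. V p)"
  proof
    fix x assume "x \<in> (\<Union>i. A i)"
    then obtain i j where "x \<in> U i j" using U(3) by blast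
    then have "x \<in> V (prod_encode (i, j))" by (simp add: V_def)
    then show "x \<in> (\<Union>p. V p)" by blast
  qed
  then have "hausdorff_content m \<delta> (\<Union>i. A i) \<le> (\<Sum>p. hcost m (V p))"
    using U by (intro hausdorff_content_le) (auto simp: V_def split: prod.split)
  also have "\<dots> = (\<Sum>i. \<Sum>j. hcost m (U i j))"
    using suminf_ennreal_2dimen[of "\<lambda>i. \<Sum>j. hcost m (U i j)" "\<lambda>(i,j). hcost m (U i j)"]
    by (simp add: V_def split_def)
  also have "\<dots> \<le> (\<Sum>i. hausdorff_content m \<delta> (A i) + ennreal (e * (1/2) ^ Suc i))"
    by (intro suminf_le U(4)) auto
  also have "\<dots> = (\<Sum>i. hausdorff_content m \<delta> (A i)) + (\<Sum>i. ennreal (e * (1/2) ^ Suc i))"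
    by (subst suminf_add) auto
  also have "(\<Sum>i. ennreal (e * (1/2) ^ Suc i)) = ennreal e"
  proof -
    have "(\<lambda>i. e * (1/2) ^ Suc i) sums (e * 1)"
      by (intro sums_mult power_half_series)
    then show ?thesis using e by (intro suminf_ennreal_eq) auto
  qed
  finally show "hausdorff_content m \<delta> (\<Union>i. A i) \<le> (\<Sum>i. hausdorff_content m \<delta> (A i)) + ennreal e" .
qed

lemma hausdorff_outer_countably_subadditive:
  "hausdorff_outer m (\<Union>i::nat. A i) \<le> (\<Sum>i. hausdorff_outer m (A i))"
proof (rule hausdorff_outer_le)
  fix \<delta> :: real assume "0 < \<delta>"
  then show "hausdorff_content m \<delta> (\<Union>i. A i) \<le> (\<Sum>i. hausdorff_outer m (A i))"
    by (intro order_trans[OF hausdorff_content_countably_subadditive] suminf_le hausdorff_content_le_outer) auto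
qed

lemma hausdorff_outer_Un_le:
  "hausdorff_outer m (A \<union> B) \<le> hausdorff_outer m A + hausdorff_outer m B"
proof -
  have "A \<union> B = (\<Union>i. binaryset A B i)" by (simp add: UN_binaryset_eq)
  then have "hausdorff_outer m (A \<union> B) \<le> (\<Sum>i. hausdorff_outer m (binaryset A B i))"
    using hausdorff_outer_countably_subadditive[where A = "binaryset A B"] by simp
  also have "\<dots> = hausdorff_outer m A + hausdorff_outer m B"
    by (rule suminf_binaryset_eq) simp
  finally show ?thesis .
qed

lemma outer_measure_space_hausdorff: "outer_measure_space (Pow UNIV) (hausdorff_outer m)"
  unfolding outer_measure_space_def positive_def increasing_def countably_subadditive_def
  using hausdorff_outer_countably_subadditive hausdorff_outer_mono by auto

text \<open>
  Once \<open>\<delta>\<close> is below the gap \<open>\<eta>\<close>, no covering set meets both \<open>A\<close> and \<open>B\<close>, so every admissible covering of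
  the union splits into coverings of the two parts.
\<close>

lemma hausdorff_outer_separated:
  assumes "0 < \<eta>" "\<And>x y. x \<in> A \<Longrightarrow> y \<in> B \<Longrightarrow> \<eta> \<le> dist x y"
  shows "hausdorff_outer m A + hausdorff_outer m B \<le> hausdorff_outer m (A \<union> B)"
proof -
  have *: "hausdorff_content m \<delta> A + hausdorff_content m \<delta> B \<le> hausdorff_content m \<delta> (A \<union> B)"
    if \<delta>: "0 < \<delta>" "\<delta> < \<eta>" for \<delta>
  proof (rule hausdorff_content_ge)
    fix U :: "nat \<Rightarrow> 'a set"
    assume U: "\<And>i. bounded (U i)" "\<And>i. diameter (U i) \<le> \<delta>" "A \<union> B \<subseteq> (\<Union>i. U i)"
    define V where "V i = (if U i \<inter> A = {} then {} else U i)" for i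
    define W where "W i = (if U i \<inter> B = {} then {} else U i)" for i
    have disj: "V i = {} \<or> W i = {}" for i
    proof (rule ccontr)
      assume "\<not> (V i = {} \<or> W i = {})"
      then obtain a b where "a \<in> U i" "a \<in> A" "b \<in> U i" "b \<in> B"
        by (auto simp: V_def W_def split: if_splits)
      then have "\<eta> \<le> dist a b" "dist a b \<le> diameter (U i)"
        using assms U(1) by (auto intro: diameter_bounded_bound)
      then show False using U(2)[of i] \<delta> by linarith
    qed
    have "A \<subseteq> (\<Union>i. V i)"
    proof
      fix x assume "x \<in> A"
      then obtain i where "x \<in> U i" using U(3) by blast
      then have "x \<in> V i" using \<open>x \<in> A\<close> by (auto simp: V_def)
      then show "x \<in> (\<Union>i. V i)" by blast
    qed
    then have A: "hausdorff_content m \<delta> A \<le> (\<Sum>i. hcost m (V i))"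
      using U \<delta> by (intro hausdorff_content_le) (auto simp: V_def)
    have "B \<subseteq> (\<Union>i. W i)"
    proof
      fix x assume "x \<in> B"
      then obtain i where "x \<in> U i" using U(3) by blast
      then have "x \<in> W i" using \<open>x \<in> B\<close> by (auto simp: W_def)
      then show "x \<in> (\<Union>i. W i)" by blast
    qed
    then have B: "hausdorff_content m \<delta> B \<le> (\<Sum>i. hcost m (W i))"
      using U \<delta> by (intro hausdorff_content_le) (auto simp: W_def)
    have "(\<Sum>i. hcost m (V i)) + (\<Sum>i. hcost m (W i)) = (\<Sum>i. hcost m (V i) + hcost m (W i))"
      by (rule suminf_add) auto
    also have "\<dots> \<le> (\<Sum>i. hcost m (U i))"
    proof (rule suminf_le)
      fix i show "hcost m (V i) + hcost m (W i) \<le> hcost m (U i)"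
        using disj[of i] unfolding V_def W_def by (cases "U i \<inter> A = {}"; cases "U i \<inter> B = {}") auto
    qed auto
    finally show "hausdorff_content m \<delta> A + hausdorff_content m \<delta> B \<le> (\<Sum>i. hcost m (U i))"
      using add_mono[OF A B] by (meson order_trans)
  qed
  have "hausdorff_outer m A + hausdorff_outer m B
      = (SUP \<delta>\<in>{0<..}. hausdorff_content m \<delta> A + hausdorff_content m \<delta> B)"
    unfolding hausdorff_outer_def
  proof (rule SUP_add_directed_ennreal[symmetric])
    fix i j :: real assume ij: "i \<in> {0<..}" "j \<in> {0<..}"
    then show "\<exists>k\<in>{0<..}. hausdorff_content m i A + hausdorff_content m j B
          \<le> hausdorff_content m k A + hausdorff_content m k B"
      by (intro bexI[of _ "min i j"] add_mono hausdorff_content_mono) auto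
  qed
  also have "\<dots> \<le> hausdorff_outer m (A \<union> B)"
  proof (rule SUP_least)
    fix \<delta> :: real assume \<delta>: "\<delta> \<in> {0<..}"
    define \<delta>' where "\<delta>' = min \<delta> (\<eta>/2)"
    have d': "0 < \<delta>'" "\<delta>' < \<eta>" using assms \<delta> by (auto simp: \<delta>'_def)
    have "hausdorff_content m \<delta> A + hausdorff_content m \<delta> B
        \<le> hausdorff_content m \<delta>' A + hausdorff_content m \<delta>' B"
      by (intro add_mono hausdorff_content_mono) (auto simp: \<delta>'_def)
    also have "\<dots> \<le> hausdorff_content m \<delta>' (A \<union> B)" by (rule *[OF d'])
    also have "\<dots> \<le> hausdorff_outer m (A \<union> B)" by (rule hausdorff_content_le_outer[OF d'(1)])
    finally show "hausdorff_content m \<delta> A + hausdorff_content m \<delta> B \<le> hausdorff_outer m (A \<union> B)" .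
  qed
  finally show ?thesis .
qed

lemma hausdorff_outer_separated_sum:
  fixes A :: "nat \<Rightarrow> 'a::metric_space set"
  assumes "\<And>i j. i < j \<Longrightarrow> \<exists>\<eta>>0. \<forall>x\<in>A i. \<forall>y\<in>A j. \<eta> \<le> dist x y"
  shows "(\<Sum>i<N. hausdorff_outer m (A i)) \<le> hausdorff_outer m (\<Union>i<N. A i)"
proof (induction N)
  case (Suc N)
  have "\<exists>\<eta>>0. \<forall>x\<in>(\<Union>i<n. A i). \<forall>y\<in>A N. \<eta> \<le> dist x y" if "n \<le> N" for n
    using that
  proof (induction n)
    case 0 then show ?case by (auto intro: exI[of _ 1])
  next
    case (Suc n)
    obtain e1 where e1: "e1 > 0" "\<forall>x\<in>(\<Union>i<n. A i). \<forall>y\<in>A N. e1 \<le> dist x y"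
      using Suc by auto
    obtain e2 where e2: "e2 > 0" "\<forall>x\<in>A n. \<forall>y\<in>A N. e2 \<le> dist x y"
      using assms[of n N] Suc by auto
    show ?case
      using e1 e2 by (intro exI[of _ "min e1 e2"]) (auto simp: lessThan_Suc min_le_iff_disj)
  qed
  then obtain \<eta> where \<eta>: "\<eta> > 0" "\<And>x y. x \<in> (\<Union>i<N. A i) \<Longrightarrow> y \<in> A N \<Longrightarrow> \<eta> \<le> dist x y" by blast
  have "(\<Sum>i<Suc N. hausdorff_outer m (A i)) \<le> hausdorff_outer m (\<Union>i<N. A i) + hausdorff_outer m (A N)"
    using Suc by (simp add: add_mono)
  also have "\<dots> \<le> hausdorff_outer m ((\<Union>i<N. A i) \<union> A N)"
    by (rule hausdorff_outer_separated[OF \<eta>])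
  finally show ?case by (simp add: lessThan_Suc Un_commute)
qed simp

text \<open>
  The part of \<open>A - C\<close> at distance at least \<open>1/(n+1)\<close> from \<open>C\<close> is separated from \<open>C\<close>, so it remains to
  see that what is left out has small measure.  It is a union of shells, each defined by two
  consecutive bounds on the distance to \<open>C\<close>.  Shells whose indices differ by at least two are
  separated, so those with even indices have total measure at most that of \<open>A\<close>, and likewise
  those with odd indices.  The shells therefore form a convergent series, and its tails tend to zero.
\<close>

lemma hausdorff_outer_closed_caratheodory:
  fixes C :: "'a::metric_space set"
  assumes "closed C"
  shows "hausdorff_outer m (A \<inter> C) + hausdorff_outer m (A - C) = hausdorff_outer m A"
proof (rule antisym)
  show "hausdorff_outer m A \<le> hausdorff_outer m (A \<inter> C) + hausdorff_outer m (A - C)"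
    using hausdorff_outer_Un_le[of m "A \<inter> C" "A - C"] by (simp add: Un_Diff_Int Int_commute sup_commute)
  let ?H = "hausdorff_outer m"
  show "?H (A \<inter> C) + ?H (A - C) \<le> ?H A"
  proof (cases "C = {} \<or> ?H A = top")
    case True then show ?thesis by auto
  next
    case False
    then have Cne: "C \<noteq> {}" and fin: "?H A \<noteq> top" by auto
    define An where "An n = {x\<in>A. infdist x C \<ge> 1 / real (Suc n)}" for n
    define R where "R n = {x\<in>A. infdist x C < 1 / real (Suc n) \<and> infdist x C \<ge> 1 / real (Suc (Suc n))}" for n
    have sub: "An n \<subseteq> A" "R n \<subseteq> A" for n by (auto simp: An_def R_def)
    have infd: "infdist x C \<le> infdist y C + dist x y" for x y
      by (simp add: infdist_triangle)
    have Rsep: "\<exists>\<eta>>0. \<forall>x\<in>R i. \<forall>y\<in>R j. \<eta> \<le> dist x y" if "i + 2 \<le> j" for i j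
    proof (intro exI[of _ "1 / real (i+2) - 1 / real (i+3)"] conjI ballI)
      show "0 < 1 / real (i+2) - 1 / real (i+3)" by (simp add: frac_less2)
      fix x y assume "x \<in> R i" "y \<in> R j"
      then have "infdist x C \<ge> 1 / real (i+2)" "infdist y C < 1 / real (Suc j)" by (auto simp: R_def)
      moreover have "1 / real (Suc j) \<le> 1 / real (i+3)" using that by (intro divide_left_mono) auto
      ultimately show "1 / real (i+2) - 1 / real (i+3) \<le> dist x y" using infd[of x y] by linarith
    qed
    have evod: "(\<Sum>i. ?H (R (2*i + c))) \<le> ?H A" for c
    proof (rule suminf_le_const)
      fix N
      have "(\<Sum>i<N. ?H (R (2*i + c))) \<le> ?H (\<Union>i<N. R (2*i + c))"
        by (rule hausdorff_outer_separated_sum) (rule Rsep, simp)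
      also have "\<dots> \<le> ?H A" using sub by (intro hausdorff_outer_mono) blast
      finally show "(\<Sum>i<N. ?H (R (2*i + c))) \<le> ?H A" .
    qed simp
    have "(\<Sum>i. ?H (R i)) \<le> ?H A + ?H A"
    proof (rule suminf_le_const)
      fix N
      have "(\<Sum>i<N. ?H (R i)) \<le> (\<Sum>i<2*N. ?H (R i))" by (rule sum_mono2) auto
      also have "(\<Sum>i<2*N. ?H (R i)) = (\<Sum>i<N. ?H (R (2*i + 0))) + (\<Sum>i<N. ?H (R (2*i + 1)))"
        by (induction N) (auto simp: algebra_simps)
      also have "\<dots> \<le> ?H A + ?H A"
        by (intro add_mono order_trans[OF sum_le_suminf evod]) auto
      finally show "(\<Sum>i<N. ?H (R i)) \<le> ?H A + ?H A" .
    qed simp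
    then have Rfin: "(\<Sum>i. ?H (R i)) \<noteq> top"
      using fin by (metis ennreal_add_eq_top top_unique)
    have step: "?H (A \<inter> C) + ?H (A - C) \<le> ?H A + (\<Sum>i. ?H (R (i + n)))" for n
    proof -
      have "A - C \<subseteq> An n \<union> (\<Union>i. R (i + n))"
      proof
        fix x assume x: "x \<in> A - C"
        then have pos: "0 < infdist x C"
          using assms Cne by (simp add: infdist_pos_not_in_closed)
        show "x \<in> An n \<union> (\<Union>i. R (i + n))"
        proof (cases "x \<in> An n")
          case False
          then have lt: "infdist x C < 1 / real (Suc n)" using x by (auto simp: An_def)
          define P where "P k \<longleftrightarrow> infdist x C \<ge> 1 / real (Suc (Suc (k + n)))" for k
          obtain k0 where "1 / real (Suc k0) < infdist x C" using pos nat_approx_posE by metis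
          moreover have "1 / real (Suc (Suc (k0 + n))) \<le> 1 / real (Suc k0)" by (intro divide_left_mono) auto
          ultimately have ex: "P k0" by (simp add: P_def)
          define k where "k = (LEAST k. P k)"
          have Pk: "P k" unfolding k_def using ex by (rule LeastI)
          have "infdist x C < 1 / real (Suc (k + n))"
          proof (cases k)
            case 0 then show ?thesis using lt by simp
          next
            case (Suc k')
            then have "\<not> P k'" using not_less_Least[of k' P] by (simp add: k_def)
            then show ?thesis using Suc by (simp add: P_def)
          qed
          then have "x \<in> R (k + n)" using Pk x by (auto simp: R_def P_def)
          then show ?thesis by blast
        qed simp
      qed
      then have "?H (A - C) \<le> ?H (An n \<union> (\<Union>i. R (i + n)))" by (rule hausdorff_outer_mono)
      also have "\<dots> \<le> ?H (An n) + (\<Sum>i. ?H (R (i + n)))"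
        by (rule order_trans[OF hausdorff_outer_Un_le]) (intro add_left_mono hausdorff_outer_countably_subadditive)
      finally have 1: "?H (A - C) \<le> ?H (An n) + (\<Sum>i. ?H (R (i + n)))" .
      have "?H (A \<inter> C) + ?H (An n) \<le> ?H ((A \<inter> C) \<union> An n)"
      proof (rule hausdorff_outer_separated)
        show "0 < 1 / real (Suc n)" by simp
        fix x y assume "x \<in> A \<inter> C" "y \<in> An n"
        then have "infdist x C = 0" "1 / real (Suc n) \<le> infdist y C" by (auto simp: An_def)
        then show "1 / real (Suc n) \<le> dist x y" using infd[of y x] by (simp add: dist_commute)
      qed
      also have "\<dots> \<le> ?H A" using sub by (intro hausdorff_outer_mono) auto
      finally have 2: "?H (A \<inter> C) + ?H (An n) \<le> ?H A" .
      have "?H (A \<inter> C) + ?H (A - C) \<le> (?H (A \<inter> C) + ?H (An n)) + (\<Sum>i. ?H (R (i + n)))"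
        using add_left_mono[OF 1, of "?H (A \<inter> C)"] by (simp add: add.assoc)
      also have "\<dots> \<le> ?H A + (\<Sum>i. ?H (R (i + n)))" by (rule add_right_mono[OF 2])
      finally show ?thesis .
    qed
    have "(\<lambda>n. (\<Sum>i. ?H (R (i + n)))) \<longlonglongrightarrow> 0"
    proof -
      define r where "r i = enn2real (?H (R i))" for i
      have "?H (R i) < top" for i
        using Rfin by (intro ennreal_suminf_lessD[where f = "\<lambda>i. ?H (R i)"]) (simp add: less_top)
      then have r: "\<And>i. ?H (R i) = ennreal (r i)" "\<And>i. 0 \<le> r i"
        by (auto simp: r_def)
      have "summable r" using Rfin r by (intro summable_suminf_not_top) auto
      then have "(\<lambda>n. \<Sum>i. r (i + n)) \<longlonglongrightarrow> 0"
        by (rule suminf_exist_split2)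
      moreover have "(\<Sum>i. ?H (R (i + n))) = ennreal (\<Sum>i. r (i + n))" for n
        using r \<open>summable r\<close> by (simp add: suminf_ennreal2 summable_ignore_initial_segment)
      ultimately show ?thesis using tendsto_ennrealI by fastforce
    qed
    then have "(\<lambda>n. ?H A + (\<Sum>i. ?H (R (i + n)))) \<longlonglongrightarrow> ?H A + 0"
      by (intro tendsto_add) auto
    then have lim: "(\<lambda>n. ?H A + (\<Sum>i. ?H (R (i + n)))) \<longlonglongrightarrow> ?H A" by simp
    show ?thesis by (rule LIMSEQ_le_const[OF lim]) (use step in blast)
  qed
qed

text \<open>
  Caratheodory's theorem: the measurable sets form a sigma-algebra, which contains the closed sets and hence all
  Borel sets.
\<close>

lemma measure_space_hausdorff: "measure_space UNIV (sets borel) (hausdorff_outer m)"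
proof -
  let ?L = "lambda_system UNIV (Pow UNIV) (hausdorff_outer m :: 'a set \<Rightarrow> _)"
  interpret sigma_algebra UNIV "Pow UNIV :: 'a set set" by (rule sigma_algebra_Pow)
  have ms: "measure_space UNIV ?L (hausdorff_outer m)"
    by (rule caratheodory_lemma[OF outer_measure_space_hausdorff])
  then interpret L: sigma_algebra UNIV ?L by (simp add: measure_space_def)
  have "closed C \<Longrightarrow> C \<in> ?L" for C
    by (simp add: lambda_system_def hausdorff_outer_closed_caratheodory Int_commute flip: Diff_eq Compl_eq_Diff_UNIV)
  then have "Collect closed \<subseteq> ?L" by auto
  then have "sets borel \<subseteq> ?L"
    using L.sigma_sets_subset[of "Collect closed"] by (auto simp: borel_eq_closed)
  with ms show ?thesis
    by (auto simp: measure_space_def positive_def countably_additive_def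
        intro: sets.sigma_algebra_axioms[of borel, simplified])
qed

lemma sets_hausdorff_measure [measurable_cong, simp]: "sets (hausdorff_measure m) = sets borel"
  unfolding hausdorff_measure_def
  by (metis sets.sets_measure_of_eq space_borel)

lemma space_hausdorff_measure [simp]: "space (hausdorff_measure m) = UNIV"
  unfolding hausdorff_measure_def by (rule space_measure_of) auto

lemma emeasure_hausdorff_measure:
  "A \<in> sets borel \<Longrightarrow> emeasure (hausdorff_measure m) A = hausdorff_outer m A"
  using measure_space_hausdorff[of m, where 'a = 'a]
  unfolding hausdorff_measure_def measure_space_def
  by (intro emeasure_measure_of_sigma) auto

text \<open>
  The image of a covering set has diameter at most \<open>L\<close> times the original one, so coverings at scale
  \<open>\<delta> / L\<close> are carried to coverings at scale \<open>\<delta>\<close> and each contribution grows by at most \<open>L\<^sup>m\<close>.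
\<close>

lemma hausdorff_outer_lipschitz_image:
  fixes f :: "'a::metric_space \<Rightarrow> 'b::metric_space"
  assumes L: "0 < L" and f: "\<And>x y. x \<in> E \<Longrightarrow> y \<in> E \<Longrightarrow> dist (f x) (f y) \<le> L * dist x y"
  shows "hausdorff_outer m (f ` E) \<le> ennreal (L ^ m) * hausdorff_outer m E"
proof (rule hausdorff_outer_le)
  fix \<delta> :: real assume \<delta>: "0 < \<delta>"
  let ?c = "ennreal (inverse (L ^ m))"
  have c: "ennreal (L ^ m) * ?c = 1" using L by (simp flip: ennreal_mult')
  have "?c * hausdorff_content m \<delta> (f ` E) \<le> hausdorff_content m (\<delta> / L) E"
  proof (rule hausdorff_content_ge)
    fix U :: "nat \<Rightarrow> 'a set"
    assume U: "\<And>i. bounded (U i)" "\<And>i. diameter (U i) \<le> \<delta> / L" "E \<subseteq> (\<Union>i. U i)"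
    define V where "V i = f ` (U i \<inter> E)" for i
    have dU: "dist a b \<le> L * diameter (U i)" if ab: "a \<in> V i" "b \<in> V i" for a b i
    proof -
      obtain x y where xy: "x \<in> U i" "x \<in> E" "y \<in> U i" "y \<in> E" "a = f x" "b = f y"
        using ab unfolding V_def by blast
      have "dist a b \<le> L * dist x y" using f xy by simp
      also have "\<dots> \<le> L * diameter (U i)"
        using L xy U(1) by (intro mult_left_mono diameter_bounded_bound) auto
      finally show ?thesis .
    qed
    have V1: "bounded (V i)" for i
      unfolding bounded_two_points using dU by blast
    have V2: "diameter (V i) \<le> L * diameter (U i)" for i
    proof (cases "V i = {}")
      case True
      then show ?thesis using L diameter_ge_0[OF U(1), of i] by simp
    next
      case False
      then show ?thesis unfolding diameter_def[of "V i"] using dU by (auto intro!: cSUP_least)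
    qed
    have "hausdorff_content m \<delta> (f ` E) \<le> (\<Sum>i. hcost m (V i))"
    proof (rule hausdorff_content_le)
      show "diameter (V i) \<le> \<delta>" for i
        using V2[of i] U(2)[of i] L by (simp add: field_simps)
      show "f ` E \<subseteq> (\<Union>i. V i)" using U(3) unfolding V_def by blast
    qed (rule V1)
    also have "\<dots> \<le> (\<Sum>i. ennreal (L ^ m) * hcost m (U i))"
    proof (rule suminf_le)
      fix i
      show "hcost m (V i) \<le> ennreal (L ^ m) * hcost m (U i)"
      proof (cases "V i = {}")
        case False
        then have "U i \<noteq> {}" by (auto simp: V_def)
        have "(diameter (V i) / 2) ^ m \<le> (L * diameter (U i) / 2) ^ m"
          using V2[of i] diameter_ge_0[OF V1[of i]] by (intro power_mono) auto
        then have "unit_ball_vol (real m) * (diameter (V i) / 2) ^ m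
            \<le> unit_ball_vol (real m) * (L * diameter (U i) / 2) ^ m"
          by (intro mult_left_mono) auto
        also have "\<dots> = L ^ m * (unit_ball_vol (real m) * (diameter (U i) / 2) ^ m)"
          by (simp add: power_mult_distrib power_divide)
        finally show ?thesis
          using False \<open>U i \<noteq> {}\<close> L by (simp add: hcost_def ennreal_mult'[symmetric] ennreal_leI)
      qed simp
    qed auto
    also have "\<dots> = ennreal (L ^ m) * (\<Sum>i. hcost m (U i))"
      by (rule ennreal_suminf_cmult)
    finally have "?c * hausdorff_content m \<delta> (f ` E) \<le> ?c * (ennreal (L ^ m) * (\<Sum>i. hcost m (U i)))"
      by (rule mult_left_mono) simp
    also have "\<dots> = (\<Sum>i. hcost m (U i))" using c by (simp add: mult.assoc[symmetric] mult.commute)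
    finally show "?c * hausdorff_content m \<delta> (f ` E) \<le> (\<Sum>i. hcost m (U i))" .
  qed
  also have "\<dots> \<le> hausdorff_outer m E" using \<delta> L by (intro hausdorff_content_le_outer) auto
  finally have "ennreal (L ^ m) * (?c * hausdorff_content m \<delta> (f ` E)) \<le> ennreal (L ^ m) * hausdorff_outer m E"
    by (rule mult_left_mono) simp
  then show "hausdorff_content m \<delta> (f ` E) \<le> ennreal (L ^ m) * hausdorff_outer m E"
    using c by (simp add: mult.assoc[symmetric])
qed

section \<open>Steiner symmetrization and the isodiametric inequality\<close>

text \<open>
  Lebesgue measure is the product of one-dimensional measures over the basis; the coordinate \<open>b\<close> is
  integrated first.
\<close>

lemma nn_integral_lborel_slices:
  fixes F :: "'a::euclidean_space \<Rightarrow> ennreal"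
  assumes F [measurable]: "F \<in> borel_measurable borel" and b: "b \<in> Basis"
  shows "(\<integral>\<^sup>+x. F x \<partial>lborel) =
    (\<integral>\<^sup>+z. (\<integral>\<^sup>+s. F ((\<Sum>c\<in>Basis - {b}. z c *\<^sub>R c) + s *\<^sub>R b) \<partial>lborel) \<partial>(\<Pi>\<^sub>M c\<in>Basis - {b}. lborel))"
proof -
  interpret product_sigma_finite "\<lambda>_::'a. lborel :: real measure" ..
  have ins: "insert b (Basis - {b}) = Basis" using b by auto
  have m: "(\<lambda>f. \<Sum>c\<in>Basis. f c *\<^sub>R c) \<in> (\<Pi>\<^sub>M c\<in>(Basis :: 'a set). lborel) \<rightarrow>\<^sub>M borel"
    by measurable
  have "(\<integral>\<^sup>+x. F x \<partial>lborel) = (\<integral>\<^sup>+f. F (\<Sum>c\<in>Basis. f c *\<^sub>R c) \<partial>(\<Pi>\<^sub>M c\<in>Basis. lborel))"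
    by (subst lborel_eq) (simp add: nn_integral_distr)
  also have "\<dots> = (\<integral>\<^sup>+f. F (\<Sum>c\<in>Basis. f c *\<^sub>R c) \<partial>(\<Pi>\<^sub>M c\<in>insert b (Basis - {b}). lborel))"
    by (simp only: ins)
  also have "\<dots> = (\<integral>\<^sup>+z. (\<integral>\<^sup>+s. F (\<Sum>c\<in>Basis. (z(b := s)) c *\<^sub>R c) \<partial>lborel) \<partial>(\<Pi>\<^sub>M c\<in>Basis - {b}. lborel))"
    by (rule product_nn_integral_insert) (use m ins in \<open>simp_all del: fun_upd_apply\<close>)
  also have "\<dots> = (\<integral>\<^sup>+z. (\<integral>\<^sup>+s. F ((\<Sum>c\<in>Basis - {b}. z c *\<^sub>R c) + s *\<^sub>R b) \<partial>lborel) \<partial>(\<Pi>\<^sub>M c\<in>Basis - {b}. lborel))"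
  proof -
    have "(\<Sum>c\<in>Basis. (z(b := s)) c *\<^sub>R c) = (\<Sum>c\<in>Basis - {b}. z c *\<^sub>R c) + s *\<^sub>R b" for z :: "'a \<Rightarrow> real" and s
      using b by (subst sum.remove[OF _ b]) (auto intro!: sum.cong simp: add.commute)
    then show ?thesis by simp
  qed
  finally show ?thesis .
qed

lemma emeasure_lborel_slices_cong:
  fixes A A' :: "'a::euclidean_space set"
  assumes [measurable]: "A \<in> sets borel" "A' \<in> sets borel" and b: "b \<in> Basis"
    and eq: "\<And>x. x \<bullet> b = 0 \<Longrightarrow>
      emeasure lborel {s. x + s *\<^sub>R b \<in> A} = emeasure lborel {s. x + s *\<^sub>R b \<in> A'}"
  shows "emeasure lborel A = emeasure lborel A'"
proof -
  have slice: "emeasure lborel B =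
      (\<integral>\<^sup>+z. emeasure lborel {s. (\<Sum>c\<in>Basis - {b}. z c *\<^sub>R c) + s *\<^sub>R b \<in> B} \<partial>(\<Pi>\<^sub>M c\<in>Basis - {b}. lborel))"
    if B [measurable]: "B \<in> sets borel" for B :: "'a set"
  proof -
    have "emeasure lborel B = (\<integral>\<^sup>+x. indicator B x \<partial>lborel)" by simp
    also have "\<dots> = (\<integral>\<^sup>+z. (\<integral>\<^sup>+s. indicator B ((\<Sum>c\<in>Basis - {b}. z c *\<^sub>R c) + s *\<^sub>R b) \<partial>lborel) \<partial>(\<Pi>\<^sub>M c\<in>Basis - {b}. lborel))"
      by (rule nn_integral_lborel_slices) (use b in measurable)
    also have "\<dots> = (\<integral>\<^sup>+z. (\<integral>\<^sup>+s. indicator {s. (\<Sum>c\<in>Basis - {b}. z c *\<^sub>R c) + s *\<^sub>R b \<in> B} s \<partial>lborel) \<partial>(\<Pi>\<^sub>M c\<in>Basis - {b}. lborel))"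
      by (simp add: indicator_def)
    also have "\<dots> = (\<integral>\<^sup>+z. emeasure lborel {s. (\<Sum>c\<in>Basis - {b}. z c *\<^sub>R c) + s *\<^sub>R b \<in> B} \<partial>(\<Pi>\<^sub>M c\<in>Basis - {b}. lborel))"
    proof -
      have "{s. w + s *\<^sub>R b \<in> B} \<in> sets lborel" for w
      proof -
        have "(\<lambda>s. w + s *\<^sub>R b) \<in> borel \<rightarrow>\<^sub>M borel" by measurable
        from measurable_sets[OF this B] show ?thesis by (simp add: vimage_def)
      qed
      then show ?thesis by simp
    qed
    finally show ?thesis .
  qed
  have "(\<Sum>c\<in>Basis - {b}. z c *\<^sub>R c) \<bullet> b = 0" for z :: "'a \<Rightarrow> real"
    using b by (auto simp: inner_sum_left inner_Basis intro!: sum.neutral)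
  then show ?thesis by (simp add: slice eq)
qed

text \<open>
  The intersection of \<open>A\<close> with the line through \<open>x\<close> in direction \<open>b\<close>, where the parameter is the
  \<open>b\<close>-coordinate itself; the slice is thus the same for all points \<open>x\<close> of that line.
\<close>

definition line_slice :: "'a::euclidean_space \<Rightarrow> 'a set \<Rightarrow> 'a \<Rightarrow> real set" where
  "line_slice b A x = {s. x + (s - x \<bullet> b) *\<^sub>R b \<in> A}"

text \<open>
  Steiner symmetrization: every slice in direction \<open>b\<close> is replaced by the centred open interval of the
  same length.
\<close>

definition steiner :: "'a::euclidean_space \<Rightarrow> 'a set \<Rightarrow> 'a set" where
  "steiner b A = {x. 2 * \<bar>x \<bullet> b\<bar> < measure lborel (line_slice b A x)}"

lemma line_slice_shift: "b \<in> Basis \<Longrightarrow> line_slice b A (x + t *\<^sub>R b) = line_slice b A x"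
  by (simp add: line_slice_def inner_add_left algebra_simps)

lemma line_slice_borel:
  assumes "A \<in> sets borel" shows "line_slice b A x \<in> sets borel"
proof -
  have "(\<lambda>s. x + (s - x \<bullet> b) *\<^sub>R b) \<in> borel \<rightarrow>\<^sub>M borel" by measurable
  from measurable_sets[OF this assms] show ?thesis by (simp add: vimage_def line_slice_def)
qed

lemma line_slice_bounded:
  assumes "b \<in> Basis" "bounded A" shows "bounded (line_slice b A x)"
proof -
  obtain M where M: "\<And>y. y \<in> A \<Longrightarrow> norm y \<le> M" using assms(2) bounded_iff by blast
  have "norm s \<le> M" if "s \<in> line_slice b A x" for s
  proof -
    have "(x + (s - x \<bullet> b) *\<^sub>R b) \<bullet> b = s" using assms(1) by (simp add: inner_add_left)
    then have "norm s \<le> norm (x + (s - x \<bullet> b) *\<^sub>R b)" using Basis_le_norm[OF assms(1)] by (metis real_norm_def)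
    then show ?thesis using M that by (force simp: line_slice_def)
  qed
  then show ?thesis using bounded_iff by blast
qed

lemma steiner_borel:
  fixes A :: "'a::euclidean_space set"
  assumes [measurable]: "A \<in> sets borel" shows "steiner b A \<in> sets borel"
proof -
  have [measurable]: "(\<lambda>p. fst p + (snd p - fst p \<bullet> b) *\<^sub>R b) \<in> (borel \<Otimes>\<^sub>M borel :: ('a \<times> real) measure) \<rightarrow>\<^sub>M borel"
    by measurable
  have Q: "{p. fst p + (snd p - fst p \<bullet> b) *\<^sub>R b \<in> A} \<in> sets (borel \<Otimes>\<^sub>M (lborel :: real measure))"
  proof -
    have "(\<lambda>p. fst p + (snd p - fst p \<bullet> b) *\<^sub>R b) -` A \<inter> space (borel \<Otimes>\<^sub>M borel :: ('a \<times> real) measure) \<in> sets (borel \<Otimes>\<^sub>M borel)"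
      by measurable
    moreover have "sets (borel \<Otimes>\<^sub>M (lborel :: real measure) :: ('a \<times> real) measure) = sets (borel \<Otimes>\<^sub>M borel)"
      by (rule sets_pair_measure_cong) auto
    ultimately show ?thesis by (simp add: vimage_def space_pair_measure)
  qed
  have "(\<lambda>x. emeasure lborel (Pair x -` {p. fst p + (snd p - fst p \<bullet> b) *\<^sub>R b \<in> A})) \<in> borel_measurable borel"
    by (rule lborel.measurable_emeasure_Pair[OF Q])
  then have [measurable]: "(\<lambda>x. emeasure lborel (line_slice b A x)) \<in> borel_measurable borel"
    by (simp add: line_slice_def vimage_def)
  show ?thesis unfolding steiner_def measure_def by measurable
qed

lemma emeasure_steiner:
  fixes A :: "'a::euclidean_space set"
  assumes A: "A \<in> sets borel" "bounded A" and b: "b \<in> Basis"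
  shows "emeasure lborel (steiner b A) = emeasure lborel A"
proof (rule emeasure_lborel_slices_cong[OF steiner_borel[OF A(1)] A(1) b])
  fix x :: 'a assume x: "x \<bullet> b = 0"
  let ?l = "measure lborel (line_slice b A x)"
  have "{s. x + s *\<^sub>R b \<in> A} = line_slice b A x" using x by (simp add: line_slice_def)
  moreover have "emeasure lborel (line_slice b A x) = ennreal ?l"
    using emeasure_bounded_finite[OF line_slice_bounded[OF b A(2)], of x]
    by (simp add: emeasure_eq_ennreal_measure less_top)
  moreover have "{s. x + s *\<^sub>R b \<in> steiner b A} = {- ?l / 2 <..< ?l / 2}"
    using x b by (auto simp: steiner_def line_slice_shift inner_add_left)
  ultimately show "emeasure lborel {s. x + s *\<^sub>R b \<in> steiner b A} = emeasure lborel {s. x + s *\<^sub>R b \<in> A}"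
    by simp
qed

lemma steiner_reflect_self:
  assumes "b \<in> Basis" "x \<in> steiner b A" shows "x - (2 * (x \<bullet> b)) *\<^sub>R b \<in> steiner b A"
  using assms line_slice_shift[of b A x "- (2 * (x \<bullet> b))"] by (simp add: steiner_def inner_diff_left)

text \<open>
  Symmetrization in direction \<open>b\<close> only depends on lengths of slices, and mirror images in a hyperplane
  parallel to \<open>b\<close> have slices of equal length.
\<close>

lemma steiner_reflect_other:
  assumes "b \<in> Basis" "c \<in> Basis" "b \<noteq> c"
    and sym: "\<And>x. x \<in> A \<Longrightarrow> x - (2 * (x \<bullet> c)) *\<^sub>R c \<in> A" and x: "x \<in> steiner b A"
  shows "x - (2 * (x \<bullet> c)) *\<^sub>R c \<in> steiner b A"
proof -
  let ?y = "x - (2 * (x \<bullet> c)) *\<^sub>R c"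
  have cb: "c \<bullet> b = 0" "b \<bullet> c = 0" using assms by (auto simp: inner_Basis)
  have yb: "?y \<bullet> b = x \<bullet> b" using cb by (simp add: inner_diff_left)
  have e: "?y + t *\<^sub>R b = (x + t *\<^sub>R b) - (2 * ((x + t *\<^sub>R b) \<bullet> c)) *\<^sub>R c" for t
    using cb by (simp add: inner_add_left)
  have e': "x + t *\<^sub>R b = (?y + t *\<^sub>R b) - (2 * ((?y + t *\<^sub>R b) \<bullet> c)) *\<^sub>R c" for t
    using cb assms(2) by (simp add: inner_add_left inner_diff_left)
  have "x + t *\<^sub>R b \<in> A \<longleftrightarrow> ?y + t *\<^sub>R b \<in> A" for t
    using sym[of "x + t *\<^sub>R b"] sym[of "?y + t *\<^sub>R b"] e[of t] e'[of t] by metis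
  then have "line_slice b A ?y = line_slice b A x" by (simp add: line_slice_def yb)
  then show ?thesis using x yb by (simp add: steiner_def)
qed

lemma measure_le_Sup_minus_Inf:
  fixes S :: "real set"
  assumes "S \<in> sets borel" "bounded S" "S \<noteq> {}"
  shows "measure lborel S \<le> Sup S - Inf S"
proof -
  have bd: "bdd_above S" "bdd_below S" using assms(2) by (auto simp: bounded_imp_bdd_above bounded_imp_bdd_below)
  have sub: "S \<subseteq> {Inf S .. Sup S}" using bd by (auto intro: cInf_lower cSup_upper)
  have "Inf S \<le> Sup S" using assms(3) bd by (simp add: cInf_le_cSup)
  moreover have "measure lborel S \<le> measure lborel {Inf S .. Sup S}"
    using sub assms(1) by (intro measure_mono_fmeasurable) (auto intro!: fmeasurableI simp: \<open>Inf S \<le> Sup S\<close>)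
  ultimately show ?thesis by simp
qed

text \<open>
  Let the slices of \<open>A\<close> over \<open>x\<close> and \<open>y\<close> have hulls \<open>[m, M]\<close> and \<open>[m', M']\<close>.  Since the slices are longer than
  \<open>2 |x \<bullet> b|\<close> and \<open>2 |y \<bullet> b|\<close>, one of the differences \<open>M - m'\<close> and \<open>M' - m\<close> exceeds
  \<open>|x \<bullet> b| + |y \<bullet> b|\<close>, because these two differences add up to the sum of the lengths of the hulls.
  Hence there are points of \<open>A\<close> over \<open>x\<close> and \<open>y\<close> whose \<open>b\<close>-coordinates are at least as far apart as those of \<open>x\<close>
  and \<open>y\<close>; the other coordinates agree, so their distance dominates that of \<open>x\<close> and \<open>y\<close>.
\<close>

lemma steiner_dist_le:
  fixes A :: "'a::euclidean_space set"
  assumes A: "A \<in> sets borel" "\<And>x y. x \<in> A \<Longrightarrow> y \<in> A \<Longrightarrow> dist x y \<le> d" and b: "b \<in> Basis"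
    and xy: "x \<in> steiner b A" "y \<in> steiner b A"
  shows "dist x y \<le> d"
proof -
  have bA: "bounded A" using A(2) bounded_two_points by blast
  let ?S = "line_slice b A"
  have pos: "2 * \<bar>x \<bullet> b\<bar> < measure lborel (?S x)" "2 * \<bar>y \<bullet> b\<bar> < measure lborel (?S y)"
    using xy by (auto simp: steiner_def)
  have ne: "?S x \<noteq> {}" "?S y \<noteq> {}" using pos by auto
  have le: "2 * \<bar>x \<bullet> b\<bar> < Sup (?S x) - Inf (?S x)" "2 * \<bar>y \<bullet> b\<bar> < Sup (?S y) - Inf (?S y)"
    using pos measure_le_Sup_minus_Inf[OF line_slice_borel[OF A(1)] line_slice_bounded[OF b bA]] ne
    by (meson order_less_le_trans)+
  have bd: "bdd_above (?S z)" "bdd_below (?S z)" for z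
    using line_slice_bounded[OF b bA, of z] by (auto simp: bounded_imp_bdd_above bounded_imp_bdd_below)
  have far: "\<exists>s\<in>?S u. \<exists>t\<in>?S v. M < s - t"
    if M: "M < Sup (?S u) - Inf (?S v)" and u: "?S u \<noteq> {}" and v: "?S v \<noteq> {}" for M u v
  proof -
    have "M + Inf (?S v) < Sup (?S u)" using M by simp
    then obtain s where s: "s \<in> ?S u" "M + Inf (?S v) < s" using less_cSup_iff[OF u bd(1)] by auto
    then have "Inf (?S v) < s - M" by simp
    then obtain t where "t \<in> ?S v" "t < s - M" using cInf_less_iff[OF v bd(2)] by auto
    then show ?thesis using s by force
  qed
  \<comment> \<open>The two right-hand sides add up to the sum of the lengths of the two hulls.\<close>
  have "\<bar>x \<bullet> b\<bar> + \<bar>y \<bullet> b\<bar> < Sup (?S x) - Inf (?S y) \<or> \<bar>x \<bullet> b\<bar> + \<bar>y \<bullet> b\<bar> < Sup (?S y) - Inf (?S x)"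
    using le by linarith
  then obtain s t where st: "s \<in> ?S x" "t \<in> ?S y" "\<bar>x \<bullet> b\<bar> + \<bar>y \<bullet> b\<bar> < \<bar>s - t\<bar>"
  proof
    assume "\<bar>x \<bullet> b\<bar> + \<bar>y \<bullet> b\<bar> < Sup (?S x) - Inf (?S y)"
    from far[OF this ne] obtain s t where "s \<in> ?S x" "t \<in> ?S y" "\<bar>x \<bullet> b\<bar> + \<bar>y \<bullet> b\<bar> < s - t" by blast
    then show ?thesis by (intro that[of s t]) auto
  next
    assume "\<bar>x \<bullet> b\<bar> + \<bar>y \<bullet> b\<bar> < Sup (?S y) - Inf (?S x)"
    from far[OF this ne(2,1)] obtain s t where "s \<in> ?S y" "t \<in> ?S x" "\<bar>x \<bullet> b\<bar> + \<bar>y \<bullet> b\<bar> < s - t" by blast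
    then show ?thesis by (intro that[of t s]) auto
  qed
  define w where "w = x \<bullet> b - y \<bullet> b"
  have "\<bar>w\<bar> \<le> \<bar>s - t\<bar>" using st(3) by (simp add: w_def)
  then have w2: "w\<^sup>2 \<le> (s - t)\<^sup>2" by (simp add: abs_le_square_iff)
  let ?p = "x + (s - x \<bullet> b) *\<^sub>R b" and ?q = "y + (t - y \<bullet> b) *\<^sub>R b"
  \<comment> \<open>The points of \<open>A\<close> over \<open>x\<close> and \<open>y\<close> differ from \<open>x\<close> and \<open>y\<close> only in the \<open>b\<close>-coordinate, by \<open>e\<close> in total.\<close>
  define e where "e = (s - t) - w"
  have pq: "?p - ?q = (x - y) + e *\<^sub>R b" by (simp add: e_def w_def algebra_simps)
  have "(norm (?p - ?q))\<^sup>2 = (norm (x - y))\<^sup>2 + 2 * e * w + e\<^sup>2"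
    unfolding pq power2_norm_eq_inner using b
    by (simp add: inner_add_left inner_add_right inner_commute w_def inner_diff_left power2_eq_square algebra_simps)
  also have "\<dots> = (norm (x - y))\<^sup>2 + (s - t)\<^sup>2 - w\<^sup>2"
    by (simp add: e_def power2_eq_square algebra_simps)
  finally have "(norm (x - y))\<^sup>2 \<le> (norm (?p - ?q))\<^sup>2" using w2 by linarith
  then have "dist x y \<le> dist ?p ?q" by (simp add: dist_norm)
  also have "\<dots> \<le> d" using st by (intro A(2)) (auto simp: line_slice_def)
  finally show ?thesis .
qed

text \<open>
  Symmetrizing in all basis directions one after the other preserves the symmetries already obtained
  (\<open>steiner_reflect_other\<close>), and the product of the reflections in all coordinate hyperplanes is
  the point reflection.
\<close>

lemma steiner_symmetrization:
  fixes A :: "'a::euclidean_space set"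
  assumes A: "A \<in> sets borel" "\<And>x y. x \<in> A \<Longrightarrow> y \<in> A \<Longrightarrow> dist x y \<le> d"
  obtains A' :: "'a set" where "A' \<in> sets borel" "\<And>x y. x \<in> A' \<Longrightarrow> y \<in> A' \<Longrightarrow> dist x y \<le> d"
    "emeasure lborel A' = emeasure lborel A" "\<And>x. x \<in> A' \<Longrightarrow> - x \<in> A'"
proof -
  have "\<exists>A' :: 'a set. A' \<in> sets borel \<and> (\<forall>x\<in>A'. \<forall>y\<in>A'. dist x y \<le> d) \<and> emeasure lborel A' = emeasure lborel A
      \<and> (\<forall>c\<in>B. \<forall>x\<in>A'. x - (2 * (x \<bullet> c)) *\<^sub>R c \<in> A')" if "finite B" "B \<subseteq> Basis" for B
    using that
  proof (induction B rule: finite_induct)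
    case empty
    then show ?case using A by (intro exI[of _ A]) auto
  next
    case (insert b B)
    then obtain A' where A': "A' \<in> sets borel" "\<And>x y. x \<in> A' \<Longrightarrow> y \<in> A' \<Longrightarrow> dist x y \<le> d"
      "emeasure lborel A' = emeasure lborel A" "\<And>c x. c \<in> B \<Longrightarrow> x \<in> A' \<Longrightarrow> x - (2 * (x \<bullet> c)) *\<^sub>R c \<in> A'"
      by auto
    have b: "b \<in> Basis" using insert by auto
    have bA': "bounded A'" using A'(2) bounded_two_points by blast
    show ?case
    proof (intro exI[of _ "steiner b A'"] conjI ballI)
      show "steiner b A' \<in> sets borel" by (rule steiner_borel[OF A'(1)])
      show "emeasure lborel (steiner b A') = emeasure lborel A"
        using emeasure_steiner[OF A'(1) bA' b] A'(3) by simp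
      show "dist x y \<le> d" if "x \<in> steiner b A'" "y \<in> steiner b A'" for x y
        by (rule steiner_dist_le[OF A'(1,2) b that])
      fix c x assume c: "c \<in> insert b B" and x: "x \<in> steiner b A'"
      show "x - (2 * (x \<bullet> c)) *\<^sub>R c \<in> steiner b A'"
      proof (cases "c = b")
        case True then show ?thesis using steiner_reflect_self[OF b x] by simp
      next
        case False
        then have "c \<in> B" "c \<in> Basis" using c insert by auto
        then show ?thesis using False A'(4) by (intro steiner_reflect_other[OF b _ _ _ x]) auto
      qed
    qed
  qed
  from this[OF finite_Basis order_refl]
  obtain A' :: "'a set" where A': "A' \<in> sets borel" "\<And>x y. x \<in> A' \<Longrightarrow> y \<in> A' \<Longrightarrow> dist x y \<le> d"
      "emeasure lborel A' = emeasure lborel A"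
      and refl: "\<And>c x. c \<in> Basis \<Longrightarrow> x \<in> A' \<Longrightarrow> x - (2 * (x \<bullet> c)) *\<^sub>R c \<in> A'"
    by auto
  have "- x \<in> A'" if x: "x \<in> A'" for x
  proof -
    have "x - (\<Sum>c\<in>B. (2 * (x \<bullet> c)) *\<^sub>R c) \<in> A'" if "finite B" "B \<subseteq> Basis" for B
      using that
    proof (induction B rule: finite_induct)
      case (insert b B)
      let ?y = "x - (\<Sum>c\<in>B. (2 * (x \<bullet> c)) *\<^sub>R c)"
      have "?y \<in> A'" using insert by auto
      moreover have "?y \<bullet> b = x \<bullet> b"
        using insert by (auto simp: inner_diff_left inner_sum_left inner_Basis intro!: sum.neutral)
      ultimately have "?y - (2 * (x \<bullet> b)) *\<^sub>R b \<in> A'" using refl[of b ?y] insert by auto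
      then show ?case using insert by (simp add: algebra_simps)
    qed (use x in simp)
    from this[OF finite_Basis order_refl]
    have "x - (\<Sum>c\<in>Basis. (2 * (x \<bullet> c)) *\<^sub>R c) \<in> A'" .
    moreover have "(\<Sum>c\<in>Basis. (2 * (x \<bullet> c)) *\<^sub>R c) = 2 *\<^sub>R x"
      by (simp add: euclidean_representation flip: scaleR_scaleR scaleR_sum_right)
    ultimately show ?thesis by (simp add: scaleR_2)
  qed
  then show ?thesis using A' that by blast
qed

text \<open>
  In a set that is symmetric about the origin, \<open>x\<close> and \<open>- x\<close> are at distance \<open>2 |x|\<close>, so such a set lies in
  the ball of half its diameter; symmetrization reduces to this case.
\<close>

theorem isodiametric:
  fixes A :: "'a::euclidean_space set"
  assumes "A \<in> sets borel" "bounded A"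
  shows "emeasure lborel A \<le> ennreal (unit_ball_vol (real DIM('a)) * (diameter A / 2) ^ DIM('a))"
proof -
  obtain A' :: "'a set" where A': "A' \<in> sets borel" "\<And>x y. x \<in> A' \<Longrightarrow> y \<in> A' \<Longrightarrow> dist x y \<le> diameter A"
      "emeasure lborel A' = emeasure lborel A" "\<And>x. x \<in> A' \<Longrightarrow> - x \<in> A'"
    using steiner_symmetrization[OF assms(1), of "diameter A"] diameter_bounded_bound[OF assms(2)] by blast
  have "A' \<subseteq> cball 0 (diameter A / 2)"
  proof
    fix x assume "x \<in> A'"
    then have "dist x (- x) \<le> diameter A" using A' by blast
    moreover have "dist x (- x) = 2 * norm x" by (simp add: dist_norm flip: scaleR_2)
    ultimately show "x \<in> cball 0 (diameter A / 2)" by simp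
  qed
  then have "emeasure lborel A \<le> emeasure lborel (cball (0::'a) (diameter A / 2))"
    unfolding A'(3)[symmetric] by (intro emeasure_mono) auto
  also have "\<dots> = ennreal (unit_ball_vol (real DIM('a)) * (diameter A / 2) ^ DIM('a))"
    using diameter_ge_0[OF assms(2)] by (intro emeasure_cball) auto
  finally show ?thesis .
qed

section \<open>Hausdorff measure of full dimension is Lebesgue measure\<close>

lemma hausdorff_outer_ge_lborel:
  fixes A :: "'a::euclidean_space set"
  assumes A: "A \<in> sets borel"
  shows "emeasure lborel A \<le> hausdorff_outer DIM('a) A"
proof -
  have "emeasure lborel A \<le> hausdorff_content DIM('a) 1 A"
  proof (rule hausdorff_content_ge)
    fix U :: "nat \<Rightarrow> 'a set"
    assume U: "\<And>i. bounded (U i)" "\<And>i. diameter (U i) \<le> 1" "A \<subseteq> (\<Union>i. U i)"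
    have "A \<subseteq> (\<Union>i. closure (U i))" by (rule order_trans[OF U(3)]) (intro UN_mono closure_subset order_refl)
    then have "emeasure lborel A \<le> emeasure lborel (\<Union>i. closure (U i))"
      by (intro emeasure_mono) auto
    also have "\<dots> \<le> (\<Sum>i. emeasure lborel (closure (U i)))"
      by (intro emeasure_subadditive_countably) auto
    also have "\<dots> \<le> (\<Sum>i. hcost DIM('a) (U i))"
    proof (rule suminf_le)
      fix i
      show "emeasure lborel (closure (U i)) \<le> hcost DIM('a) (U i)"
        using isodiametric[of "closure (U i)"] U(1)[of i]
        by (auto simp: hcost_def diameter_closure)
    qed auto
    finally show "emeasure lborel A \<le> (\<Sum>i. hcost DIM('a) (U i))" .
  qed
  also have "\<dots> \<le> hausdorff_outer DIM('a) A" by (rule hausdorff_content_le_outer) simp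
  finally show ?thesis .
qed

lemma hausdorff_content_le_countable:
  assumes C: "countable C" and B: "\<And>i. i \<in> C \<Longrightarrow> bounded (B i)" "\<And>i. i \<in> C \<Longrightarrow> diameter (B i) \<le> \<delta>"
    and A: "A \<subseteq> (\<Union>i\<in>C. B i)" and \<delta>: "0 \<le> \<delta>"
  shows "hausdorff_content m \<delta> A \<le> (\<integral>\<^sup>+i. hcost m (B i) \<partial>count_space C)"
proof -
  let ?N = "to_nat_on C ` C"
  define U where "U n = (if n \<in> ?N then B (from_nat_into C n) else {})" for n
  have bij: "bij_betw (to_nat_on C) C ?N"
    using C by (simp add: inj_on_imp_bij_betw inj_on_to_nat_on)
  have UB: "U (to_nat_on C i) = B i" if "i \<in> C" for i
    using that C by (auto simp: U_def)
  have "hausdorff_content m \<delta> A \<le> (\<Sum>n. hcost m (U n))"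
  proof (rule hausdorff_content_le)
    show "bounded (U i)" for i using B(1) C by (auto simp: U_def)
    show "diameter (U i) \<le> \<delta>" for i using B(2) C \<delta> by (auto simp: U_def)
    show "A \<subseteq> (\<Union>i. U i)"
    proof
      fix x assume "x \<in> A"
      then obtain i where "i \<in> C" "x \<in> B i" using A by blast
      then have "x \<in> U (to_nat_on C i)" using UB by simp
      then show "x \<in> (\<Union>i. U i)" by blast
    qed
  qed
  also have "\<dots> = (\<integral>\<^sup>+n. hcost m (U n) \<partial>count_space UNIV)"
    by (simp add: nn_integral_count_space_nat)
  also have "\<dots> = (\<integral>\<^sup>+n. hcost m (U n) * indicator ?N n \<partial>count_space UNIV)"
    by (intro nn_integral_cong) (auto simp: U_def indicator_def)
  also have "\<dots> = (\<integral>\<^sup>+n. hcost m (U n) \<partial>count_space ?N)"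
    by (simp add: nn_integral_count_space_indicator)
  also have "\<dots> = (\<integral>\<^sup>+i. hcost m (U (to_nat_on C i)) \<partial>count_space C)"
    by (rule nn_integral_bij_count_space[OF bij, symmetric])
  also have "\<dots> = (\<integral>\<^sup>+i. hcost m (B i) \<partial>count_space C)"
    by (intro nn_integral_cong) (simp add: UB)
  finally show ?thesis .
qed

lemma hcost_ball:
  fixes x :: "'a::euclidean_space"
  assumes "0 < r"
  shows "hcost DIM('a) (ball x r) = emeasure lborel (ball x r)"
  using assms by (simp add: hcost_def diameter_ball emeasure_ball)

lemma nn_integral_disjoint_balls_le:
  fixes a :: "'i \<Rightarrow> 'a::euclidean_space"
  assumes C: "countable C" and dis: "pairwise (\<lambda>i j. disjnt (ball (a i) (r i)) (ball (a j) (r j))) C"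
    and sub: "\<And>i. i \<in> C \<Longrightarrow> ball (a i) (r i) \<subseteq> U" and U: "open U"
  shows "(\<integral>\<^sup>+i. emeasure lborel (ball (a i) (r i)) \<partial>count_space C) \<le> emeasure lborel U"
proof -
  have "(\<integral>\<^sup>+i. emeasure lborel (ball (a i) (r i)) \<partial>count_space C) = emeasure lborel (\<Union>i\<in>C. ball (a i) (r i))"
    using dis C by (intro emeasure_UN_countable[symmetric])
      (auto simp: disjoint_family_on_def pairwise_def disjnt_def)
  also have "\<dots> \<le> emeasure lborel U" using sub U by (intro emeasure_mono) auto
  finally show ?thesis .
qed

text \<open>
  Small balls inside \<open>U\<close> cover \<open>S\<close>.  Vitali's lemma selects disjoint ones whose fivefold enlargements still
  cover \<open>S\<close>; the total volume of the disjoint balls is at most that of \<open>U\<close>.  The factor is harmless, since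
  this bound serves only for null sets.
\<close>

lemma hausdorff_content_le_open_crude:
  fixes U :: "'a::euclidean_space set"
  assumes U: "open U" and S: "S \<subseteq> U" and \<delta>: "0 < \<delta>"
  shows "hausdorff_content DIM('a) \<delta> S \<le> 5 ^ DIM('a) * emeasure lborel U"
proof -
  define K where "K = {p :: 'a \<times> real. 0 < snd p \<and> snd p \<le> \<delta> / 10 \<and> ball (fst p) (snd p) \<subseteq> U}"
  have cov: "S \<subseteq> (\<Union>p\<in>K. ball (fst p) (snd p))"
  proof
    fix x assume "x \<in> S"
    then obtain e where e: "0 < e" "ball x e \<subseteq> U" using U S open_contains_ball by blast
    then have "(x, min e (\<delta>/10)) \<in> K" using \<delta> by (auto simp: K_def)
    moreover have "x \<in> ball x (min e (\<delta>/10))" using e \<delta> by simp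
    ultimately show "x \<in> (\<Union>p\<in>K. ball (fst p) (snd p))" by force
  qed
  obtain C where C: "countable C" "C \<subseteq> K"
      "pairwise (\<lambda>i j. disjnt (ball (fst i) (snd i)) (ball (fst j) (snd j))) C"
      "S \<subseteq> (\<Union>i\<in>C. ball (fst i) (5 * snd i))"
    by (rule Vitali_covering_lemma_balls[OF cov, of "\<delta>/10"]) (auto simp: K_def)
  have "hausdorff_content DIM('a) \<delta> S \<le> (\<integral>\<^sup>+i. hcost DIM('a) (ball (fst i) (5 * snd i)) \<partial>count_space C)"
    using C \<delta> by (intro hausdorff_content_le_countable) (auto simp: K_def diameter_ball)
  also have "\<dots> = (\<integral>\<^sup>+i. 5 ^ DIM('a) * emeasure lborel (ball (fst i) (snd i)) \<partial>count_space C)"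
  proof (rule nn_integral_cong)
    fix i assume "i \<in> space (count_space C)"
    then have "0 < snd i" using C(2) by (auto simp: K_def)
    then show "hcost DIM('a) (ball (fst i) (5 * snd i)) = 5 ^ DIM('a) * emeasure lborel (ball (fst i) (snd i))"
      by (simp add: hcost_ball emeasure_ball power_mult_distrib ennreal_mult' mult_ac flip: ennreal_power)
  qed
  also have "\<dots> = 5 ^ DIM('a) * (\<integral>\<^sup>+i. emeasure lborel (ball (fst i) (snd i)) \<partial>count_space C)"
    by (rule nn_integral_cmult) simp
  also have "\<dots> \<le> 5 ^ DIM('a) * emeasure lborel U"
    using C U by (intro mult_left_mono nn_integral_disjoint_balls_le) (auto simp: K_def)
  finally show ?thesis .
qed

lemma hausdorff_outer_negligible:
  fixes N :: "'a::euclidean_space set"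
  assumes "negligible N"
  shows "hausdorff_outer DIM('a) N = 0"
proof -
  have "hausdorff_content DIM('a) \<delta> N \<le> 0" if \<delta>: "0 < \<delta>" for \<delta>
  proof (rule ennreal_le_epsilon)
    fix e :: real assume e: "0 < e"
    have Nl: "N \<in> sets lebesgue" "emeasure lebesgue N = 0"
      using assms by (auto simp: negligible_iff_null_sets)
    have "0 < e / 5 ^ DIM('a)" using e by simp
    then obtain U where U: "open U" "N \<subseteq> U" "emeasure lebesgue (U - N) < ennreal (e / 5 ^ DIM('a))" 
      using sets_lebesgue_outer_open[OF Nl(1)] by metis
    have "emeasure lborel U = emeasure lebesgue (N \<union> (U - N))"
      using U by (simp add: Un_absorb1)
    also have "\<dots> \<le> emeasure lebesgue N + emeasure lebesgue (U - N)"
      using Nl U by (intro emeasure_subadditive) auto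
    finally have "emeasure lborel U \<le> ennreal (e / 5 ^ DIM('a))"
      using U(3) Nl(2) by simp
    then have "5 ^ DIM('a) * emeasure lborel U \<le> 5 ^ DIM('a) * ennreal (e / 5 ^ DIM('a))"
      by (rule mult_left_mono) simp
    also have "\<dots> = ennreal e"
    proof -
      have "(5 :: ennreal) ^ DIM('a) = ennreal 5 ^ DIM('a)" by simp
      also have "\<dots> = ennreal (5 ^ DIM('a))" by (rule ennreal_power) simp
      finally show ?thesis using e by (simp flip: ennreal_mult)
    qed
    finally show "hausdorff_content DIM('a) \<delta> N \<le> 0 + ennreal e"
      using hausdorff_content_le_open_crude[OF U(1,2) \<delta>] by simp
  qed
  then show ?thesis by (intro antisym hausdorff_outer_le) auto
qed

text \<open>
  Vitali's covering theorem fills \<open>U\<close> by disjoint small balls up to a null set.  For balls the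
  contribution to the Hausdorff content is exactly the volume, and the null set is free by
  \<open>hausdorff_outer_negligible\<close>.
\<close>

lemma hausdorff_outer_open_le:
  fixes U :: "'a::euclidean_space set"
  assumes U: "open U"
  shows "hausdorff_outer DIM('a) U \<le> emeasure lborel U"
proof (rule hausdorff_outer_le)
  fix \<delta> :: real assume \<delta>: "0 < \<delta>"
  define K where "K = {p :: 'a \<times> real. 0 < snd p \<and> snd p \<le> \<delta> / 2 \<and> ball (fst p) (snd p) \<subseteq> U}"
  have "\<exists>p. p \<in> K \<and> x \<in> ball (fst p) (snd p) \<and> snd p < d" if xd: "x \<in> U" "0 < d" for x d
  proof -
    obtain e where e: "0 < e" "ball x e \<subseteq> U" using U xd open_contains_ball by blast
    then show ?thesis using \<delta> xd 
      by (intro exI[of _ "(x, min e (min (\<delta>/2) (d/2)))"]) (auto simp: K_def)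
  qed
  then obtain C where C: "countable C" "C \<subseteq> K"
      "pairwise (\<lambda>i j. disjnt (ball (fst i) (snd i)) (ball (fst j) (snd j))) C"
      "negligible (U - (\<Union>i\<in>C. ball (fst i) (snd i)))"
    by (rule Vitali_covering_theorem_balls)
  let ?V = "\<Union>i\<in>C. ball (fst i) (snd i)"
  have "hausdorff_content DIM('a) \<delta> ?V \<le> (\<integral>\<^sup>+i. hcost DIM('a) (ball (fst i) (snd i)) \<partial>count_space C)"
    using C \<delta> by (intro hausdorff_content_le_countable) (auto simp: K_def diameter_ball)
  also have "\<dots> = (\<integral>\<^sup>+i. emeasure lborel (ball (fst i) (snd i)) \<partial>count_space C)"
    using C by (intro nn_integral_cong hcost_ball) (auto simp: K_def)
  also have "\<dots> \<le> emeasure lborel U"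
    using C U by (intro nn_integral_disjoint_balls_le) (auto simp: K_def)
  finally have 1: "hausdorff_content DIM('a) \<delta> ?V \<le> emeasure lborel U" .
  have 2: "hausdorff_content DIM('a) \<delta> (U - ?V) \<le> 0"
    using hausdorff_content_le_outer[OF \<delta>, of "DIM('a)" "U - ?V"] hausdorff_outer_negligible[OF C(4)] by simp
  have "hausdorff_content DIM('a) \<delta> U \<le> hausdorff_content DIM('a) \<delta> (\<Union>i. binaryset ?V (U - ?V) i)"
    by (intro hausdorff_content_mono) (auto simp: UN_binaryset_eq)
  also have "\<dots> \<le> (\<Sum>i. hausdorff_content DIM('a) \<delta> (binaryset ?V (U - ?V) i))"
    by (rule hausdorff_content_countably_subadditive)
  also have "\<dots> = hausdorff_content DIM('a) \<delta> ?V + hausdorff_content DIM('a) \<delta> (U - ?V)"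
    using hausdorff_content_le_outer[OF \<delta>, of "DIM('a)" "{} :: 'a set"]
    by (intro suminf_binaryset_eq) simp
  also have "\<dots> \<le> emeasure lborel U" using add_mono[OF 1 2] by simp
  finally show "hausdorff_content DIM('a) \<delta> U \<le> emeasure lborel U" .
qed

text \<open>
  The lower bound is the isodiametric inequality applied to each covering set; the upper bound passes
  from open sets to Borel sets by outer regularity of Lebesgue measure.
\<close>

theorem hausdorff_outer_eq_lborel:
  fixes A :: "'a::euclidean_space set"
  assumes A: "A \<in> sets borel"
  shows "hausdorff_outer DIM('a) A = emeasure lborel A"
proof (rule antisym[OF _ hausdorff_outer_ge_lborel[OF A]])
  show "hausdorff_outer DIM('a) A \<le> emeasure lborel A"
  proof (rule ennreal_le_epsilon)
    fix e :: real assume e: "0 < e"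
    have "A \<in> sets lebesgue" using A by simp
    from sets_lebesgue_outer_open[OF this e]
    obtain U where U: "open U" "A \<subseteq> U" "emeasure lebesgue (U - A) < ennreal e" by metis
    then have "emeasure lborel (U - A) < ennreal e" using A by simp
    note U = U(1,2) this
    have "hausdorff_outer DIM('a) A \<le> hausdorff_outer DIM('a) U" by (rule hausdorff_outer_mono[OF U(2)])
    also have "\<dots> \<le> emeasure lborel U" by (rule hausdorff_outer_open_le[OF U(1)])
    also have "U = A \<union> (U - A)" using U(2) by blast
    also have "emeasure lborel (A \<union> (U - A)) \<le> emeasure lborel A + emeasure lborel (U - A)"
      using A U by (intro emeasure_subadditive) auto
    also have "\<dots> \<le> emeasure lborel A + ennreal e" using U(3) by (intro add_left_mono) auto
    finally show "hausdorff_outer DIM('a) A \<le> emeasure lborel A + ennreal e" .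
  qed
qed

section \<open>Change of variables in nonnegative integrals\<close>

text \<open>
  The theorem \<open>has_measure_differentiable_image\<close> concerns vectors over a well-ordered index type.  This type has as
  many elements as a finite \<open>'a\<close> and inherits the order of the natural numbers, so the theorem can be transported
  to arbitrary finite index types.  The disjunct \<open>i = 0\<close> keeps the type inhabited
  when \<open>'a\<close> is infinite and \<open>CARD('a) = 0\<close>.
\<close>

typedef 'a index_copy = "{i::nat. i = 0 \<or> i < CARD('a)}"
  by auto

instantiation index_copy :: (type) wellorder
begin

definition less_eq_index_copy :: "'a index_copy \<Rightarrow> 'a index_copy \<Rightarrow> bool" where
  "less_eq_index_copy i j \<longleftrightarrow> Rep_index_copy i \<le> Rep_index_copy j"

definition less_index_copy :: "'a index_copy \<Rightarrow> 'a index_copy \<Rightarrow> bool" where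
  "less_index_copy i j \<longleftrightarrow> Rep_index_copy i < Rep_index_copy j"

instance
proof
  fix P :: "'a index_copy \<Rightarrow> bool" and a
  assume step: "\<And>i. (\<And>j. j < i \<Longrightarrow> P j) \<Longrightarrow> P i"
  show "P a"
    by (induction "Rep_index_copy a" arbitrary: a rule: less_induct)
       (metis step less_index_copy_def)
qed (auto simp: less_eq_index_copy_def less_index_copy_def Rep_index_copy_inject)

end

instance index_copy :: (type) finite
proof
  have "finite {i::nat. i = 0 \<or> i < CARD('a)}" by simp
  then show "finite (UNIV :: 'a index_copy set)"
    unfolding type_definition.univ[OF type_definition_index_copy] by (rule finite_imageI)
qed

lemma card_index_copy: "CARD('a::finite index_copy) = CARD('a)"
proof -
  have "{i::nat. i = 0 \<or> i < CARD('a)} = {..<CARD('a)}" by auto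
  then show ?thesis by (simp add: type_definition.card[OF type_definition_index_copy])
qed

lemma det_reindex:
  fixes A :: "real ^ 'a ^ 'a" and h :: "'b::finite \<Rightarrow> 'a::finite"
  assumes h: "bij h"
  shows "det (\<chi> i j. A $ h i $ h j) = det A"
proof -
  let ?j = "\<lambda>p. h \<circ> p \<circ> inv h" and ?i = "\<lambda>q. inv h \<circ> q \<circ> h"
  have ih: "inv h \<circ> h = id" "h \<circ> inv h = id" "\<And>x. inv h (h x) = x" "\<And>x. h (inv h x) = x"
    using h by (auto simp: bij_is_inj bij_is_surj surj_iff inv_f_f surj_f_inv_f)
  have mp: "map_permutation UNIV h p = ?j p" for p :: "'b \<Rightarrow> 'b"
    using h by (auto simp: map_permutation_def restrict_id_def bij_is_surj)
  show ?thesis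
    unfolding det_def
  proof (rule sum.reindex_bij_witness[of _ ?i ?j])
    fix p :: "'b \<Rightarrow> 'b" assume "p \<in> {p. p permutes UNIV}"
    then have p: "p permutes UNIV" by simp
    show "?i (?j p) = p" by (auto simp: fun_eq_iff ih)
    have "bij (?j p)" using h p by (intro bij_comp) (auto simp: permutes_bij bij_imp_bij_inv)
    then show "?j p \<in> {p. p permutes UNIV}" by (auto intro: bij_imp_permutes)
    have s: "sign (?j p) = sign p"
      using sign_map_permutation[of h UNIV p] h p by (simp add: mp bij_is_inj)
    have "(\<Prod>i\<in>UNIV. (\<chi> i j. A $ h i $ h j) $ i $ p i) = (\<Prod>i\<in>UNIV. A $ h i $ (?j p (h i)))"
      by (simp add: ih)
    also have "\<dots> = (\<Prod>a\<in>UNIV. A $ a $ (?j p a))"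
      by (rule prod.reindex_bij_betw) (use h in simp)
    finally show "of_int (sign (?j p)) * (\<Prod>i\<in>UNIV. A $ i $ ?j p i)
        = of_int (sign p) * (\<Prod>i\<in>UNIV. (\<chi> i j. A $ h i $ h j) $ i $ p i)"
      using s by simp
  next
    fix q :: "'a \<Rightarrow> 'a" assume "q \<in> {q. q permutes UNIV}"
    then have q: "q permutes UNIV" by simp
    show "?j (?i q) = q" by (auto simp: fun_eq_iff ih)
    have "bij (?i q)" using h q by (intro bij_comp) (auto simp: permutes_bij bij_imp_bij_inv)
    then show "?i q \<in> {p. p permutes UNIV}" by (auto intro: bij_imp_permutes)
  qed
qed

text \<open>
  A bijection between the bases carries boxes to boxes with the same side lengths.
\<close>

lemma distr_lborel_basis_bij:
  fixes T :: "'a::euclidean_space \<Rightarrow> 'b::euclidean_space"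
  assumes T: "linear T" and bij: "bij_betw T Basis Basis"
  shows "distr lborel borel T = lborel"
proof (rule lborel_eqI[symmetric])
  have TB: "T b \<in> Basis" if "b \<in> Basis" for b using bij that by (auto simp: bij_betw_def)
  have inj: "T b = T c \<longleftrightarrow> b = c" if "b \<in> Basis" "c \<in> Basis" for b c
    using bij that by (auto simp: bij_betw_def inj_on_def)
  have TT: "T x \<bullet> T b = x \<bullet> b" if b: "b \<in> Basis" for x b
  proof -
    have "T x = T (\<Sum>c\<in>Basis. (x \<bullet> c) *\<^sub>R c)" by (simp add: euclidean_representation)
    also have "\<dots> = (\<Sum>c\<in>Basis. (x \<bullet> c) *\<^sub>R T c)" using T by (simp add: linear_sum linear_scale)
    finally have "T x \<bullet> T b = (\<Sum>c\<in>Basis. (x \<bullet> c) * (T c \<bullet> T b))" by (simp add: inner_sum_left)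
    also have "\<dots> = (\<Sum>c\<in>Basis. if c = b then x \<bullet> c else 0)"
      using b TB inj by (intro sum.cong) (auto simp: inner_Basis)
    finally show ?thesis using b by simp
  qed
  have Tm: "T \<in> borel \<rightarrow>\<^sub>M borel"
    using T by (intro borel_measurable_continuous_onI linear_continuous_on) (simp add: linear_conv_bounded_linear)
  fix l u :: 'b assume le: "\<And>b. b \<in> Basis \<Longrightarrow> l \<bullet> b \<le> u \<bullet> b"
  let ?r = "\<lambda>y. \<Sum>b\<in>Basis. (y \<bullet> T b) *\<^sub>R b"
  have r: "?r y \<bullet> b = y \<bullet> T b" if "b \<in> Basis" for y b
    using that by simp
  have "T -` box l u = box (?r l) (?r u)"
  proof -
    have "T x \<in> box l u \<longleftrightarrow> (\<forall>b\<in>Basis. l \<bullet> T b < T x \<bullet> T b \<and> T x \<bullet> T b < u \<bullet> T b)" for x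
      using bij unfolding mem_box bij_betw_def by (metis (no_types, lifting) imageE imageI)
    then show ?thesis by (auto simp: mem_box TT r)
  qed
  then have "emeasure (distr lborel borel T) (box l u) = emeasure lborel (box (?r l) (?r u))"
    using Tm by (subst emeasure_distr) auto
  also have "\<dots> = ennreal (\<Prod>b\<in>Basis. (?r u - ?r l) \<bullet> b)"
    by (rule emeasure_lborel_box) (use le TB in \<open>auto simp: r\<close>)
  also have "(\<Prod>b\<in>Basis. (?r u - ?r l) \<bullet> b) = (\<Prod>b\<in>Basis. (u - l) \<bullet> T b)"
    by (intro prod.cong) (auto simp: inner_diff_left r)
  also have "\<dots> = (\<Prod>b\<in>Basis. (u - l) \<bullet> b)"
    by (rule prod.reindex_bij_betw[OF bij])
  finally show "emeasure (distr lborel borel T) (box l u) = ennreal (\<Prod>b\<in>Basis. (u - l) \<bullet> b)" .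
qed simp

lemma Basis_real_vec: "(Basis :: (real ^ 'c) set) = (\<lambda>i. axis i 1) ` UNIV"
  by (auto simp: Basis_vec_def)

text \<open>
  The theorem \<open>has_measure_differentiable_image\<close> treats finite values, in terms of the gauge integral.  The
  equivalence in it also shows that one side is infinite whenever the other one is.  The function \<open>D\<close> is a
  Borel version of the Jacobian on the whole space, for which the nonnegative integral makes sense.
\<close>

lemma emeasure_change_of_variables_wellorder:
  fixes g :: "real ^ 'm::{finite,wellorder} \<Rightarrow> real ^ 'm::_"
  assumes S: "S \<in> sets borel" and gS: "g ` S \<in> sets borel"
    and der: "\<And>x. x \<in> S \<Longrightarrow> (g has_derivative g' x) (at x)" and inj: "inj_on g S"
    and D: "\<And>x. x \<in> S \<Longrightarrow> \<bar>det (matrix (g' x))\<bar> = D x" and Dm [measurable]: "D \<in> borel_measurable borel"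
  shows "emeasure lborel (g ` S) = (\<integral>\<^sup>+x. ennreal (D x) * indicator S x \<partial>lborel)"
proof -
  note [measurable] = S
  have hm: "g ` S \<in> lmeasurable \<and> measure lebesgue (g ` S) = m \<longleftrightarrow> ((\<lambda>x. \<bar>det (matrix (g' x))\<bar>) has_integral m) S" for m
    by (rule has_measure_differentiable_image) (use S der inj in \<open>auto intro: has_derivative_at_withinI\<close>)
  have hD: "((\<lambda>x. \<bar>det (matrix (g' x))\<bar>) has_integral m) S \<longleftrightarrow> ((\<lambda>x. D x * indicator S x) has_integral m) UNIV" for m
  proof -
    have "((\<lambda>x. \<bar>det (matrix (g' x))\<bar>) has_integral m) S \<longleftrightarrow> (D has_integral m) S"
      by (rule has_integral_cong) (rule D)
    also have "\<dots> \<longleftrightarrow> ((\<lambda>x. if x \<in> S then D x else 0) has_integral m) UNIV"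
      by (rule has_integral_restrict_UNIV[symmetric])
    also have "(\<lambda>x. if x \<in> S then D x else 0) = (\<lambda>x. D x * indicator S x)"
      by (auto simp: indicator_def)
    finally show ?thesis .
  qed
  have D0: "0 \<le> D x * indicator S x" for x using D[of x] by (auto simp: indicator_def)
  have nn: "(\<integral>\<^sup>+x. ennreal (D x) * indicator S x \<partial>lborel) = (\<integral>\<^sup>+x. ennreal (D x * indicator S x) \<partial>lborel)"
    by (intro nn_integral_cong) (auto simp: indicator_def)
  have eq: "emeasure lborel (g ` S) = emeasure lebesgue (g ` S)" using gS by simp
  show ?thesis
  proof (cases "(\<integral>\<^sup>+x. ennreal (D x * indicator S x) \<partial>lborel) = top")
    case False
    have int: "integrable lborel (\<lambda>x. D x * indicator S x)"
      by (rule integrableI_nonneg) (use D0 False in \<open>auto simp: less_top\<close>)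
    let ?m = "integral\<^sup>L lborel (\<lambda>x. D x * indicator S x)"
    have "((\<lambda>x. D x * indicator S x) has_integral ?m) UNIV"
      by (rule has_integral_integral_lborel[OF int])
    then have "g ` S \<in> lmeasurable" "measure lebesgue (g ` S) = ?m" using hm hD by auto
    then have "emeasure lebesgue (g ` S) = ennreal ?m" by (simp add: emeasure_eq_measure2)
    also have "\<dots> = (\<integral>\<^sup>+x. ennreal (D x * indicator S x) \<partial>lborel)"
      by (rule nn_integral_eq_integral[symmetric, OF int]) (simp add: D0)
    finally show ?thesis using eq nn by simp
  next
    case True
    have "emeasure lebesgue (g ` S) = top"
    proof (rule ccontr)
      assume "emeasure lebesgue (g ` S) \<noteq> top"
      then have "g ` S \<in> lmeasurable" using gS by (intro fmeasurableI) (auto simp: less_top)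
      then have "((\<lambda>x. D x * indicator S x) has_integral (measure lebesgue (g ` S))) UNIV" using hm hD by blast
      then have "(\<integral>\<^sup>+x. ennreal (D x * indicator S x) \<partial>lborel) = ennreal (measure lebesgue (g ` S))"
        using D0 by (intro nn_integral_has_integral_lborel) auto
      then show False using True by simp
    qed
    then show ?thesis using True eq nn by simp
  qed
qed

lemma nn_integral_change_of_variables_wellorder:
  fixes g :: "real ^ 'm::{finite,wellorder} \<Rightarrow> real ^ 'm::_"
  assumes S: "open S"
    and der: "\<And>x. x \<in> S \<Longrightarrow> (g has_derivative g' x) (at x)" and inj: "inj_on g S"
    and D: "\<And>x. x \<in> S \<Longrightarrow> \<bar>det (matrix (g' x))\<bar> = D x" and Dm [measurable]: "D \<in> borel_measurable borel"
    and gm [measurable]: "g \<in> borel \<rightarrow>\<^sub>M borel" and F [measurable]: "F \<in> borel_measurable borel"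
  shows "(\<integral>\<^sup>+y. F y * indicator (g ` S) y \<partial>lborel) = (\<integral>\<^sup>+x. ennreal (D x) * F (g x) * indicator S x \<partial>lborel)"
proof -
  have [measurable]: "S \<in> sets borel" using S by simp
  have "continuous_on S g" using der has_derivative_continuous_on[of S g g'] by (meson has_derivative_at_withinI)
  then have "open (g ` S)" by (rule invariance_of_domain[OF _ S inj])
  then have [measurable]: "g ` S \<in> sets borel" by simp
  have "density lborel (indicator (g ` S)) = distr (density lborel (\<lambda>x. ennreal (D x) * indicator S x)) borel g"
  proof (rule measure_eqI)
    fix A assume "A \<in> sets (density lborel (indicator (g ` S)))"
    then have A [measurable]: "A \<in> sets borel" by simp
    have gA: "g -` A \<in> sets borel" using measurable_sets[OF gm A] by simp
    let ?SA = "S \<inter> g -` A"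
    have im: "g ` ?SA = g ` S \<inter> A" by auto
    have "emeasure (density lborel (indicator (g ` S))) A = emeasure lborel (g ` ?SA)"
      by (simp add: emeasure_density im flip: indicator_inter_arith)
    also have "\<dots> = (\<integral>\<^sup>+x. ennreal (D x) * indicator ?SA x \<partial>lborel)"
      by (rule emeasure_change_of_variables_wellorder[where g' = g'])
         (use gA der D inj im in \<open>auto intro: inj_on_subset\<close>)
    also have "\<dots> = (\<integral>\<^sup>+x. (ennreal (D x) * indicator S x) * indicator (g -` A) x \<partial>lborel)"
      by (intro nn_integral_cong) (auto simp: indicator_def)
    also have "\<dots> = emeasure (distr (density lborel (\<lambda>x. ennreal (D x) * indicator S x)) borel g) A"
      using gA by (simp add: emeasure_distr emeasure_density)
    finally show "emeasure (density lborel (indicator (g ` S))) A = \<dots>" .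
  qed simp
  then have "(\<integral>\<^sup>+y. F y \<partial>density lborel (indicator (g ` S)))
      = (\<integral>\<^sup>+y. F y \<partial>distr (density lborel (\<lambda>x. ennreal (D x) * indicator S x)) borel g)" by simp
  then show ?thesis
    by (simp add: nn_integral_density nn_integral_distr mult_ac)
qed

text \<open>
  Conjugation by the permutation of coordinates \<open>P\<close>, with inverse \<open>Q\<close>, moves the problem to the well-ordered copy of
  the index type;
  Lebesgue measure and the Jacobian determinant are invariant under it.
\<close>

lemma nn_integral_change_of_variables:
  fixes g :: "real ^ 'k \<Rightarrow> real ^ 'k"
  assumes S: "open S"
    and der: "\<And>x. x \<in> S \<Longrightarrow> (g has_derivative g' x) (at x)" and inj: "inj_on g S"
    and D: "\<And>x. x \<in> S \<Longrightarrow> \<bar>det (matrix (g' x))\<bar> = D x" and Dm [measurable]: "D \<in> borel_measurable borel"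
    and gm [measurable]: "g \<in> borel \<rightarrow>\<^sub>M borel" and F [measurable]: "F \<in> borel_measurable borel"
  shows "(\<integral>\<^sup>+y. F y * indicator (g ` S) y \<partial>lborel) = (\<integral>\<^sup>+x. ennreal (D x) * F (g x) * indicator S x \<partial>lborel)"
proof -
  have [measurable]: "S \<in> sets borel" using S by simp
  obtain h :: "'k index_copy \<Rightarrow> 'k" where h: "bij h"
    using finite_same_card_bij[of "UNIV :: 'k index_copy set" "UNIV :: 'k set"] card_index_copy[where 'a = 'k] by auto
  have ih: "\<And>x. inv h (h x) = x" "\<And>x. h (inv h x) = x"
    using h by (auto simp: bij_is_inj bij_is_surj inv_f_f surj_f_inv_f)
  define P :: "real ^ 'k \<Rightarrow> real ^ 'k index_copy" where "P x = (\<chi> i. x $ h i)" for x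
  define Q :: "real ^ 'k index_copy \<Rightarrow> real ^ 'k" where "Q y = (\<chi> a. y $ inv h a)" for y
  have PQ [simp]: "P (Q y) = y" "Q (P x) = x" for x y by (simp_all add: P_def Q_def ih vec_eq_iff)
  have linP: "linear P" and linQ: "linear Q"
    by (auto simp: P_def Q_def intro!: linearI simp: vec_eq_iff)
  have contP: "continuous_on UNIV P" and contQ: "continuous_on UNIV Q"
    using linP linQ by (auto simp: linear_continuous_on linear_conv_bounded_linear)
  have [measurable]: "P \<in> borel \<rightarrow>\<^sub>M borel" "Q \<in> borel \<rightarrow>\<^sub>M borel"
    using contP contQ by (auto intro: borel_measurable_continuous_onI)
  have Qaxis: "Q (axis i 1) = axis (h i) 1" for i
    by (auto simp: Q_def axis_def vec_eq_iff ih)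
  have "bij_betw Q Basis Basis"
    unfolding bij_betw_def
  proof
    show "inj_on Q Basis" by (metis PQ(1) inj_onI)
    have "Q ` Basis = (\<lambda>i. axis (h i) 1) ` UNIV"
      by (simp add: Basis_real_vec image_image Qaxis)
    also have "\<dots> = (\<lambda>a. axis a 1) ` h ` UNIV" by (simp only: image_image)
    also have "\<dots> = Basis" using h by (simp add: Basis_real_vec bij_is_surj)
    finally show "Q ` Basis = Basis" .
  qed
  then have dQ: "distr lborel borel Q = lborel" by (rule distr_lborel_basis_bij[OF linQ])
  have pull: "(\<integral>\<^sup>+x. G x \<partial>lborel) = (\<integral>\<^sup>+y. G (Q y) \<partial>lborel)" if "G \<in> borel_measurable borel" for G
    using that by (subst dQ[symmetric]) (simp add: nn_integral_distr)
  let ?g = "P \<circ> g \<circ> Q" and ?S = "Q -` S"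
  have oS: "open ?S" using open_vimage[OF S contQ] .
  have "continuous_on S g" using der has_derivative_continuous_on[of S g g'] by (meson has_derivative_at_withinI)
  then have "open (g ` S)" by (rule invariance_of_domain[OF _ S inj])
  then have [measurable]: "g ` S \<in> sets borel" by simp
  have img: "indicator (g ` S) (Q z) = (indicator (?g ` ?S) z :: ennreal)" for z
  proof -
    have "Q z \<in> g ` S \<longleftrightarrow> z \<in> ?g ` ?S"
    proof
      assume "Q z \<in> g ` S"
      then obtain x where x: "x \<in> S" "Q z = g x" by auto
      have z: "z = P (g x)" using arg_cong[OF x(2), of P] by (simp only: PQ)
      have "z = ?g (P x)" unfolding comp_apply PQ by (rule z)
      moreover have "P x \<in> ?S" using x(1) by simp
      ultimately have "z = ?g (P x) \<and> P x \<in> ?S" ..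
      then show "z \<in> ?g ` ?S" by blast
    qed auto
    then show ?thesis by (simp add: indicator_def)
  qed
  have "(\<integral>\<^sup>+y. F y * indicator (g ` S) y \<partial>lborel) = (\<integral>\<^sup>+z. F (Q z) * indicator (g ` S) (Q z) \<partial>lborel)"
    by (rule pull) measurable
  also have "\<dots> = (\<integral>\<^sup>+z. (F \<circ> Q) z * indicator (?g ` ?S) z \<partial>lborel)" by (simp add: img)
  also have "\<dots> = (\<integral>\<^sup>+y. ennreal ((D \<circ> Q) y) * (F \<circ> Q) (?g y) * indicator ?S y \<partial>lborel)"
  proof (rule nn_integral_change_of_variables_wellorder[where g' = "\<lambda>y. P \<circ> g' (Q y) \<circ> Q", OF oS])
    have dP: "(P has_derivative P) F'" "(Q has_derivative Q) F''" for F' F''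
      using linP linQ by (auto intro!: linear_imp_has_derivative)
    fix y assume y: "y \<in> ?S"
    have "(g has_derivative g' (Q y)) (at (Q y))" using der y by simp
    then show "(?g has_derivative P \<circ> g' (Q y) \<circ> Q) (at y)"
      by (intro diff_chain_at) (auto intro: dP)
    have lg: "linear (g' (Q y))" using der[of "Q y"] y by (auto intro: has_derivative_linear)
    have "matrix (P \<circ> g' (Q y) \<circ> Q) = (\<chi> i j. matrix (g' (Q y)) $ h i $ h j)"
      by (simp add: matrix_def vec_eq_iff Qaxis P_def)
    then show "\<bar>det (matrix (P \<circ> g' (Q y) \<circ> Q))\<bar> = (D \<circ> Q) y"
      using det_reindex[OF h, of "matrix (g' (Q y))"] D[of "Q y"] y by simp
  next
    show "inj_on ?g ?S"
    proof (rule inj_onI)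
      fix a b assume ab: "a \<in> ?S" "b \<in> ?S" "?g a = ?g b"
      then have "g (Q a) = g (Q b)" by (metis PQ(2) comp_apply)
      then have "Q a = Q b" using inj ab by (auto simp: inj_on_def)
      then show "a = b" by (metis PQ(1))
    qed
  qed measurable
  also have "\<dots> = (\<integral>\<^sup>+y. ennreal (D (Q y)) * F (g (Q y)) * indicator S (Q y) \<partial>lborel)"
    by (simp add: indicator_def)
  also have "\<dots> = (\<integral>\<^sup>+x. ennreal (D x) * F (g x) * indicator S x \<partial>lborel)"
    by (rule pull[symmetric]) measurable
  finally show ?thesis .
qed

lemma distr_lborel_orthogonal:
  fixes U :: "real ^ 'n \<Rightarrow> real ^ 'n"
  assumes U: "orthogonal_transformation U"
  shows "distr lborel borel U = lborel"
proof (rule measure_eqI)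
  have lin: "linear U" using U by (rule orthogonal_transformation_linear)
  have [measurable]: "U \<in> borel \<rightarrow>\<^sub>M borel"
    using lin by (intro borel_measurable_continuous_onI linear_continuous_on) (simp add: linear_conv_bounded_linear)
  fix A assume "A \<in> sets (distr lborel borel U)"
  then have A [measurable]: "A \<in> sets borel" by simp
  have "emeasure lborel A = (\<integral>\<^sup>+y. indicator A y * indicator (U ` UNIV) y \<partial>lborel)"
    using orthogonal_transformation_surj[OF U] by simp
  also have "\<dots> = (\<integral>\<^sup>+x. ennreal 1 * indicator A (U x) * indicator UNIV x \<partial>lborel)"
    by (rule nn_integral_change_of_variables[where g' = "\<lambda>_. U"])
       (use U lin orthogonal_transformation_det[OF U] in
        \<open>auto intro: linear_imp_has_derivative orthogonal_transformation_inj simp: orthogonal_transformation_inj\<close>)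
  also have "\<dots> = emeasure (distr lborel borel U) A"
  proof -
    have "U -` A \<in> sets borel" using measurable_sets[OF \<open>U \<in> borel \<rightarrow>\<^sub>M borel\<close> A] by simp
    moreover have "indicator A (U x) = (indicator (U -` A) x :: ennreal)" for x by (simp add: indicator_def)
    ultimately show ?thesis by (simp add: emeasure_distr)
  qed
  finally show "emeasure (distr lborel borel U) A = emeasure lborel A" by simp
qed simp

text \<open>
  After matching the two orthonormal bases, a linear isometry becomes an orthogonal transformation,
  whose determinant is \<open>1\<close> up to sign.
\<close>

lemma distr_lborel_linear_isometry:
  fixes T :: "'a::euclidean_space \<Rightarrow> real ^ 'n"
  assumes T: "linear T" and iso: "\<And>x. norm (T x) = norm x" and dim: "DIM('a) = CARD('n)"
  shows "distr lborel borel T = lborel"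
proof -
  obtain \<sigma> :: "'a \<Rightarrow> real ^ 'n" where \<sigma>: "bij_betw \<sigma> Basis Basis"
    using finite_same_card_bij[of "Basis :: 'a set" "Basis :: (real ^ 'n) set"] dim by auto
  define C where "C x = (\<Sum>b\<in>Basis. (x \<bullet> b) *\<^sub>R \<sigma> b)" for x
  define C' where "C' y = (\<Sum>b\<in>Basis. (y \<bullet> \<sigma> b) *\<^sub>R b)" for y
  have lC: "linear C" "linear C'"
    unfolding C_def[abs_def] C'_def[abs_def]
    by (auto intro!: linearI simp: inner_add_left scaleR_add_left sum.distrib scaleR_sum_right)
  have s: "\<sigma> b \<bullet> \<sigma> c = (if b = c then 1 else 0)" if "b \<in> Basis" "c \<in> Basis" for b c
  proof -
    have "\<sigma> b \<in> Basis" "\<sigma> c \<in> Basis" using \<sigma> that by (auto simp: bij_betw_def)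
    moreover have "\<sigma> b = \<sigma> c \<longleftrightarrow> b = c" using \<sigma> that by (auto simp: bij_betw_def dest: inj_onD)
    ultimately show ?thesis by (simp add: inner_Basis)
  qed
  have Cb: "C b = \<sigma> b" if "b \<in> Basis" for b
  proof -
    have "C b = (\<Sum>c\<in>Basis. if c = b then \<sigma> c else 0)"
      unfolding C_def using that by (intro sum.cong) (auto simp: inner_Basis)
    then show ?thesis using that by simp
  qed
  have CC: "C' (C x) = x" for x
  proof (rule euclidean_eqI)
    fix b :: 'a assume b: "b \<in> Basis"
    have "C' (C x) \<bullet> b = C x \<bullet> \<sigma> b" using b by (simp add: C'_def)
    also have "\<dots> = (\<Sum>c\<in>Basis. if c = b then x \<bullet> c else 0)"
      unfolding C_def inner_sum_left using b by (intro sum.cong) (auto simp: s)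
    finally show "C' (C x) \<bullet> b = x \<bullet> b" using b by simp
  qed
  have nC': "norm (C' y) = norm y" for y
  proof -
    have "(norm (C' y))\<^sup>2 = (\<Sum>b\<in>Basis. (y \<bullet> \<sigma> b)\<^sup>2)"
      by (subst power2_norm_eq_inner, subst euclidean_inner) (simp add: C'_def power2_eq_square)
    also have "\<dots> = (\<Sum>b\<in>Basis. (y \<bullet> b)\<^sup>2)" by (rule sum.reindex_bij_betw[OF \<sigma>])
    also have "\<dots> = (norm y)\<^sup>2"
      by (subst power2_norm_eq_inner, subst euclidean_inner) (simp add: power2_eq_square)
    finally show ?thesis by simp
  qed
  have "bij_betw C Basis Basis" using \<sigma> Cb by (simp cong: bij_betw_cong)
  then have dC: "distr lborel borel C = lborel" by (rule distr_lborel_basis_bij[OF lC(1)])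
  have oU: "orthogonal_transformation (T \<circ> C')"
    unfolding orthogonal_transformation using T lC by (auto simp: linear_compose iso nC')
  have m [measurable]: "C \<in> borel \<rightarrow>\<^sub>M borel" "T \<circ> C' \<in> borel \<rightarrow>\<^sub>M borel"
    using lC(1) orthogonal_transformation_linear[OF oU]
    by (auto intro!: borel_measurable_continuous_onI linear_continuous_on simp: linear_conv_bounded_linear)
  have "T = (T \<circ> C') \<circ> C" by (simp add: fun_eq_iff CC)
  then have "distr lborel borel T = distr (distr lborel borel C) borel (T \<circ> C')"
    using m by (subst distr_distr) auto
  also have "\<dots> = lborel" unfolding dC by (rule distr_lborel_orthogonal[OF oU])
  finally show ?thesis .
qed

section \<open>Surface measure of a hemisphere\<close>

lemma det_scale_coordinate:
  fixes k :: "'m::finite"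
  shows "det (matrix (\<lambda>x :: real ^ 'm. \<chi> i. (if i = k then a else 1) * x $ i)) = a"
proof -
  have "matrix (\<lambda>x :: real ^ 'm. \<chi> i. (if i = k then a else 1) * x $ i) = (\<chi> i j. if i = j then (if i = k then a else 1) else 0)"
    by (auto simp: matrix_def axis_def vec_eq_iff)
  then have "det (matrix (\<lambda>x :: real ^ 'm. \<chi> i. (if i = k then a else 1) * x $ i)) = (\<Prod>i\<in>UNIV. if i = k then a else 1)"
    by (subst det_diagonal) auto
  also have "\<dots> = a" by (simp add: prod.delta)
  finally show ?thesis .
qed

text \<open>
  The quadratic form \<open>|d|\<^sup>2 + (q \<bullet> d)\<^sup>2\<close> is the metric of a graph whose slope is \<open>q\<close>.  A rotation takes \<open>q\<close> to
  a coordinate axis, and there the form is diagonal with entries \<open>1\<close> except for one entry \<open>1 + |q|\<^sup>2\<close>; scaling that coordinate by the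
  root of this entry gives \<open>T\<close>.
\<close>

lemma rank_one_root_exists:
  fixes q :: "real ^ 'm"
  obtains T :: "real ^ 'm \<Rightarrow> real ^ 'm" where "linear T"
    "\<And>d. (norm (T d))\<^sup>2 = (norm d)\<^sup>2 + (q \<bullet> d)\<^sup>2" "\<bar>det (matrix T)\<bar> = sqrt (1 + (norm q)\<^sup>2)"
proof -
  obtain k :: 'm where True by simp
  have "norm q = norm (norm q *\<^sub>R axis k (1::real))" by (simp add: norm_axis_1)
  then obtain R where R: "orthogonal_transformation R" "R q = norm q *\<^sub>R axis k (1::real)"
    by (rule orthogonal_transformation_exists) (erule (1) that)
  define a where "a = sqrt (1 + (norm q)\<^sup>2)"
  have a2: "a\<^sup>2 = 1 + (norm q)\<^sup>2" and a0: "0 \<le> a" by (auto simp: a_def)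
  define D where "D x = (\<chi> i. (if i = k then a else 1) * x $ i)" for x :: "real ^ 'm"
  have linD: "linear D" by (rule linearI) (auto simp: D_def vec_eq_iff algebra_simps)
  have linR: "linear R" using R(1) by (rule orthogonal_transformation_linear)
  have nD: "(norm (D x))\<^sup>2 = (norm x)\<^sup>2 + (norm q * x $ k)\<^sup>2" for x
  proof -
    have "(norm (D x))\<^sup>2 = (\<Sum>i\<in>UNIV. ((if i = k then a else 1) * x $ i)\<^sup>2)"
      unfolding power2_norm_eq_inner by (simp add: inner_vec_def D_def power2_eq_square)
    also have "\<dots> = (\<Sum>i\<in>UNIV. (x $ i)\<^sup>2 + (if i = k then (norm q * x $ k)\<^sup>2 else 0))"
      by (intro sum.cong) (auto simp: power_mult_distrib a2 algebra_simps)
    also have "\<dots> = (norm x)\<^sup>2 + (norm q * x $ k)\<^sup>2"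
      unfolding power2_norm_eq_inner by (simp add: sum.distrib inner_vec_def power2_eq_square)
    finally show ?thesis .
  qed
  show thesis
  proof (rule that[of "D \<circ> R"])
    show "linear (D \<circ> R)" using linR linD by (rule linear_compose)
    show "(norm ((D \<circ> R) d))\<^sup>2 = (norm d)\<^sup>2 + (q \<bullet> d)\<^sup>2" for d
    proof -
      have "q \<bullet> d = R q \<bullet> R d" using R(1) by (simp add: orthogonal_transformation_def)
      also have "\<dots> = norm q * R d $ k" by (simp add: R(2) inner_axis')
      finally show ?thesis using R(1) by (simp add: nD orthogonal_transformation_norm)
    qed
    have "det (matrix (D \<circ> R)) = det (matrix D) * det (matrix R)"
      using linD linR by (simp add: matrix_compose det_mul)
    then show "\<bar>det (matrix (D \<circ> R))\<bar> = sqrt (1 + (norm q)\<^sup>2)"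
      using orthogonal_transformation_det[OF R(1)] a0
      by (simp add: abs_mult det_scale_coordinate D_def[abs_def] a_def)
  qed
qed

lemma linear_image_borel:
  fixes T :: "real ^ 'm \<Rightarrow> real ^ 'm"
  assumes T: "linear T" "inj T" and E: "E \<in> sets borel"
  shows "T ` E \<in> sets borel" "emeasure lborel (T ` E) = ennreal \<bar>det (matrix T)\<bar> * emeasure lborel E"
proof -
  obtain T' where T': "linear T'" "T' \<circ> T = id" using linear_injective_left_inverse[OF T] by metis
  have TT: "T' (T x) = x" for x using T'(2) by (metis comp_apply id_apply)
  have surj: "surj T" using T by (rule linear_inj_imp_surj)
  have c: "continuous_on UNIV T'" "continuous_on UNIV T"
    using T T' by (auto simp: linear_continuous_on linear_conv_bounded_linear)
  then have m [measurable]: "T' \<in> borel \<rightarrow>\<^sub>M borel" "T \<in> borel \<rightarrow>\<^sub>M borel" by (auto intro: borel_measurable_continuous_onI)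
  have "T ` E = T' -` E \<inter> space borel"
  proof (intro equalityI subsetI)
    fix y assume y: "y \<in> T' -` E \<inter> space borel"
    obtain x where "y = T x" using surj by (metis surjD)
    then show "y \<in> T ` E" using y TT by simp
  qed (auto simp: TT)
  then show TE: "T ` E \<in> sets borel" using measurable_sets[OF m(1) E] by simp
  note [measurable] = TE E
  have "emeasure lborel (T ` E) = (\<integral>\<^sup>+y. indicator (T ` E) y * indicator (T ` UNIV) y \<partial>lborel)"
    using surj by simp
  also have "\<dots> = (\<integral>\<^sup>+x. ennreal \<bar>det (matrix T)\<bar> * indicator (T ` E) (T x) * indicator UNIV x \<partial>lborel)"
    by (rule nn_integral_change_of_variables[where g' = "\<lambda>_. T"]) (use T in \<open>auto intro: linear_imp_has_derivative\<close>)
  also have "\<dots> = (\<integral>\<^sup>+x. ennreal \<bar>det (matrix T)\<bar> * indicator E x \<partial>lborel)"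
    using T(2) by (intro nn_integral_cong) (auto simp: indicator_def inj_image_mem_iff)
  also have "\<dots> = ennreal \<bar>det (matrix T)\<bar> * emeasure lborel E"
    by (simp add: nn_integral_cmult)
  finally show "emeasure lborel (T ` E) = ennreal \<bar>det (matrix T)\<bar> * emeasure lborel E" .
qed

text \<open>
  The isometry \<open>E\<close> spans an \<open>m\<close>-dimensional subspace, \<open>e\<close> is a unit vector normal to it, and \<open>\<sigma>\<close> chooses
  one of the two hemispheres of the sphere of radius \<open>r\<close> about \<open>c\<close> in the span of both.  The hemisphere is the graph
  of \<open>\<sigma> height\<close> over the ball of radius \<open>r\<close>.
\<close>

locale hemisphere =
  fixes E :: "real ^ 'm \<Rightarrow> 'v::euclidean_space" and e c :: 'v and r \<sigma> :: real
  assumes linE: "linear E" and normE: "\<And>u. norm (E u) = norm u" and e: "norm e = 1"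
    and orth: "\<And>u. e \<bullet> E u = 0" and r: "0 < r" and \<sigma>: "\<sigma> = 1 \<or> \<sigma> = - 1"
begin

definition height :: "real ^ 'm \<Rightarrow> real" where "height u = sqrt (r\<^sup>2 - (norm u)\<^sup>2)"
definition graph :: "real ^ 'm \<Rightarrow> 'v" where "graph u = c + E u + (\<sigma> * height u) *\<^sub>R e"
definition stretch :: "real ^ 'm \<Rightarrow> real" where "stretch u = r / height u"
definition proj :: "'v \<Rightarrow> real ^ 'm" where "proj y = (\<chi> i. (y - c) \<bullet> E (axis i 1))"

lemma inner_E: "E u \<bullet> E v = u \<bullet> v"
proof -
  have n: "E w \<bullet> E w = w \<bullet> w" for w
    using normE[of w] by (simp flip: power2_norm_eq_inner)
  show ?thesis
    using n[of "u + v"] n[of u] n[of v] linear_add[OF linE, of u v]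
    by (simp add: inner_add_left inner_add_right inner_commute)
qed

lemma proj_graph [simp]: "proj (graph u) = u"
proof (rule vec_eq_iff[THEN iffD2], rule allI)
  fix i
  have "proj (graph u) $ i = E u \<bullet> E (axis i 1) + (\<sigma> * height u) * (e \<bullet> E (axis i 1))"
    by (simp add: proj_def graph_def inner_add_left)
  then show "proj (graph u) $ i = u $ i" by (simp add: orth inner_E inner_axis)
qed

lemma continuous_height: "continuous_on UNIV height"
  unfolding height_def[abs_def] by (intro continuous_intros)

lemma continuous_graph: "continuous_on UNIV graph"
proof -
  have "continuous_on UNIV E" using linE by (simp add: linear_continuous_on linear_conv_bounded_linear)
  then show ?thesis unfolding graph_def[abs_def] by (intro continuous_intros continuous_height)
qed

lemma continuous_proj: "continuous_on UNIV proj"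
  unfolding proj_def[abs_def] by (intro continuous_intros)

lemma measurable_graph [measurable]: "graph \<in> borel \<rightarrow>\<^sub>M borel"
  by (rule borel_measurable_continuous_onI[OF continuous_graph])

lemma measurable_stretch [measurable]: "stretch \<in> borel_measurable borel"
proof -
  have [measurable]: "height \<in> borel_measurable borel" by (rule borel_measurable_continuous_onI[OF continuous_height])
  show ?thesis unfolding stretch_def[abs_def] by measurable
qed

lemma inj_graph: "inj graph"
  by (metis proj_graph injI)

text \<open>
  The projection \<open>proj\<close> is a left inverse of \<open>graph\<close>, so the image of \<open>A\<close> is the part of a closed set, the
  graph, that projects into \<open>A\<close>.
\<close>

lemma graph_image_borel:
  assumes "A \<in> sets borel" shows "graph ` A \<in> sets borel"
proof -
  have Pm: "proj \<in> borel \<rightarrow>\<^sub>M borel" by (rule borel_measurable_continuous_onI[OF continuous_proj])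
  have "continuous_on UNIV (\<lambda>y. graph (proj y))"
    using continuous_on_compose2[OF continuous_graph continuous_proj] by simp
  then have "closed {y. graph (proj y) = y}" by (intro closed_Collect_eq continuous_intros)
  moreover have "graph ` A = (proj -` A \<inter> space borel) \<inter> {y. graph (proj y) = y}"
  proof (intro equalityI subsetI)
    fix y assume "y \<in> (proj -` A \<inter> space borel) \<inter> {y. graph (proj y) = y}"
    then have "proj y \<in> A" "graph (proj y) = y" by auto
    then show "y \<in> graph ` A" by (intro image_eqI[of y graph "proj y"]) auto
  qed auto
  ultimately show ?thesis using measurable_sets[OF Pm assms] by simp
qed

lemma height_pos: "u \<in> ball 0 r \<Longrightarrow> 0 < height u"
  unfolding height_def using r by (simp add: power_strict_mono)

lemma height_sq: "u \<in> ball 0 r \<Longrightarrow> (height u)\<^sup>2 = r\<^sup>2 - (norm u)\<^sup>2"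
  unfolding height_def using r by (simp add: power_mono)

text \<open>
  The average slope of \<open>height\<close> between \<open>u\<close> and \<open>v\<close>, up to sign: since \<open>height\<^sup>2 = r\<^sup>2 - |u|\<^sup>2\<close>, dividing the
  difference of the squares by the sum of the heights gives an exact difference quotient.  On the diagonal
  it is the gradient up to sign.
\<close>

definition slope :: "real ^ 'm \<Rightarrow> real ^ 'm \<Rightarrow> real ^ 'm" where
  "slope u v = (1 / (height u + height v)) *\<^sub>R (u + v)"

text \<open>
  Distances on the hemisphere have exactly the form considered in \<open>rank_one_root_exists\<close>, with a
  vector \<open>slope u v\<close> that depends continuously on both points.
\<close>

lemma norm_graph_diff:
  assumes u: "u \<in> ball 0 r" and v: "v \<in> ball 0 r"
  shows "norm (graph u - graph v) = norm (u - v, slope u v \<bullet> (u - v))"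
proof -
  have p: "0 < height u + height v" using height_pos[OF u] height_pos[OF v] by simp
  have "(height u - height v) * (height u + height v) = (height u)\<^sup>2 - (height v)\<^sup>2" by (simp add: power2_eq_square algebra_simps)
  also have "\<dots> = - ((u + v) \<bullet> (u - v))"
    by (simp add: height_sq[OF u] height_sq[OF v] power2_norm_eq_inner inner_add_left inner_add_right inner_diff_left inner_diff_right inner_commute)
  finally have "height u - height v = - ((u + v) \<bullet> (u - v)) / (height u + height v)"
    using p by (simp only: eq_divide_eq) simp
  then have "height u - height v = - (slope u v \<bullet> (u - v))"
    unfolding slope_def inner_scaleR_left by simp
  then have d: "(height u - height v)\<^sup>2 = (slope u v \<bullet> (u - v))\<^sup>2" by simp
  have "graph u - graph v = E (u - v) + (\<sigma> * (height u - height v)) *\<^sub>R e"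
    using linE by (simp add: graph_def linear_diff algebra_simps)
  then have "(norm (graph u - graph v))\<^sup>2 = (norm (E (u - v)))\<^sup>2 + (\<sigma> * (height u - height v))\<^sup>2"
    using orth[of "u - v"] e unfolding power2_norm_eq_inner
    by (simp add: inner_add_left inner_add_right inner_commute norm_eq_1 power2_eq_square)
  also have "\<dots> = (norm (u - v))\<^sup>2 + (slope u v \<bullet> (u - v))\<^sup>2"
    using \<sigma> d by (auto simp: normE power_mult_distrib)
  finally have "norm (graph u - graph v) = sqrt ((norm (u - v))\<^sup>2 + (slope u v \<bullet> (u - v))\<^sup>2)"
    by (metis norm_ge_zero real_sqrt_abs2 real_sqrt_unique)
  then show ?thesis by (simp add: norm_prod_def)
qed

lemma stretch_eq: 
  assumes u: "u \<in> ball 0 r" shows "stretch u = sqrt (1 + (norm (slope u u))\<^sup>2)"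
proof -
  have p: "0 < height u" by (rule height_pos[OF u])
  have "slope u u = (1 / height u) *\<^sub>R u" using p by (simp add: slope_def scaleR_2[symmetric])
  then have "1 + (norm (slope u u))\<^sup>2 = ((height u)\<^sup>2 + (norm u)\<^sup>2) / (height u)\<^sup>2"
    using p by (simp add: power_mult_distrib power_divide field_simps)
  also have "\<dots> = (stretch u)\<^sup>2" using p by (simp add: height_sq[OF u] stretch_def power_divide)
  finally show ?thesis using p r by (simp add: stretch_def)
qed

text \<open>
  Near \<open>p\<close> the slope is almost \<open>slope p p\<close>, so chords of the graph are almost as long as the images of \<open>u - v\<close>
  under the fixed linear map \<open>T\<close> that belongs to \<open>slope p p\<close>; the determinant of \<open>T\<close> is the stretch factor at \<open>p\<close>.
\<close>

lemma local_bilipschitz: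
  assumes p: "p \<in> ball 0 r" and l: "1 < l"
  obtains U T where "open U" "p \<in> U" "U \<subseteq> ball 0 r" "linear T" "inj T" "\<bar>det (matrix T)\<bar> = stretch p"
    "\<And>u v. u \<in> U \<Longrightarrow> v \<in> U \<Longrightarrow> norm (graph u - graph v) \<le> l * norm (T (u - v))"
    "\<And>u v. u \<in> U \<Longrightarrow> v \<in> U \<Longrightarrow> norm (T (u - v)) \<le> l * norm (graph u - graph v)"
    "\<And>u. u \<in> U \<Longrightarrow> stretch u \<le> l * stretch p" "\<And>u. u \<in> U \<Longrightarrow> stretch p \<le> l * stretch u"
proof -
  let ?q = "slope p p"
  obtain T where T: "linear T" "\<And>d. (norm (T d))\<^sup>2 = (norm d)\<^sup>2 + (?q \<bullet> d)\<^sup>2" "\<bar>det (matrix T)\<bar> = sqrt (1 + (norm ?q)\<^sup>2)"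
    by (rule rank_one_root_exists[of ?q]) (rule that)
  \<comment> \<open>The model map \<open>T\<close> has the length formula of \<open>norm_graph_diff\<close> with the slope frozen at \<open>p\<close>.\<close>
  have nT: "norm (T d) = norm (d, ?q \<bullet> d)" for d
    using T(2)[of d] by (metis norm_ge_zero norm_prod_def fst_conv snd_conv real_norm_def power2_abs real_sqrt_unique)
  have Tge: "norm d \<le> norm (T d)" for d using norm_fst_le[of d "?q \<bullet> d"] by (simp add: nT)
  have injT: "inj T"
  proof (rule linear_injective_0[OF T(1), THEN iffD2], intro allI impI)
    fix d assume "T d = 0" then show "d = 0" using Tge[of d] by simp
  qed
  \<comment> \<open>With this choice \<open>1 - \<epsilon>\<close> is exactly \<open>1 / l\<close>, and \<open>1 + \<epsilon> \<le> l\<close> amounts to \<open>(l - 1)\<^sup>2 \<ge> 0\<close>.\<close>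
  define \<epsilon> where "\<epsilon> = 1 - 1 / l"
  have \<epsilon>: "0 < \<epsilon>" "1 - \<epsilon> = 1 / l" "1 + \<epsilon> \<le> l"
  proof -
    show "0 < \<epsilon>" "1 - \<epsilon> = 1 / l" using l by (auto simp: \<epsilon>_def)
    have "(l - 1) * (l - 1) \<ge> 0" by simp
    then show "1 + \<epsilon> \<le> l" using l by (simp add: \<epsilon>_def field_simps)
  qed
  have height_p: "0 < height p" by (rule height_pos[OF p])
  have cont_at: "isCont height x" for x using continuous_height by (simp add: continuous_on_eq_continuous_at)
  have f: "isCont fst (p, p)" "isCont snd (p, p)" by (intro continuous_intros)+
  have "isCont (\<lambda>z. height (fst z)) (p, p)" "isCont (\<lambda>z. height (snd z)) (p, p)"
    by (rule isCont_o2[OF f(1)], rule cont_at) (rule isCont_o2[OF f(2)], rule cont_at)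
  then have "isCont (\<lambda>z. slope (fst z) (snd z)) (p, p)"
    unfolding slope_def by (intro continuous_intros) (use height_p in auto)
  then have "((\<lambda>z. slope (fst z) (snd z)) \<longlongrightarrow> ?q) (nhds (p, p))"
    using tendsto_at_iff_tendsto_nhds[of "\<lambda>z. slope (fst z) (snd z)" "(p, p)"] by (simp add: isCont_def)
  then have "\<forall>\<^sub>F z in nhds (p, p). dist (slope (fst z) (snd z)) ?q < \<epsilon>"
    using \<epsilon>(1) by (rule tendstoD)
  then obtain S where S: "open S" "(p, p) \<in> S" "\<And>z. z \<in> S \<Longrightarrow> dist (slope (fst z) (snd z)) ?q < \<epsilon>"
    unfolding eventually_nhds by blast
  obtain A B where AB: "open A" "open B" "(p, p) \<in> A \<times> B" "A \<times> B \<subseteq> S"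
    using open_prod_elim[OF S(1,2)] by metis
  have stretch_p: "0 < stretch p" using height_p r by (simp add: stretch_def)
  have "isCont stretch p" unfolding stretch_def[abs_def] using height_p by (intro continuous_intros cont_at) auto
  then have tJ: "(stretch \<longlongrightarrow> stretch p) (nhds p)" by (simp add: isCont_def tendsto_at_iff_tendsto_nhds)
  have "stretch p < l * stretch p" "stretch p / l < stretch p" using l stretch_p by (auto simp: field_simps)
  then have "\<forall>\<^sub>F u in nhds p. stretch u < l * stretch p" "\<forall>\<^sub>F u in nhds p. stretch p / l < stretch u"
    using order_tendstoD[OF tJ] by blast+
  then have "\<forall>\<^sub>F u in nhds p. stretch u < l * stretch p \<and> stretch p / l < stretch u" by (rule eventually_conj)
  then obtain C where C: "open C" "p \<in> C" "\<And>u. u \<in> C \<Longrightarrow> stretch u < l * stretch p" "\<And>u. u \<in> C \<Longrightarrow> stretch p / l < stretch u"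
    unfolding eventually_nhds by blast
  define U where "U = A \<inter> B \<inter> C \<inter> ball 0 r"
  have near: "\<bar>norm (graph u - graph v) - norm (T (u - v))\<bar> \<le> \<epsilon> * norm (T (u - v))" if uv: "u \<in> U" "v \<in> U" for u v
  proof -
    have ub: "u \<in> ball 0 r" "v \<in> ball 0 r" and "(u, v) \<in> S" using uv AB(4) by (auto simp: U_def)
    then have s: "norm (slope u v - ?q) < \<epsilon>" using S(3)[of "(u, v)"] by (simp add: dist_norm)
    \<comment> \<open>Both lengths are norms of vectors in the product space that share their first component.\<close>
    have "\<bar>norm (graph u - graph v) - norm (T (u - v))\<bar> \<le> norm ((u - v, slope u v \<bullet> (u - v)) - (u - v, ?q \<bullet> (u - v)))"
      unfolding norm_graph_diff[OF ub] nT by (rule norm_triangle_ineq3)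
    also have "\<dots> = \<bar>(slope u v - ?q) \<bullet> (u - v)\<bar>" by (simp add: norm_prod_def inner_diff_left)
    also have "\<dots> \<le> norm (slope u v - ?q) * norm (u - v)" by (rule Cauchy_Schwarz_ineq2)
    also have "\<dots> \<le> \<epsilon> * norm (T (u - v))" using s Tge[of "u - v"] \<epsilon>(1) by (intro mult_mono) auto
    finally show ?thesis .
  qed
  show thesis
  proof (rule that[of U T])
    show "open U" using AB C by (auto simp: U_def)
    show "p \<in> U" using AB C p by (auto simp: U_def)
    show "U \<subseteq> ball 0 r" by (auto simp: U_def)
    show "linear T" "inj T" by fact+
    show "\<bar>det (matrix T)\<bar> = stretch p" using T(3) by (simp add: stretch_eq[OF p])
    fix u v assume uv: "u \<in> U" "v \<in> U"
    have "norm (graph u - graph v) \<le> (1 + \<epsilon>) * norm (T (u - v))" using near[OF uv] by (simp add: algebra_simps abs_le_iff)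
    also have "\<dots> \<le> l * norm (T (u - v))" using \<epsilon>(3) by (intro mult_right_mono) auto
    finally show "norm (graph u - graph v) \<le> l * norm (T (u - v))" .
    have "(1 - \<epsilon>) * norm (T (u - v)) \<le> norm (graph u - graph v)" using near[OF uv] by (simp add: algebra_simps abs_le_iff)
    then show "norm (T (u - v)) \<le> l * norm (graph u - graph v)" using l unfolding \<epsilon>(2) by (simp add: field_simps)
  next
    fix u assume "u \<in> U"
    then have "u \<in> C" by (simp add: U_def)
    then show "stretch u \<le> l * stretch p" "stretch p \<le> l * stretch u" using C(3,4)[of u] l by (auto simp: field_simps intro: less_imp_le)
  qed
qed

text \<open>
  Through \<open>T\<close>, the piece of the graph over \<open>A\<close> is bi-Lipschitz equivalent to the flat set \<open>T ` A\<close>, whose Hausdorff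
  measure is \<open>stretch p\<close> times the volume of \<open>A\<close>.  The bi-Lipschitz maps cost a factor \<open>l\<^sup>m\<close>, and replacing \<open>stretch p\<close> by
  \<open>stretch u\<close> costs one more factor \<open>l\<close>.
\<close>

lemma local_area_estimate:
  assumes p: "p \<in> ball 0 r" and l: "1 < l"
  obtains U where "open U" "p \<in> U" "U \<subseteq> ball 0 r"
    "\<And>A. A \<in> sets borel \<Longrightarrow> A \<subseteq> U \<Longrightarrow> hausdorff_outer CARD('m) (graph ` A) \<le> ennreal (l ^ Suc CARD('m)) * (\<integral>\<^sup>+u. ennreal (stretch u) * indicator A u \<partial>lborel)"
    "\<And>A. A \<in> sets borel \<Longrightarrow> A \<subseteq> U \<Longrightarrow> (\<integral>\<^sup>+u. ennreal (stretch u) * indicator A u \<partial>lborel) \<le> ennreal (l ^ Suc CARD('m)) * hausdorff_outer CARD('m) (graph ` A)"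
proof -
  obtain U T where U: "open U" "p \<in> U" "U \<subseteq> ball 0 r" and T: "linear T" "inj T" "\<bar>det (matrix T)\<bar> = stretch p"
    and up: "\<And>u v. u \<in> U \<Longrightarrow> v \<in> U \<Longrightarrow> norm (graph u - graph v) \<le> l * norm (T (u - v))"
    and lo: "\<And>u v. u \<in> U \<Longrightarrow> v \<in> U \<Longrightarrow> norm (T (u - v)) \<le> l * norm (graph u - graph v)"
    and stretch: "\<And>u. u \<in> U \<Longrightarrow> stretch u \<le> l * stretch p" "\<And>u. u \<in> U \<Longrightarrow> stretch p \<le> l * stretch u"
    using local_bilipschitz[OF p l] by metis
  have stretch_p: "0 < stretch p" using height_pos[OF p] r by (simp add: stretch_def)
  have l0: "0 < l" using l by simp
  show thesis
  proof (rule that[OF U])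
    fix A assume A: "A \<in> sets borel" "A \<subseteq> U"
    note [measurable] = A(1)
    \<comment> \<open>In the flat model Hausdorff measure is Lebesgue measure.\<close>
    have LT: "hausdorff_outer CARD('m) (T ` A) = ennreal (stretch p) * emeasure lborel A"
      using hausdorff_outer_eq_lborel[OF linear_image_borel(1)[OF T(1,2) A(1)]] linear_image_borel(2)[OF T(1,2) A(1)] T(3)
      by simp
    have "graph ` A = (graph \<circ> inv T) ` (T ` A)" using T(2) by (simp add: image_comp o_assoc)
    then have "hausdorff_outer CARD('m) (graph ` A) \<le> ennreal (l ^ CARD('m)) * hausdorff_outer CARD('m) (T ` A)"
    proof (simp only:, intro hausdorff_outer_lipschitz_image l0)
      fix x y assume "x \<in> T ` A" "y \<in> T ` A"
      then obtain u v where uv: "u \<in> A" "v \<in> A" "x = T u" "y = T v" by auto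
      then show "dist ((graph \<circ> inv T) x) ((graph \<circ> inv T) y) \<le> l * dist x y"
        using up[of u v] A(2) T by (auto simp: dist_norm linear_diff)
    qed
    also have "\<dots> = ennreal (l ^ CARD('m)) * (\<integral>\<^sup>+u. ennreal (stretch p) * indicator A u \<partial>lborel)"
      by (simp add: LT nn_integral_cmult)
    also have "\<dots> \<le> ennreal (l ^ CARD('m)) * (\<integral>\<^sup>+u. ennreal l * (ennreal (stretch u) * indicator A u) \<partial>lborel)"
      using A(2) stretch(2) l0 by (intro mult_left_mono nn_integral_mono) (auto simp: indicator_def ennreal_leI simp flip: ennreal_mult')
    also have "\<dots> = ennreal (l ^ Suc CARD('m)) * (\<integral>\<^sup>+u. ennreal (stretch u) * indicator A u \<partial>lborel)"
      using l0 by (subst nn_integral_cmult) (auto simp: ennreal_mult' mult_ac)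
    finally show "hausdorff_outer CARD('m) (graph ` A) \<le> ennreal (l ^ Suc CARD('m)) * (\<integral>\<^sup>+u. ennreal (stretch u) * indicator A u \<partial>lborel)" .
    have TA: "T ` A = (T \<circ> proj) ` (graph ` A)" by (simp add: image_image)
    have "(\<integral>\<^sup>+u. ennreal (stretch u) * indicator A u \<partial>lborel) \<le> (\<integral>\<^sup>+u. ennreal l * (ennreal (stretch p) * indicator A u) \<partial>lborel)"
      using A(2) stretch(1) l0 by (intro nn_integral_mono) (auto simp: indicator_def ennreal_leI simp flip: ennreal_mult')
    also have "\<dots> = ennreal l * hausdorff_outer CARD('m) (T ` A)"
      by (simp add: LT nn_integral_cmult)
    also have "\<dots> \<le> ennreal l * (ennreal (l ^ CARD('m)) * hausdorff_outer CARD('m) (graph ` A))"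
      unfolding TA
    proof (intro mult_left_mono hausdorff_outer_lipschitz_image l0)
      fix x y assume "x \<in> graph ` A" "y \<in> graph ` A"
      then obtain u v where uv: "u \<in> A" "v \<in> A" "x = graph u" "y = graph v" by auto
      then show "dist ((T \<circ> proj) x) ((T \<circ> proj) y) \<le> l * dist x y"
        using lo[of u v] A(2) T by (auto simp: dist_norm linear_diff)
    qed simp
    also have "\<dots> = ennreal (l ^ Suc CARD('m)) * hausdorff_outer CARD('m) (graph ` A)"
      using l0 by (simp add: ennreal_mult' mult_ac)
    finally show "(\<integral>\<^sup>+u. ennreal (stretch u) * indicator A u \<partial>lborel) \<le> ennreal (l ^ Suc CARD('m)) * hausdorff_outer CARD('m) (graph ` A)" .
  qed
qed

text \<open>
  For each \<open>l > 1\<close> countably many of the neighbourhoods in \<open>local_area_estimate\<close> suffice, by Lindelof's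
  theorem.  Both sides are countably additive in \<open>A\<close>, so the local estimates with the same constant add up to a
  global one, in which \<open>l\<close> tends to \<open>1\<close>.
\<close>

lemma emeasure_hemisphere:
  assumes A: "A \<in> sets borel" "A \<subseteq> ball 0 r"
  shows "hausdorff_outer CARD('m) (graph ` A) = (\<integral>\<^sup>+u. ennreal (stretch u) * indicator A u \<partial>lborel)"
proof -
  let ?\<nu> = "\<lambda>A. \<integral>\<^sup>+u. ennreal (stretch u) * indicator A u \<partial>lborel"
  have est: "hausdorff_outer CARD('m) (graph ` A) \<le> ennreal (l ^ Suc CARD('m)) * ?\<nu> A \<and> ?\<nu> A \<le> ennreal (l ^ Suc CARD('m)) * hausdorff_outer CARD('m) (graph ` A)"
    if l: "1 < l" for l
  proof -
    let ?c = "ennreal (l ^ Suc CARD('m))"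
    define good where "good U \<longleftrightarrow> open U \<and> (\<forall>B. B \<in> sets borel \<longrightarrow> B \<subseteq> U \<longrightarrow> hausdorff_outer CARD('m) (graph ` B) \<le> ?c * ?\<nu> B \<and> ?\<nu> B \<le> ?c * hausdorff_outer CARD('m) (graph ` B))" for U
    have ex: "\<exists>U. good U \<and> p \<in> U" if p: "p \<in> ball 0 r" for p
    proof -
      obtain U where "open U" "p \<in> U" "U \<subseteq> ball 0 r"
        and U: "\<And>B. B \<in> sets borel \<Longrightarrow> B \<subseteq> U \<Longrightarrow> hausdorff_outer CARD('m) (graph ` B) \<le> ?c * ?\<nu> B"
          "\<And>B. B \<in> sets borel \<Longrightarrow> B \<subseteq> U \<Longrightarrow> ?\<nu> B \<le> ?c * hausdorff_outer CARD('m) (graph ` B)"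
        by (rule local_area_estimate[OF p l]) (rule that)
      have "good U" unfolding good_def using \<open>open U\<close> by (intro conjI allI impI U)
      then show ?thesis using \<open>p \<in> U\<close> by blast
    qed
    obtain F where F: "F \<subseteq> {U. good U}" "countable F" "\<Union>F = \<Union>{U. good U}"
      using Lindelof[of "{U. good U}"] by (auto simp: good_def)
    have goodempty: "good {}" by (simp add: good_def)
    define U where "U = from_nat_into (insert {} F)"
    have rU: "range U = insert {} F" unfolding U_def using F(2) by (intro range_from_nat_into) auto
    have gU: "good (U n)" for n using rU F(1) goodempty by (metis insertE mem_Collect_eq rangeI subsetD)
    have cov: "A \<subseteq> (\<Union>n. U n)"
    proof
      fix p assume "p \<in> A"
      then have "p \<in> \<Union>F" using ex[of p] A(2) F(3) by auto
      then show "p \<in> (\<Union>n. U n)" using rU by auto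
    qed
    define D where "D n = A \<inter> disjointed U n" for n
    have Um: "range U \<subseteq> sets borel" using gU by (auto simp: good_def)
    have Dm [measurable]: "D n \<in> sets borel" for n
      using sets.range_disjointed_sets[OF Um] A(1) by (auto simp: D_def)
    have DU: "D n \<subseteq> U n" for n using disjointed_subset[of U n] by (auto simp: D_def)
    have dis: "disjoint_family D" using disjoint_family_disjointed[of U] by (auto simp: D_def disjoint_family_on_def)
    have AD: "A = (\<Union>n. D n)" using cov by (auto simp: D_def UN_disjointed_eq simp flip: Int_UN_distrib)
    have GA: "graph ` A = (\<Union>n. graph ` D n)" by (subst AD) auto
    have "disjoint_family (\<lambda>n. graph ` D n)"
      using dis by (simp add: disjoint_family_on_def image_Int[OF inj_graph, symmetric])
    then have "(\<Sum>n. emeasure (hausdorff_measure CARD('m)) (graph ` D n)) = emeasure (hausdorff_measure CARD('m)) (graph ` A)"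
      unfolding GA using graph_image_borel[OF Dm] by (intro suminf_emeasure) auto
    then have H: "hausdorff_outer CARD('m) (graph ` A) = (\<Sum>n. hausdorff_outer CARD('m) (graph ` D n))"
      by (simp add: emeasure_hausdorff_measure graph_image_borel A(1))
    have N: "?\<nu> A = (\<Sum>n. ?\<nu> (D n))"
    proof -
      have "(\<Sum>n. emeasure (density lborel (\<lambda>u. ennreal (stretch u))) (D n)) = emeasure (density lborel (\<lambda>u. ennreal (stretch u))) A"
        unfolding AD using dis by (intro suminf_emeasure) auto
      then show ?thesis using A(1) by (simp add: emeasure_density)
    qed
    have g: "hausdorff_outer CARD('m) (graph ` D n) \<le> ?c * ?\<nu> (D n)" "?\<nu> (D n) \<le> ?c * hausdorff_outer CARD('m) (graph ` D n)" for n
      using gU[of n] DU[of n] Dm[of n] unfolding good_def by blast+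
    show ?thesis
      unfolding H N ennreal_suminf_cmult[symmetric] by (intro conjI suminf_le g) auto
  qed
  have lim: "x \<le> y" if xy: "\<And>l. 1 < l \<Longrightarrow> x \<le> ennreal (l ^ Suc CARD('m)) * y" for x y :: ennreal
  proof (rule LIMSEQ_le_const)
    have "(\<lambda>n. (1 + 1 / real (Suc n)) ^ Suc CARD('m)) \<longlonglongrightarrow> (1 + 0) ^ Suc CARD('m)"
      by (intro tendsto_intros LIMSEQ_Suc[OF lim_1_over_n])
    then have "(\<lambda>n. ennreal ((1 + 1 / real (Suc n)) ^ Suc CARD('m))) \<longlonglongrightarrow> ennreal ((1 + 0) ^ Suc CARD('m))"
      by (rule tendsto_ennrealI)
    then have "(\<lambda>n. ennreal ((1 + 1 / real (Suc n)) ^ Suc CARD('m))) \<longlonglongrightarrow> 1" by simp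
    then have "(\<lambda>n. ennreal ((1 + 1 / real (Suc n)) ^ Suc CARD('m)) * y) \<longlonglongrightarrow> 1 * y"
      by (intro tendsto_mult_ennreal tendsto_const) auto
    then show "(\<lambda>n. ennreal ((1 + 1 / real (Suc n)) ^ Suc CARD('m)) * y) \<longlonglongrightarrow> y" by simp
    show "\<exists>N. \<forall>n\<ge>N. x \<le> ennreal ((1 + 1 / real (Suc n)) ^ Suc CARD('m)) * y"
      by (intro exI allI impI xy) simp
  qed
  show ?thesis
    by (rule antisym) (rule lim, drule est, elim conjE, assumption)+
qed

lemma integral_hemisphere:
  fixes f :: "'v \<Rightarrow> complex"
  assumes f [measurable]: "f \<in> borel_measurable borel"
  shows "(LINT y : graph ` ball 0 r | hausdorff_measure CARD('m). f y)
      = (LINT u | lborel. (stretch u * indicator (ball 0 r) u) *\<^sub>R f (graph u))"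
    and "set_integrable (hausdorff_measure CARD('m)) (graph ` ball 0 r) f \<longleftrightarrow>
      integrable lborel (\<lambda>u. (stretch u * indicator (ball 0 r) u) *\<^sub>R f (graph u))"
proof -
  let ?H = "hausdorff_measure CARD('m) :: 'v measure" and ?S = "graph ` ball 0 r"
  let ?w = "\<lambda>u. stretch u * indicator (ball 0 r) u"
  have [measurable]: "?S \<in> sets borel" by (rule graph_image_borel) simp
  have w0: "0 \<le> ?w u" for u using height_pos[of u] r by (auto simp: stretch_def indicator_def)
  note [measurable] = measurable_graph measurable_stretch
  have wm0: "?w \<in> borel_measurable borel"
    by (intro borel_measurable_times measurable_stretch borel_measurable_indicator) simp
  then have wm: "(\<lambda>u. ennreal (?w u)) \<in> borel_measurable borel" by simp
  have eq: "density ?H (\<lambda>y. ennreal (indicator ?S y)) = distr (density lborel (\<lambda>u. ennreal (?w u))) borel graph"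
  proof (rule measure_eqI)
    fix B assume "B \<in> sets (density ?H (\<lambda>y. ennreal (indicator ?S y)))"
    then have B [measurable]: "B \<in> sets borel" by simp
    have GB: "graph -` B \<in> sets borel" using measurable_sets[OF measurable_graph B] by simp
    have "emeasure (density ?H (\<lambda>y. ennreal (indicator ?S y))) B = emeasure ?H (?S \<inter> B)"
      by (subst emeasure_density) (auto simp: ennreal_indicator simp flip: indicator_inter_arith)
    also have "?S \<inter> B = graph ` (ball 0 r \<inter> graph -` B)" by auto
    also have "emeasure ?H \<dots> = hausdorff_outer CARD('m) \<dots>"
      using GB by (intro emeasure_hausdorff_measure graph_image_borel) auto
    also have "\<dots> = (\<integral>\<^sup>+u. ennreal (stretch u) * indicator (ball 0 r \<inter> graph -` B) u \<partial>lborel)"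
      using GB by (intro emeasure_hemisphere) auto
    also have "\<dots> = (\<integral>\<^sup>+u. ennreal (?w u) * indicator (graph -` B) u \<partial>lborel)"
      by (intro nn_integral_cong) (auto simp: indicator_def)
    also have "\<dots> = emeasure (density lborel (\<lambda>u. ennreal (?w u))) (graph -` B)"
      using wm GB by (intro emeasure_density[symmetric]) simp_all
    also have "\<dots> = emeasure (distr (density lborel (\<lambda>u. ennreal (?w u))) borel graph) B"
      by (subst emeasure_distr) auto
    finally show "emeasure (density ?H (\<lambda>y. ennreal (indicator ?S y))) B = \<dots>" .
  qed simp
  have "(LINT y : ?S | ?H. f y) = integral\<^sup>L (density ?H (\<lambda>y. ennreal (indicator ?S y))) f"
    unfolding set_lebesgue_integral_def by (rule integral_density[symmetric]) auto
  also have "\<dots> = (LINT u | lborel. ?w u *\<^sub>R f (graph u))"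
  proof -
    have "integral\<^sup>L (density lborel (\<lambda>u. ennreal (?w u))) (\<lambda>u. f (graph u)) = (LINT u | lborel. ?w u *\<^sub>R f (graph u))"
      using wm0 w0 by (intro integral_density) auto
    moreover have "integral\<^sup>L (distr (density lborel (\<lambda>u. ennreal (?w u))) borel graph) f = integral\<^sup>L (density lborel (\<lambda>u. ennreal (?w u))) (\<lambda>u. f (graph u))"
      by (rule integral_distr) auto
    ultimately show ?thesis unfolding eq by simp
  qed
  finally show "(LINT y : ?S | ?H. f y) = (LINT u | lborel. ?w u *\<^sub>R f (graph u))" .
  have "set_integrable ?H ?S f \<longleftrightarrow> integrable (density ?H (\<lambda>y. ennreal (indicator ?S y))) f"
    unfolding set_integrable_def by (rule integrable_density[symmetric]) auto
  also have "\<dots> \<longleftrightarrow> integrable lborel (\<lambda>u. ?w u *\<^sub>R f (graph u))"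
  proof -
    have "integrable (density lborel (\<lambda>u. ennreal (?w u))) (\<lambda>u. f (graph u)) \<longleftrightarrow> integrable lborel (\<lambda>u. ?w u *\<^sub>R f (graph u))"
      using wm0 w0 by (intro integrable_density) auto
    moreover have "integrable (distr (density lborel (\<lambda>u. ennreal (?w u))) borel graph) f \<longleftrightarrow> integrable (density lborel (\<lambda>u. ennreal (?w u))) (\<lambda>u. f (graph u))"
      by (rule integrable_distr_eq) auto
    ultimately show ?thesis unfolding eq by simp
  qed
  finally show "set_integrable ?H ?S f \<longleftrightarrow> integrable lborel (\<lambda>u. ?w u *\<^sub>R f (graph u))" .
qed

text \<open>
  The equator is an isometric image of a sphere in \<open>\<real>\<^sup>m\<close>, which is a null set there.
\<close>

lemma equator_null: "hausdorff_outer CARD('m) ((\<lambda>u. c + E u) ` sphere 0 r) = 0"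
proof -
  have "hausdorff_outer CARD('m) ((\<lambda>u. c + E u) ` sphere 0 r) \<le> ennreal (1 ^ CARD('m)) * hausdorff_outer CARD('m) (sphere (0 :: real ^ 'm) r)"
    using linE by (intro hausdorff_outer_lipschitz_image) (auto simp: dist_norm normE simp flip: linear_diff)
  also have "hausdorff_outer CARD('m) (sphere (0 :: real ^ 'm) r) = 0"
    using hausdorff_outer_negligible[OF negligible_sphere[of "0 :: real ^ 'm" r]] by simp
  finally show ?thesis by simp
qed

end

section \<open>The Plancherel identity for integrable functions\<close>

lemma tendsto_zero_ennreal_epsI:
  fixes f :: "nat \<Rightarrow> ennreal"
  assumes "\<And>e. 0 < e \<Longrightarrow> \<forall>\<^sub>F n in sequentially. f n \<le> ennreal e"
  shows "f \<longlonglongrightarrow> 0"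
proof (rule order_tendstoI)
  fix a :: ennreal assume "0 < a"
  then obtain z where z: "0 < z" "z < a" using dense by blast
  then obtain r where r: "z = ennreal r" "0 \<le> r" by (cases z) auto
  then have "0 < r" using z by simp
  then have "\<forall>\<^sub>F n in sequentially. f n \<le> ennreal r" by (rule assms)
  then show "\<forall>\<^sub>F n in sequentially. f n < a"
    by eventually_elim (use r z in simp)
qed simp

lemma tendsto_zero_ennreal_le:
  fixes f g :: "nat \<Rightarrow> ennreal"
  assumes "f \<longlonglongrightarrow> 0" and le: "\<And>n. g n \<le> f n"
  shows "g \<longlonglongrightarrow> 0"
proof (rule tendsto_sandwich[OF _ _ tendsto_const assms(1)])
  show "\<forall>\<^sub>F n in sequentially. 0 \<le> g n" by simp
  show "\<forall>\<^sub>F n in sequentially. g n \<le> f n" using le by simp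
qed

lemma nn_integral_lborel_translate:
  fixes f :: "'a::euclidean_space \<Rightarrow> ennreal"
  assumes [measurable]: "f \<in> borel_measurable borel"
  shows "(\<integral>\<^sup>+u. f (u + h) \<partial>lborel) = (\<integral>\<^sup>+u. f u \<partial>lborel)"
  by (subst (2) lborel_distr_plus[of h, symmetric]) (simp add: nn_integral_distr add.commute)

lemma integral_lborel_translate:
  fixes f :: "'a::euclidean_space \<Rightarrow> 'b::{banach, second_countable_topology}"
  assumes [measurable]: "f \<in> borel_measurable borel"
  shows "(LINT u|lborel. f (u + h)) = (LINT u|lborel. f u)"
  by (subst (2) lborel_distr_plus[of h, symmetric]) (simp add: integral_distr add.commute)

lemma integral_lborel_affine:
  fixes f :: "'a::euclidean_space \<Rightarrow> 'b::{banach, second_countable_topology}"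
  assumes [measurable]: "f \<in> borel_measurable borel" and c: "c \<noteq> 0"
  shows "(LINT u|lborel. f u) = \<bar>c\<bar> ^ DIM('a) *\<^sub>R (LINT u|lborel. f (t + c *\<^sub>R u))"
  by (subst lborel_affine[OF c, of t]) (simp add: integral_density integral_distr)

text \<open>
  For an open set \<open>U\<close> of finite measure the claim is dominated convergence, because \<open>u + X n\<close> eventually
  enters \<open>U\<close> whenever \<open>u\<close> lies in \<open>U\<close>.  A general set is approximated by an open one from outside.
\<close>

lemma translate_indicator_tendsto_0:
  fixes A :: "'a::euclidean_space set"
  assumes A [measurable]: "A \<in> sets borel" and fin: "emeasure lborel A < \<infinity>" and X: "X \<longlonglongrightarrow> 0"
  shows "(\<lambda>n. \<integral>\<^sup>+u. indicator A u * indicator (- A) (u + X n) \<partial>lborel) \<longlonglongrightarrow> 0"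
proof (rule tendsto_zero_ennreal_epsI)
  fix e :: real assume e: "0 < e"
  have "A \<in> sets lebesgue" using A by simp
  moreover have "0 < e/2" using e by simp
  ultimately obtain U where U: "open U" "A \<subseteq> U" "emeasure lebesgue (U - A) < ennreal (e/2)"
    using sets_lebesgue_outer_open by metis
  have [measurable]: "U \<in> sets borel" using U(1) by simp
  have UA: "emeasure lborel (U - A) \<le> ennreal (e/2)" using U(3) by simp
  have "emeasure lborel U = emeasure lborel (A \<union> (U - A))" using U(2) by (simp add: Un_absorb1)
  also have "\<dots> \<le> emeasure lborel A + emeasure lborel (U - A)"
    by (rule emeasure_subadditive) auto
  also have "\<dots> < \<infinity>"
    using fin order_le_less_trans[OF UA ennreal_less_top] by simp
  finally have finU: "emeasure lborel U < \<infinity>" .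
  have "(\<lambda>n. \<integral>\<^sup>+u. indicator U u * indicator (- U) (u + X n) \<partial>lborel) \<longlonglongrightarrow> (\<integral>\<^sup>+u. 0 \<partial>(lborel :: 'a measure))"
  proof (rule nn_integral_dominated_convergence[where w = "indicator U"])
    show "AE u in lborel. (\<lambda>n. indicator U u * indicator (- U) (u + X n) :: ennreal) \<longlonglongrightarrow> 0"
    proof (rule AE_I2)
      fix u :: 'a
      show "(\<lambda>n. indicator U u * indicator (- U) (u + X n) :: ennreal) \<longlonglongrightarrow> 0"
      proof (cases "u \<in> U")
        case True
        have "(\<lambda>n. u + X n) \<longlonglongrightarrow> u + 0" using X by (intro tendsto_intros)
        then have "\<forall>\<^sub>F n in sequentially. u + X n \<in> U"
          using topological_tendstoD[OF _ U(1)] True by simp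
        then show ?thesis by (intro tendsto_eventually) (elim eventually_mono, simp)
      qed simp
    qed
    show "(\<integral>\<^sup>+u. indicator U u \<partial>lborel) < \<infinity>" using finU by simp
  qed (auto simp: indicator_def)
  then have "\<forall>\<^sub>F n in sequentially. (\<integral>\<^sup>+u. indicator U u * indicator (- U) (u + X n) \<partial>lborel) < ennreal (e/2)"
    using e by (intro order_tendstoD(2)) auto
  then show "\<forall>\<^sub>F n in sequentially. (\<integral>\<^sup>+u. indicator A u * indicator (- A) (u + X n) \<partial>lborel) \<le> ennreal e"
  proof eventually_elim
    case (elim n)
    have "(\<integral>\<^sup>+u. indicator A u * indicator (- A) (u + X n) \<partial>lborel)
        \<le> (\<integral>\<^sup>+u. indicator U u * indicator (- U) (u + X n) + indicator (U - A) (u + X n) \<partial>lborel)"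
      using U(2) by (intro nn_integral_mono) (auto simp: indicator_def)
    also have "\<dots> = (\<integral>\<^sup>+u. indicator U u * indicator (- U) (u + X n) \<partial>lborel) + (\<integral>\<^sup>+u. indicator (U - A) (u + X n) \<partial>lborel)"
      by (rule nn_integral_add) measurable
    also have "(\<integral>\<^sup>+u. indicator (U - A) (u + X n) \<partial>lborel) = (\<integral>\<^sup>+u. indicator (U - A) u \<partial>lborel)"
      by (rule nn_integral_lborel_translate) measurable
    also have "\<dots> = emeasure lborel (U - A)" by simp
    also have "(\<integral>\<^sup>+u. indicator U u * indicator (- U) (u + X n) \<partial>lborel) + emeasure lborel (U - A)
        \<le> ennreal (e/2) + ennreal (e/2)"
      using elim UA by (intro add_mono) auto
    also have "\<dots> = ennreal e" using e by (simp flip: ennreal_plus)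
    finally show ?case .
  qed
qed

text \<open>
  Indicator functions are covered by \<open>translate_indicator_tendsto_0\<close>, which is applied to \<open>X\<close> and to \<open>- X\<close> for the
  two halves of the symmetric difference; linear combinations and dominated limits
  then give all integrable functions.
\<close>

lemma L1_translation_continuous:
  fixes g :: "'a::euclidean_space \<Rightarrow> complex"
  assumes "integrable lborel g"
  shows "X \<longlonglongrightarrow> 0 \<Longrightarrow> (\<lambda>n. \<integral>\<^sup>+u. norm (g (u + X n) - g u) \<partial>lborel) \<longlonglongrightarrow> 0"
  using assms
proof (induction arbitrary: X rule: integrable_induct)
  case (base A c)
  then have A [measurable]: "A \<in> sets borel" by simp
  let ?q = "\<lambda>h. \<integral>\<^sup>+u. indicator A u * indicator (- A) (u + h) \<partial>lborel"
  have q: "(\<lambda>n. ?q (X n)) \<longlonglongrightarrow> 0" "(\<lambda>n. ?q (- X n)) \<longlonglongrightarrow> 0"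
    using translate_indicator_tendsto_0[OF A, of X] translate_indicator_tendsto_0[OF A, of "\<lambda>n. - X n"] base
      tendsto_minus[of X 0] by auto
  have b: "(\<integral>\<^sup>+u. norm (indicator A (u + h) *\<^sub>R c - indicator A u *\<^sub>R c) \<partial>lborel)
      \<le> ennreal (norm c) * (?q h + ?q (- h))" for h
  proof -
    have "(\<integral>\<^sup>+u. norm (indicator A (u + h) *\<^sub>R c - indicator A u *\<^sub>R c) \<partial>lborel)
        = (\<integral>\<^sup>+u. ennreal (norm c) * (indicator A u * indicator (- A) (u + h) + indicator A (u + h) * indicator (- A) u) \<partial>lborel)"
      by (intro nn_integral_cong) (auto simp: indicator_def)
    also have "\<dots> = ennreal (norm c) * (?q h + (\<integral>\<^sup>+u. indicator A (u + h) * indicator (- A) u \<partial>lborel))"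
      by (subst nn_integral_cmult) (auto simp: nn_integral_add)
    also have "(\<integral>\<^sup>+u. indicator A (u + h) * indicator (- A) u \<partial>lborel) = (\<integral>\<^sup>+u. indicator A (u + h) * indicator (- A) ((u + h) + - h) \<partial>lborel)"
      by simp
    also have "\<dots> = ?q (- h)"
      by (rule nn_integral_lborel_translate[where f = "\<lambda>u. indicator A u * indicator (- A) (u + - h)"]) measurable
    finally show ?thesis by simp
  qed
  have "(\<lambda>n. ennreal (norm c) * (?q (X n) + ?q (- X n))) \<longlonglongrightarrow> ennreal (norm c) * (0 + 0)"
    by (intro ennreal_tendsto_cmult tendsto_add q) auto
  then have "(\<lambda>n. ennreal (norm c) * (?q (X n) + ?q (- X n))) \<longlonglongrightarrow> 0" by simp
  then show ?case
    by (rule tendsto_zero_ennreal_le) (rule b)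
next
  case (add f g)
  have [measurable]: "f \<in> borel_measurable borel" "g \<in> borel_measurable borel"
    using add by auto
  let ?I = "\<lambda>f n. \<integral>\<^sup>+u. norm (f (u + X n) - f u :: complex) \<partial>lborel"
  have "(\<lambda>n. ?I f n + ?I g n) \<longlonglongrightarrow> 0 + 0" by (intro tendsto_add add)
  then have "(\<lambda>n. ?I f n + ?I g n) \<longlonglongrightarrow> 0" by simp
  moreover have "?I (\<lambda>x. f x + g x) n \<le> ?I f n + ?I g n" for n
  proof -
    have "?I (\<lambda>x. f x + g x) n \<le> (\<integral>\<^sup>+u. ennreal (norm (f (u + X n) - f u)) + ennreal (norm (g (u + X n) - g u)) \<partial>lborel)"
      by (intro nn_integral_mono) (auto simp flip: ennreal_plus intro!: ennreal_leI norm_triangle_le simp: add_diff_add)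
    then show ?thesis by (simp add: nn_integral_add)
  qed
  ultimately show ?case by (rule tendsto_zero_ennreal_le)
next
  case (lim f s)
  have [measurable]: "f \<in> borel_measurable borel" "\<And>i. s i \<in> borel_measurable borel"
    using lim by auto
  let ?I = "\<lambda>f n. \<integral>\<^sup>+u. norm (f (u + X n) - f u :: complex) \<partial>lborel"
  let ?d = "\<lambda>i. \<integral>\<^sup>+u. norm (s i u - f u) \<partial>lborel"
  have "?d \<longlonglongrightarrow> (\<integral>\<^sup>+u. 0 \<partial>(lborel :: 'a measure))"
  proof (rule nn_integral_dominated_convergence[where w = "\<lambda>u. ennreal (3 * norm (f u))"])
    show "AE u in lborel. ennreal (norm (s i u - f u)) \<le> ennreal (3 * norm (f u))" for i
    proof (rule AE_I2)
      fix u
      have "norm (s i u - f u) \<le> norm (s i u) + norm (f u)" by (rule norm_triangle_ineq4)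
      also have "\<dots> \<le> 3 * norm (f u)" using lim.hyps(3)[of u i] by simp
      finally show "ennreal (norm (s i u - f u)) \<le> ennreal (3 * norm (f u))" by (rule ennreal_leI)
    qed
    have "integrable lborel (\<lambda>u. 3 * norm (f u))" using lim by simp
    then show "(\<integral>\<^sup>+u. ennreal (3 * norm (f u)) \<partial>lborel) < \<infinity>" by (subst nn_integral_eq_integral) auto
    show "AE u in lborel. (\<lambda>i. ennreal (norm (s i u - f u))) \<longlonglongrightarrow> 0"
    proof (rule AE_I2)
      fix u :: 'a
      have "(\<lambda>i. norm (s i u - f u)) \<longlonglongrightarrow> norm (f u - f u)" using lim.hyps(2)[of u] by (intro tendsto_intros) auto
      then have "(\<lambda>i. ennreal (norm (s i u - f u))) \<longlonglongrightarrow> ennreal (norm (f u - f u))" by (rule tendsto_ennrealI)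
      then show "(\<lambda>i. ennreal (norm (s i u - f u))) \<longlonglongrightarrow> 0" by simp
    qed
  qed auto
  then have d: "?d \<longlonglongrightarrow> 0" by simp
  show ?case
  proof (rule tendsto_zero_ennreal_epsI)
    fix e :: real assume e: "0 < e"
    then have "\<forall>\<^sub>F i in sequentially. ?d i < ennreal (e/3)" by (intro order_tendstoD(2)[OF d]) auto
    then obtain i where i: "?d i < ennreal (e/3)" by (auto simp: eventually_sequentially)
    have "\<forall>\<^sub>F n in sequentially. ?I (s i) n < ennreal (e/3)"
      using e by (intro order_tendstoD(2)[OF lim.IH[OF lim.prems]]) auto
    then show "\<forall>\<^sub>F n in sequentially. ?I f n \<le> ennreal e"
    proof eventually_elim
      case (elim n)
      have "?I f n \<le> (\<integral>\<^sup>+u. ennreal (norm (s i (u + X n) - f (u + X n))) + (ennreal (norm (s i (u + X n) - s i u)) + ennreal (norm (s i u - f u))) \<partial>lborel)"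
      proof (rule nn_integral_mono)
        fix u
        have "f (u + X n) - f u = (s i (u + X n) - s i u) - (s i (u + X n) - f (u + X n)) + (s i u - f u)" by simp
        then have "norm (f (u + X n) - f u) \<le> norm (s i (u + X n) - f (u + X n)) + (norm (s i (u + X n) - s i u) + norm (s i u - f u))"
          using norm_triangle_ineq[of "(s i (u + X n) - s i u) - (s i (u + X n) - f (u + X n))" "s i u - f u"]
            norm_triangle_ineq4[of "s i (u + X n) - s i u" "s i (u + X n) - f (u + X n)"] by simp
        then show "ennreal (norm (f (u + X n) - f u)) \<le> ennreal (norm (s i (u + X n) - f (u + X n))) + (ennreal (norm (s i (u + X n) - s i u)) + ennreal (norm (s i u - f u)))"
          by (simp flip: ennreal_plus add: ennreal_leI)
      qed
      also have "\<dots> = (\<integral>\<^sup>+u. ennreal (norm (s i (u + X n) - f (u + X n))) \<partial>lborel) + (?I (s i) n + ?d i)"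
        by (simp add: nn_integral_add)
      also have "(\<integral>\<^sup>+u. ennreal (norm (s i (u + X n) - f (u + X n))) \<partial>lborel) = ?d i"
        by (rule nn_integral_lborel_translate[where f = "\<lambda>u. ennreal (norm (s i u - f u))"]) measurable
      also have "?d i + (?I (s i) n + ?d i) \<le> ennreal (e/3) + (ennreal (e/3) + ennreal (e/3))"
        using i elim by (intro add_mono) auto
      also have "\<dots> = ennreal e" using e by (simp flip: ennreal_plus)
      finally show ?case .
    qed
  qed
qed

text \<open>
  The standard Gaussian density, as a product so that its integrals factor over the coordinates.
\<close>

definition gauss :: "'a::euclidean_space \<Rightarrow> real" where
  "gauss x = (\<Prod>b\<in>Basis. std_normal_density (x \<bullet> b))"

lemma gauss_pos: "0 < gauss x"
  unfolding gauss_def by (intro prod_pos) (auto simp: normal_density_def)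

lemma gauss_nonneg [simp]: "0 \<le> gauss x"
  using gauss_pos[of x] by simp

lemma measurable_gauss [measurable]: "gauss \<in> borel_measurable borel"
  unfolding gauss_def[abs_def] by measurable

lemma gauss_eq: "gauss (x::'a::euclidean_space) = (1 / sqrt (2 * pi)) ^ DIM('a) * exp (- (norm x)\<^sup>2 / 2)"
proof -
  have "(norm x)\<^sup>2 = (\<Sum>b\<in>Basis. (x \<bullet> b)\<^sup>2)"
    by (subst power2_norm_eq_inner, subst euclidean_inner) (simp add: power2_eq_square)
  then have "exp (- (norm x)\<^sup>2 / 2) = (\<Prod>b\<in>Basis. exp (- (x \<bullet> b)\<^sup>2 / 2))"
    by (simp add: exp_sum sum_negf sum_divide_distrib flip: exp_sum)
  then show ?thesis
    unfolding gauss_def std_normal_density_def by (simp add: prod_dividef power_one_over)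
qed

lemma measurable_cis [measurable]: "cis \<in> borel_measurable borel"
  by (intro borel_measurable_continuous_onI continuous_intros)

text \<open>
  Over each coordinate this is the characteristic function of the standard normal distribution.
\<close>

lemma gauss_cis:
  fixes t :: "'a::euclidean_space"
  shows "integrable lborel (\<lambda>x. complex_of_real (gauss x) * cis (x \<bullet> t))"
    and "(LINT x|lborel. complex_of_real (gauss x) * cis (x \<bullet> t)) = complex_of_real (exp (- (norm t)\<^sup>2 / 2))"
proof -
  interpret product_sigma_finite "\<lambda>_::'a. lborel :: real measure" ..
  let ?f = "\<lambda>b y. complex_of_real (std_normal_density y) * cis (y * (t \<bullet> b))"
  have i1: "integrable lborel (?f b)" for b
    by (rule Bochner_Integration.integrable_bound[OF integrable_normal_density[of 1 0]])
       (auto simp: norm_mult)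
  have v1: "(LINT y|lborel. ?f b y) = complex_of_real (exp (- (t \<bullet> b)\<^sup>2 / 2))" for b
  proof -
    have "char std_normal_distribution (t \<bullet> b) = (LINT y|lborel. std_normal_density y *\<^sub>R iexp ((t \<bullet> b) * y))"
      unfolding char_def by (subst integral_density) (auto simp: normal_density_nonneg)
    also have "\<dots> = (LINT y|lborel. ?f b y)"
      by (intro Bochner_Integration.integral_cong) (auto simp: cis_conv_exp scaleR_conv_of_real mult_ac)
    finally show ?thesis by (simp add: char_std_normal_distribution)
  qed
  let ?F = "\<lambda>x. complex_of_real (gauss x) * cis (x \<bullet> t)"
  have F: "?F (\<Sum>b\<in>Basis. z b *\<^sub>R b) = (\<Prod>b\<in>Basis. ?f b (z b))" for z :: "'a \<Rightarrow> real"
  proof -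
    have 1: "gauss (\<Sum>b\<in>Basis. z b *\<^sub>R b) = (\<Prod>b\<in>Basis. std_normal_density (z b))"
      unfolding gauss_def by (intro prod.cong) auto
    have "(\<Sum>b\<in>Basis. z b *\<^sub>R b) \<bullet> t = (\<Sum>b\<in>Basis. z b * (t \<bullet> b))"
      by (simp only: inner_sum_left inner_scaleR_left inner_commute[of t])
    then have "cis ((\<Sum>b\<in>Basis. z b *\<^sub>R b) \<bullet> t) = (\<Prod>b\<in>Basis. cis (z b * (t \<bullet> b)))"
      by (simp add: cis_conv_exp exp_sum sum_distrib_left)
    then show ?thesis by (simp add: 1 prod.distrib)
  qed
  have m: "(\<lambda>z. \<Sum>b\<in>Basis. z b *\<^sub>R b) \<in> (\<Pi>\<^sub>M b\<in>(Basis::'a set). lborel) \<rightarrow>\<^sub>M borel" by measurable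
  have Fm: "?F \<in> borel_measurable borel"
    by measurable
  have "integrable (\<Pi>\<^sub>M b\<in>(Basis::'a set). lborel) (\<lambda>z. ?F (\<Sum>b\<in>Basis. z b *\<^sub>R b))"
    unfolding F by (rule product_integrable_prod) (auto intro: i1)
  then show "integrable lborel ?F"
    by (subst lborel_eq) (simp add: integrable_distr_eq[OF m Fm])
  have "integral\<^sup>L lborel ?F = (\<integral>z. ?F (\<Sum>b\<in>Basis. z b *\<^sub>R b) \<partial>(\<Pi>\<^sub>M b\<in>(Basis::'a set). lborel))"
    by (subst lborel_eq) (rule integral_distr[OF m Fm])
  also have "\<dots> = (\<Prod>b\<in>Basis. complex_of_real (exp (- (t \<bullet> b)\<^sup>2 / 2)))"
    unfolding F by (subst product_integral_prod) (auto intro: i1 simp: v1)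
  also have "\<dots> = complex_of_real (exp (- (norm t)\<^sup>2 / 2))"
  proof -
    have "(norm t)\<^sup>2 = (\<Sum>b\<in>Basis. (t \<bullet> b)\<^sup>2)"
      by (subst power2_norm_eq_inner, subst euclidean_inner) (simp add: power2_eq_square)
    then show ?thesis by (simp add: sum_negf sum_divide_distrib flip: exp_sum of_real_prod)
  qed
  finally show "integral\<^sup>L lborel ?F = complex_of_real (exp (- (norm t)\<^sup>2 / 2))" .
qed

lemma integrable_gauss: "integrable lborel (gauss :: 'a::euclidean_space \<Rightarrow> real)"
  using gauss_cis(1)[of "0::'a"] by (simp add: complex_of_real_integrable_eq)

lemma nn_integral_gauss: "(\<integral>\<^sup>+x. ennreal (gauss (x::'a::euclidean_space)) \<partial>lborel) = 1"
proof -
  have "(LINT x|lborel. gauss (x::'a)) = 1"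
    using gauss_cis(2)[of "0::'a"] by (simp flip: of_real_eq_iff)
  then show ?thesis using nn_integral_eq_integral[OF integrable_gauss[where 'a = 'a]] by simp
qed

text \<open>
  The mean of \<open>g\<close> over a Gaussian of width \<open>\<kappa>\<close> about \<open>u\<close>.
\<close>

definition mollify :: "real \<Rightarrow> ('a::euclidean_space \<Rightarrow> complex) \<Rightarrow> 'a \<Rightarrow> complex" where
  "mollify \<kappa> g u = (LINT y|lborel. complex_of_real (gauss y) * g (u - \<kappa> *\<^sub>R y))"

lemma mollify_pair_integrable:
  fixes g :: "'a::euclidean_space \<Rightarrow> complex"
  assumes g: "integrable lborel g"
  shows "integrable (lborel \<Otimes>\<^sub>M lborel) (\<lambda>(u, y). complex_of_real (gauss y) * g (u - \<kappa> *\<^sub>R y))"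
proof (rule integrableI_bounded)
  have [measurable]: "g \<in> borel_measurable borel" using g by auto
  show "(\<lambda>(u, y). complex_of_real (gauss y) * g (u - \<kappa> *\<^sub>R y)) \<in> borel_measurable (lborel \<Otimes>\<^sub>M lborel)"
    by measurable
  have "(\<integral>\<^sup>+p. norm (case p of (u, y) \<Rightarrow> complex_of_real (gauss y) * g (u - \<kappa> *\<^sub>R y)) \<partial>(lborel \<Otimes>\<^sub>M lborel))
      = (\<integral>\<^sup>+y. (\<integral>\<^sup>+u. ennreal (gauss y) * ennreal (norm (g (u - \<kappa> *\<^sub>R y))) \<partial>lborel) \<partial>lborel)"
    by (subst lborel_pair.nn_integral_snd[symmetric]) (auto simp: norm_mult ennreal_mult)
  also have "\<dots> = (\<integral>\<^sup>+y. ennreal (gauss y) * (\<integral>\<^sup>+u. ennreal (norm (g u)) \<partial>lborel) \<partial>(lborel :: 'a measure))"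
  proof (rule nn_integral_cong)
    fix y :: 'a
    have "(\<integral>\<^sup>+u. ennreal (norm (g (u + - (\<kappa> *\<^sub>R y)))) \<partial>lborel) = (\<integral>\<^sup>+u. ennreal (norm (g u)) \<partial>lborel)"
      by (rule nn_integral_lborel_translate) measurable
    then show "(\<integral>\<^sup>+u. ennreal (gauss y) * ennreal (norm (g (u - \<kappa> *\<^sub>R y))) \<partial>lborel)
        = ennreal (gauss y) * (\<integral>\<^sup>+u. ennreal (norm (g u)) \<partial>lborel)"
      by (subst nn_integral_cmult) auto
  qed
  also have "\<dots> = (\<integral>\<^sup>+u. ennreal (norm (g u)) \<partial>lborel)"
    by (subst nn_integral_multc) (auto simp: nn_integral_gauss)
  also have "\<dots> < \<infinity>" using g by (simp add: integrable_iff_bounded)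
  finally show "(\<integral>\<^sup>+p. norm (case p of (u, y) \<Rightarrow> complex_of_real (gauss y) * g (u - \<kappa> *\<^sub>R y)) \<partial>(lborel \<Otimes>\<^sub>M lborel)) < \<infinity>" .
qed

lemma mollify_integrable:
  assumes "integrable lborel g" shows "integrable lborel (mollify \<kappa> g)"
  unfolding mollify_def[abs_def]
  using lborel_pair.integrable_fst[OF mollify_pair_integrable[OF assms, of \<kappa>]] by simp

text \<open>
  The \<open>L\<^sup>1\<close> norm of the deviation is at most the Gaussian mean over \<open>y\<close> of the \<open>L\<^sup>1\<close> norms of
  \<open>g(u - \<kappa> y) - g(u)\<close>.  These are at most twice the norm of \<open>g\<close> and tend to zero by
  \<open>L1_translation_continuous\<close>, so dominated convergence applies.
\<close>

lemma mollify_L1: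
  fixes g :: "'a::euclidean_space \<Rightarrow> complex"
  assumes g: "integrable lborel g" and k: "k \<longlonglongrightarrow> 0"
  shows "(\<lambda>n. \<integral>\<^sup>+u. norm (mollify (k n) g u - g u) \<partial>lborel) \<longlonglongrightarrow> 0"
proof -
  have [measurable]: "g \<in> borel_measurable borel" using g by auto
  let ?W = "\<lambda>h. \<integral>\<^sup>+u. norm (g (u + h) - g u) \<partial>lborel"
  let ?N = "\<integral>\<^sup>+u. norm (g u) \<partial>lborel"
  have N: "?N < \<infinity>" using g by (simp add: integrable_iff_bounded)
  have le: "(\<integral>\<^sup>+u. norm (mollify \<kappa> g u - g u) \<partial>lborel) \<le> (\<integral>\<^sup>+y. ennreal (gauss y) * ?W (- (\<kappa> *\<^sub>R y)) \<partial>lborel)" for \<kappa>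
  proof -
    have "AE u in lborel. integrable lborel (\<lambda>y. complex_of_real (gauss y) * g (u - \<kappa> *\<^sub>R y))"
      using lborel_pair.AE_integrable_fst[OF mollify_pair_integrable[OF g, of \<kappa>]] by simp
    then have "AE u in lborel. ennreal (norm (mollify \<kappa> g u - g u))
        \<le> (\<integral>\<^sup>+y. ennreal (gauss y) * ennreal (norm (g (u + - (\<kappa> *\<^sub>R y)) - g u)) \<partial>lborel)"
    proof eventually_elim
      case (elim u)
      have i2: "integrable lborel (\<lambda>y::'a. complex_of_real (gauss y) * g u)"
        using integrable_gauss[where 'a = 'a] by simp
      have "(LINT y|lborel. complex_of_real (gauss (y::'a)) * g u) = g u"
        using gauss_cis(2)[of "0::'a"] by simp
      then have "mollify \<kappa> g u - g u = (LINT y|lborel. complex_of_real (gauss y) * g (u - \<kappa> *\<^sub>R y) - complex_of_real (gauss y) * g u)"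
        using elim i2 by (simp add: mollify_def)
      also have "ennreal (norm \<dots>) \<le> (\<integral>\<^sup>+y. norm (complex_of_real (gauss y) * g (u - \<kappa> *\<^sub>R y) - complex_of_real (gauss y) * g u) \<partial>lborel)"
        using elim i2 by (intro integral_norm_bound_ennreal) auto
      also have "\<dots> = (\<integral>\<^sup>+y. ennreal (gauss y) * ennreal (norm (g (u + - (\<kappa> *\<^sub>R y)) - g u)) \<partial>lborel)"
        by (intro nn_integral_cong) (simp add: norm_mult ennreal_mult flip: right_diff_distrib)
      finally show ?case .
    qed
    then have "(\<integral>\<^sup>+u. norm (mollify \<kappa> g u - g u) \<partial>lborel)
        \<le> (\<integral>\<^sup>+u. (\<integral>\<^sup>+y. ennreal (gauss y) * ennreal (norm (g (u + - (\<kappa> *\<^sub>R y)) - g u)) \<partial>lborel) \<partial>lborel)"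
      by (rule nn_integral_mono_AE)
    also have "\<dots> = (\<integral>\<^sup>+y. (\<integral>\<^sup>+u. ennreal (gauss y) * ennreal (norm (g (u + - (\<kappa> *\<^sub>R y)) - g u)) \<partial>lborel) \<partial>lborel)"
      by (rule lborel_pair.Fubini'[symmetric]) measurable
    also have "\<dots> = (\<integral>\<^sup>+y. ennreal (gauss y) * ?W (- (\<kappa> *\<^sub>R y)) \<partial>lborel)"
      by (intro nn_integral_cong nn_integral_cmult) measurable
    finally show ?thesis .
  qed
  have "(\<lambda>n. \<integral>\<^sup>+y. ennreal (gauss y) * ?W (- (k n *\<^sub>R y)) \<partial>lborel) \<longlonglongrightarrow> (\<integral>\<^sup>+y. 0 \<partial>(lborel :: 'a measure))"
  proof (rule nn_integral_dominated_convergence[where w = "\<lambda>y. ennreal (gauss y) * (?N + ?N)"])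
    show "AE y in lborel. ennreal (gauss y) * ?W (- (k n *\<^sub>R y)) \<le> ennreal (gauss y) * (?N + ?N)" for n
    proof (rule AE_I2, rule mult_left_mono)
      fix y :: 'a
      have "?W h \<le> ?N + ?N" for h
      proof -
        have "?W h \<le> (\<integral>\<^sup>+u. ennreal (norm (g (u + h))) + ennreal (norm (g u)) \<partial>lborel)"
          by (intro nn_integral_mono) (simp flip: ennreal_plus add: ennreal_leI norm_triangle_ineq4)
        also have "\<dots> = (\<integral>\<^sup>+u. ennreal (norm (g (u + h))) \<partial>lborel) + ?N"
          by (rule nn_integral_add) measurable
        also have "(\<integral>\<^sup>+u. ennreal (norm (g (u + h))) \<partial>lborel) = ?N"
          by (rule nn_integral_lborel_translate) measurable
        finally show ?thesis .
      qed
      then show "?W (- (k n *\<^sub>R y)) \<le> ?N + ?N" .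
    qed simp
    have "(\<integral>\<^sup>+y. ennreal (gauss y) * (?N + ?N) \<partial>(lborel :: 'a measure)) = ?N + ?N"
      by (subst nn_integral_multc) (auto simp: nn_integral_gauss)
    then show "(\<integral>\<^sup>+y. ennreal (gauss y) * (?N + ?N) \<partial>(lborel :: 'a measure)) < \<infinity>" using N by simp
    show "AE y in lborel. (\<lambda>n. ennreal (gauss y) * ?W (- (k n *\<^sub>R y))) \<longlonglongrightarrow> 0"
    proof (rule AE_I2)
      fix y :: 'a
      have "(\<lambda>n. - (k n *\<^sub>R y)) \<longlonglongrightarrow> - (0 *\<^sub>R y)" by (intro tendsto_intros k)
      then have "(\<lambda>n. ?W (- (k n *\<^sub>R y))) \<longlonglongrightarrow> 0" by (intro L1_translation_continuous g) simp
      then have "(\<lambda>n. ennreal (gauss y) * ?W (- (k n *\<^sub>R y))) \<longlonglongrightarrow> ennreal (gauss y) * 0"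
        by (intro ennreal_tendsto_cmult) auto
      then show "(\<lambda>n. ennreal (gauss y) * ?W (- (k n *\<^sub>R y))) \<longlonglongrightarrow> 0" by simp
    qed
  qed measurable
  then have "(\<lambda>n. \<integral>\<^sup>+y. ennreal (gauss y) * ?W (- (k n *\<^sub>R y)) \<partial>lborel) \<longlonglongrightarrow> 0" by simp
  then show ?thesis by (rule tendsto_zero_ennreal_le) (rule le)
qed

lemma norm_integral_le_nn_integral:
  fixes f :: "'a \<Rightarrow> complex"
  shows "ennreal (norm (integral\<^sup>L M f)) \<le> (\<integral>\<^sup>+x. ennreal (norm (f x)) \<partial>M)"
  using integral_norm_bound_ennreal[of M f] by (cases "integrable M f") (auto simp: not_integrable_integral_eq)

text \<open>
  Jensen's inequality for the Gaussian probability measure, in the form of the Cauchy-Schwarz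
  inequality, followed by translation invariance.
\<close>

lemma mollify_L2_le:
  fixes g :: "'a::euclidean_space \<Rightarrow> complex"
  assumes [measurable]: "g \<in> borel_measurable borel"
  shows "(\<integral>\<^sup>+u. ennreal ((norm (mollify \<kappa> g u))\<^sup>2) \<partial>lborel) \<le> (\<integral>\<^sup>+u. ennreal ((norm (g u))\<^sup>2) \<partial>lborel)"
proof -
  have "ennreal ((norm (mollify \<kappa> g u))\<^sup>2) \<le> (\<integral>\<^sup>+y. ennreal (gauss y) * ennreal ((norm (g (u - \<kappa> *\<^sub>R y)))\<^sup>2) \<partial>lborel)" for u
  proof -
    have "ennreal (norm (mollify \<kappa> g u)) \<le> (\<integral>\<^sup>+y. ennreal (norm (complex_of_real (gauss y) * g (u - \<kappa> *\<^sub>R y))) \<partial>lborel)"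
      unfolding mollify_def by (rule norm_integral_le_nn_integral)
    also have "\<dots> = (\<integral>\<^sup>+y. ennreal (sqrt (gauss y)) * ennreal (sqrt (gauss y) * norm (g (u - \<kappa> *\<^sub>R y))) \<partial>lborel)"
      by (intro nn_integral_cong) (simp add: norm_mult flip: ennreal_mult mult.assoc)
    finally have "(ennreal (norm (mollify \<kappa> g u)))\<^sup>2
        \<le> (\<integral>\<^sup>+y. ennreal (sqrt (gauss y)) * ennreal (sqrt (gauss y) * norm (g (u - \<kappa> *\<^sub>R y))) \<partial>lborel)\<^sup>2"
      by (rule power_mono) simp
    also have "\<dots> \<le> (\<integral>\<^sup>+y. (ennreal (sqrt (gauss y)))\<^sup>2 \<partial>(lborel :: 'a measure)) * (\<integral>\<^sup>+y. (ennreal (sqrt (gauss y) * norm (g (u - \<kappa> *\<^sub>R y))))\<^sup>2 \<partial>lborel)"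
      by (rule Cauchy_Schwarz_nn_integral) measurable
    also have "(\<lambda>y::'a. (ennreal (sqrt (gauss y)))\<^sup>2) = (\<lambda>y. ennreal (gauss y))"
      by (simp add: ennreal_power)
    also have "(\<lambda>y::'a. (ennreal (sqrt (gauss y) * norm (g (u - \<kappa> *\<^sub>R y))))\<^sup>2) = (\<lambda>y. ennreal (gauss y) * ennreal ((norm (g (u - \<kappa> *\<^sub>R y)))\<^sup>2))"
      by (simp add: ennreal_power power_mult_distrib ennreal_mult)
    finally show ?thesis by (simp add: nn_integral_gauss ennreal_power)
  qed
  then have "(\<integral>\<^sup>+u. ennreal ((norm (mollify \<kappa> g u))\<^sup>2) \<partial>lborel)
      \<le> (\<integral>\<^sup>+u. (\<integral>\<^sup>+y. ennreal (gauss y) * ennreal ((norm (g (u + - (\<kappa> *\<^sub>R y))))\<^sup>2) \<partial>lborel) \<partial>lborel)"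
    by (intro nn_integral_mono) simp
  also have "\<dots> = (\<integral>\<^sup>+y. (\<integral>\<^sup>+u. ennreal (gauss y) * ennreal ((norm (g (u + - (\<kappa> *\<^sub>R y))))\<^sup>2) \<partial>lborel) \<partial>lborel)"
    by (rule lborel_pair.Fubini'[symmetric]) measurable
  also have "\<dots> = (\<integral>\<^sup>+y. ennreal (gauss y) * (\<integral>\<^sup>+u. ennreal ((norm (g u))\<^sup>2) \<partial>lborel) \<partial>(lborel :: 'a measure))"
  proof (rule nn_integral_cong)
    fix y :: 'a
    have "(\<integral>\<^sup>+u. ennreal ((norm (g (u + - (\<kappa> *\<^sub>R y))))\<^sup>2) \<partial>lborel) = (\<integral>\<^sup>+u. ennreal ((norm (g u))\<^sup>2) \<partial>lborel)"
      by (rule nn_integral_lborel_translate) measurable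
    then show "(\<integral>\<^sup>+u. ennreal (gauss y) * ennreal ((norm (g (u + - (\<kappa> *\<^sub>R y))))\<^sup>2) \<partial>lborel)
        = ennreal (gauss y) * (\<integral>\<^sup>+u. ennreal ((norm (g u))\<^sup>2) \<partial>lborel)"
      by (subst nn_integral_cmult) auto
  qed
  also have "\<dots> = (\<integral>\<^sup>+u. ennreal ((norm (g u))\<^sup>2) \<partial>lborel)"
    by (subst nn_integral_multc) (auto simp: nn_integral_gauss)
  finally show ?thesis .
qed

definition fourier :: "('a::euclidean_space \<Rightarrow> complex) \<Rightarrow> 'a \<Rightarrow> complex" where
  "fourier g s = (LINT u|lborel. g u * cis (2 * pi * (u \<bullet> s)))"

text \<open>
  The Fourier transform of the Gaussian of width \<open>\<kappa>\<close>.
\<close>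

definition gauss_weight :: "real \<Rightarrow> 'a::euclidean_space \<Rightarrow> real" where
  "gauss_weight \<kappa> s = exp (- (norm ((2 * pi * \<kappa>) *\<^sub>R s))\<^sup>2 / 2)"

lemma measurable_gauss_weight [measurable]: "gauss_weight \<kappa> \<in> borel_measurable borel"
  unfolding gauss_weight_def[abs_def] by measurable

lemma gauss_weight_nonneg [simp]: "0 \<le> gauss_weight \<kappa> s"
  by (simp add: gauss_weight_def)

lemma gauss_weight_eq: "gauss_weight \<kappa> (s::'a::euclidean_space) = sqrt (2 * pi) ^ DIM('a) * gauss ((2 * pi * \<kappa>) *\<^sub>R s)"
  by (simp add: gauss_weight_def gauss_eq power_one_over)

lemma gauss_weight_cis:
  fixes t :: "'a::euclidean_space"
  assumes k: "0 < \<kappa>"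
  shows "integrable lborel (\<lambda>s. complex_of_real (gauss_weight \<kappa> s) * cis (2 * pi * (s \<bullet> t)))"
    and "(LINT s|lborel. complex_of_real (gauss_weight \<kappa> s) * cis (2 * pi * (s \<bullet> t)))
      = complex_of_real (\<kappa> powi (- int DIM('a)) * gauss ((1 / \<kappa>) *\<^sub>R t))"
proof -
  let ?c = "2 * pi * \<kappa>" and ?d = "DIM('a)"
  have c: "?c \<noteq> 0" "0 < ?c" using k by auto
  let ?f = "\<lambda>y::'a. complex_of_real (gauss y) * cis (y \<bullet> ((1 / \<kappa>) *\<^sub>R t))"
  have fs: "complex_of_real (gauss_weight \<kappa> s) * cis (2 * pi * (s \<bullet> t))
      = complex_of_real (sqrt (2 * pi) ^ ?d) * ?f (0 + ?c *\<^sub>R s)" for s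
    using k by (simp add: gauss_weight_eq mult.assoc)
  have [measurable]: "?f \<in> borel_measurable borel" by measurable
  have "integrable lborel (\<lambda>s. ?f (0 + ?c *\<^sub>R s))"
  proof -
    have "integrable (density (distr lborel borel (\<lambda>x. 0 + ?c *\<^sub>R x)) (\<lambda>_. \<bar>?c\<bar> ^ ?d)) ?f"
      using gauss_cis(1)[of "(1 / \<kappa>) *\<^sub>R t"] by (subst (asm) lborel_affine[OF c(1), of 0])
    then have "integrable lborel (\<lambda>s. \<bar>?c\<bar> ^ ?d *\<^sub>R ?f (0 + ?c *\<^sub>R s))"
      by (simp add: integrable_density integrable_distr_eq)
    then have "integrable lborel (\<lambda>s. inverse (\<bar>?c\<bar> ^ ?d) *\<^sub>R (\<bar>?c\<bar> ^ ?d *\<^sub>R ?f (0 + ?c *\<^sub>R s)))"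
      by (rule integrable_scaleR_right)
    then show ?thesis using k by simp
  qed
  then show "integrable lborel (\<lambda>s. complex_of_real (gauss_weight \<kappa> s) * cis (2 * pi * (s \<bullet> t)))"
    unfolding fs by simp
  have "complex_of_real (exp (- (norm ((1 / \<kappa>) *\<^sub>R t))\<^sup>2 / 2)) = \<bar>?c\<bar> ^ ?d *\<^sub>R (LINT s|lborel. ?f (0 + ?c *\<^sub>R s))"
    by (subst gauss_cis(2)[symmetric], rule integral_lborel_affine[OF _ c(1)]) measurable
  then have "(LINT s|lborel. ?f (0 + ?c *\<^sub>R s)) = complex_of_real (exp (- (norm ((1 / \<kappa>) *\<^sub>R t))\<^sup>2 / 2) / ?c ^ ?d)"
    using c by (simp add: scaleR_conv_of_real field_simps)
  then have "(LINT s|lborel. complex_of_real (gauss_weight \<kappa> s) * cis (2 * pi * (s \<bullet> t)))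
      = complex_of_real (sqrt (2 * pi) ^ ?d * (exp (- (norm ((1 / \<kappa>) *\<^sub>R t))\<^sup>2 / 2) / ?c ^ ?d))"
    unfolding fs by simp
  also have "sqrt (2 * pi) ^ ?d * (exp (- (norm ((1 / \<kappa>) *\<^sub>R t))\<^sup>2 / 2) / ?c ^ ?d)
      = \<kappa> powi (- int ?d) * gauss ((1 / \<kappa>) *\<^sub>R t)"
  proof -
    have "(2 * pi) ^ ?d = (sqrt (2 * pi) * sqrt (2 * pi)) ^ ?d" by simp
    also have "\<dots> = sqrt (2 * pi) ^ ?d * sqrt (2 * pi) ^ ?d" by (rule power_mult_distrib)
    finally have "(2 * pi) ^ ?d = sqrt (2 * pi) ^ ?d * sqrt (2 * pi) ^ ?d" .
    moreover have "?c ^ ?d = (2 * pi) ^ ?d * \<kappa> ^ ?d" by (rule power_mult_distrib)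
    ultimately have "?c ^ ?d = \<kappa> ^ ?d * (sqrt (2 * pi) ^ ?d * sqrt (2 * pi) ^ ?d)" by simp
    moreover have "0 < sqrt (2 * pi) ^ ?d" by simp
    ultimately show ?thesis
      using k unfolding gauss_eq by (simp add: power_int_minus power_one_over field_simps)
  qed
  finally show "(LINT s|lborel. complex_of_real (gauss_weight \<kappa> s) * cis (2 * pi * (s \<bullet> t)))
      = complex_of_real (\<kappa> powi (- int DIM('a)) * gauss ((1 / \<kappa>) *\<^sub>R t))" .
qed

lemma integrable_gauss_weight: "0 < \<kappa> \<Longrightarrow> integrable lborel (gauss_weight \<kappa> :: 'a::euclidean_space \<Rightarrow> real)"
  using gauss_weight_cis(1)[of \<kappa> "0::'a"] by (simp add: complex_of_real_integrable_eq)

lemma measurable_fourier [measurable]: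
  assumes [measurable]: "g \<in> borel_measurable borel"
  shows "fourier g \<in> borel_measurable borel"
  unfolding fourier_def[abs_def] by measurable

text \<open>
  Mollification is a convolution, so it multiplies the Fourier transform by that of the Gaussian.
\<close>

lemma fourier_mollify:
  fixes g :: "'a::euclidean_space \<Rightarrow> complex"
  assumes g: "integrable lborel g"
  shows "fourier (mollify \<kappa> g) s = fourier g s * complex_of_real (gauss_weight \<kappa> s)"
proof -
  have [measurable]: "g \<in> borel_measurable borel" using g by auto
  let ?F = "\<lambda>u y. complex_of_real (gauss y) * g (u - \<kappa> *\<^sub>R y) * cis (2 * pi * (u \<bullet> s))"
  have int: "integrable (lborel \<Otimes>\<^sub>M lborel) (\<lambda>(u, y). ?F u y)"
    by (rule Bochner_Integration.integrable_bound[OF mollify_pair_integrable[OF g, of \<kappa>]]) (auto simp: norm_mult)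
  have "fourier (mollify \<kappa> g) s = (LINT u|lborel. (LINT y|lborel. ?F u y))"
    unfolding fourier_def mollify_def by simp
  also have "\<dots> = (LINT y|lborel. (LINT u|lborel. ?F u y))"
    by (rule lborel_pair.Fubini_integral[OF int, symmetric])
  also have "\<dots> = (LINT y|lborel. fourier g s * (complex_of_real (gauss y) * cis (y \<bullet> ((2 * pi * \<kappa>) *\<^sub>R s))))"
  proof (rule Bochner_Integration.integral_cong)
    fix y :: 'a
    have "(LINT u|lborel. ?F u y) = (LINT u|lborel. ?F (u + \<kappa> *\<^sub>R y) y)"
      by (rule integral_lborel_translate[symmetric]) measurable
    also have "\<dots> = (LINT u|lborel. (g u * cis (2 * pi * (u \<bullet> s))) * (complex_of_real (gauss y) * cis (y \<bullet> ((2 * pi * \<kappa>) *\<^sub>R s))))"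
      by (intro Bochner_Integration.integral_cong) (auto simp: inner_add_left distrib_left mult_ac simp flip: cis_mult)
    finally show "(LINT u|lborel. ?F u y) = fourier g s * (complex_of_real (gauss y) * cis (y \<bullet> ((2 * pi * \<kappa>) *\<^sub>R s)))"
      by (simp add: fourier_def)
  qed simp
  also have "\<dots> = fourier g s * complex_of_real (gauss_weight \<kappa> s)"
    by (subst integral_mult_right_zero) (simp only: gauss_cis(2) gauss_weight_def)
  finally show ?thesis .
qed

lemma fourier_bounded:
  assumes "integrable lborel g"
  shows "norm (fourier g s) \<le> (LINT u|lborel. norm (g u))"
  unfolding fourier_def by (rule order_trans[OF integral_norm_bound]) (simp add: norm_mult)

lemma integrable_fourier_gauss_weight:
  fixes g :: "'a::euclidean_space \<Rightarrow> complex"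
  assumes g: "integrable lborel g" and k: "0 < \<kappa>"
  shows "integrable lborel (\<lambda>s. fourier g s * complex_of_real (gauss_weight \<kappa> s))"
proof (rule Bochner_Integration.integrable_bound)
  have [measurable]: "g \<in> borel_measurable borel" using g by auto
  show "integrable lborel (\<lambda>s::'a. (LINT u|lborel. norm (g u)) * gauss_weight \<kappa> s)"
    using integrable_gauss_weight[OF k, where 'a = 'a] by simp
  show "(\<lambda>s. fourier g s * complex_of_real (gauss_weight \<kappa> s)) \<in> borel_measurable lborel" by measurable
  show "AE s in lborel. norm (fourier g s * complex_of_real (gauss_weight \<kappa> s))
      \<le> norm ((LINT u|lborel. norm (g u)) * gauss_weight \<kappa> s)"
    using fourier_bounded[OF g] by (intro AE_I2) (auto simp: norm_mult abs_mult intro!: mult_right_mono intro: order_trans[OF _ abs_ge_self])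
qed

lemma integrable_pair_mult:
  fixes f :: "'a::euclidean_space \<Rightarrow> complex" and h :: "'b::euclidean_space \<Rightarrow> complex"
  assumes f: "integrable lborel f" and h: "integrable lborel h"
  shows "integrable (lborel \<Otimes>\<^sub>M lborel) (\<lambda>(x, y). f x * h y)"
proof -
  have [measurable]: "f \<in> borel_measurable borel" "h \<in> borel_measurable borel" using f h by auto
  show ?thesis
    by (rule lborel_pair.Fubini_integrable) (use f h in \<open>auto simp: norm_mult\<close>)
qed

text \<open>
  Inserting the Gaussian weight makes the double integral absolutely convergent; exchanging the order leaves the
  inverse transform of the weight, which is the Gaussian of width \<open>\<kappa>\<close> again.
\<close>

lemma mollify_inversion:
  fixes g :: "'a::euclidean_space \<Rightarrow> complex"
  assumes g: "integrable lborel g" and k: "0 < \<kappa>"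
  shows "mollify \<kappa> g u = (LINT s|lborel. fourier g s * complex_of_real (gauss_weight \<kappa> s) * cis (- (2 * pi * (u \<bullet> s))))"
proof -
  have [measurable]: "g \<in> borel_measurable borel" using g by auto
  let ?w = "\<lambda>s. complex_of_real (gauss_weight \<kappa> (s::'a))"
  let ?F = "\<lambda>v s. g v * (?w s * cis (2 * pi * (s \<bullet> (v - u))))"
  have int: "integrable (lborel \<Otimes>\<^sub>M lborel) (\<lambda>(v, s). ?F v s)"
  proof (rule Bochner_Integration.integrable_bound[OF integrable_pair_mult[OF g, of ?w]])
    show "integrable lborel ?w" using integrable_gauss_weight[OF k, where 'a = 'a] by (rule integrable_of_real)
  qed (auto simp: norm_mult)
  have "(LINT s|lborel. fourier g s * ?w s * cis (- (2 * pi * (u \<bullet> s)))) = (LINT s|lborel. (LINT v|lborel. ?F v s))"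
  proof (rule Bochner_Integration.integral_cong)
    fix s :: 'a
    have "fourier g s * (?w s * cis (- (2 * pi * (u \<bullet> s)))) = (LINT v|lborel. g v * cis (2 * pi * (v \<bullet> s)) * (?w s * cis (- (2 * pi * (u \<bullet> s)))))"
      unfolding fourier_def by simp
    also have "\<dots> = (LINT v|lborel. ?F v s)"
    proof (rule Bochner_Integration.integral_cong)
      fix v
      have "cis (2 * pi * (s \<bullet> (v - u))) = cis (2 * pi * (v \<bullet> s)) * cis (- (2 * pi * (u \<bullet> s)))"
        unfolding cis_mult by (simp add: inner_diff_right inner_commute right_diff_distrib)
      then show "g v * cis (2 * pi * (v \<bullet> s)) * (?w s * cis (- (2 * pi * (u \<bullet> s)))) = ?F v s" by (simp only: mult_ac)
    qed simp
    finally show "fourier g s * ?w s * cis (- (2 * pi * (u \<bullet> s))) = (LINT v|lborel. ?F v s)" by (simp only: mult_ac)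
  qed simp
  also have "\<dots> = (LINT v|lborel. (LINT s|lborel. ?F v s))"
    by (rule lborel_pair.Fubini_integral[OF int])
  also have "\<dots> = (LINT v|lborel. g v * complex_of_real (\<kappa> powi (- int DIM('a)) * gauss ((1 / \<kappa>) *\<^sub>R (v - u))))"
    by (simp only: integral_mult_right_zero gauss_weight_cis(2)[OF k])
  also have "\<dots> = \<bar>- \<kappa>\<bar> ^ DIM('a) *\<^sub>R (LINT y|lborel. g (u + (- \<kappa>) *\<^sub>R y) * complex_of_real (\<kappa> powi (- int DIM('a)) * gauss ((1 / \<kappa>) *\<^sub>R ((u + (- \<kappa>) *\<^sub>R y) - u))))"
    by (rule integral_lborel_affine) (use k in auto)
  also have "\<dots> = \<kappa> ^ DIM('a) *\<^sub>R (LINT y|lborel. \<kappa> powi (- int DIM('a)) *\<^sub>R (complex_of_real (gauss y) * g (u - \<kappa> *\<^sub>R y)))"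
  proof -
    have "gauss ((1 / \<kappa>) *\<^sub>R ((u + (- \<kappa>) *\<^sub>R y) - u)) = gauss y" for y :: 'a
      using k by (simp add: gauss_eq)
    then show ?thesis using k by (simp add: scaleR_conv_of_real mult_ac del: integral_mult_right_zero integral_mult_left_zero)
  qed
  also have "\<dots> = mollify \<kappa> g u"
    using k by (simp add: mollify_def power_int_minus)
  finally show ?thesis by simp
qed

text \<open>
  The mollified function and its transform are both integrable and bounded, hence square integrable,
  and inversion with Fubini's theorem moves one factor of \<open>\<integral> |mollify \<kappa> g|\<^sup>2\<close> to the Fourier side.
\<close>

lemma mollify_parseval:
  fixes g :: "'a::euclidean_space \<Rightarrow> complex"
  assumes g: "integrable lborel g" and k: "0 < \<kappa>"
  shows "(\<integral>\<^sup>+u. ennreal ((norm (mollify \<kappa> g u))\<^sup>2) \<partial>lborel) =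
    (\<integral>\<^sup>+s. ennreal ((norm (fourier g s * complex_of_real (gauss_weight \<kappa> s)))\<^sup>2) \<partial>lborel)"
proof -
  let ?m = "mollify \<kappa> g" and ?p = "\<lambda>s. fourier g s * complex_of_real (gauss_weight \<kappa> s)"
  have im: "integrable lborel ?m" by (rule mollify_integrable[OF g])
  have ip: "integrable lborel ?p" by (rule integrable_fourier_gauss_weight[OF g k])
  have [measurable]: "?m \<in> borel_measurable borel" "g \<in> borel_measurable borel" using im g by auto
  have [measurable]: "cnj \<in> borel_measurable borel" by (intro borel_measurable_continuous_onI continuous_intros)
  \<comment> \<open>An integrable bounded function is square integrable, so its norm can be computed as a Bochner integral.\<close>
  have sq: "(\<integral>\<^sup>+u. ennreal ((norm (f u))\<^sup>2) \<partial>lborel) = ennreal (Re (LINT u|lborel. f u * cnj (f u)))"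
    if f: "integrable lborel f" and b: "\<And>u. norm (f u) \<le> B" for f :: "'a \<Rightarrow> complex" and B
  proof -
    have [measurable]: "f \<in> borel_measurable borel" using f by auto
    have "integrable lborel (\<lambda>u. (norm (f u))\<^sup>2)"
    proof (rule Bochner_Integration.integrable_bound)
      show "integrable lborel (\<lambda>u. B * norm (f u))" using f by simp
      have "(norm (f u))\<^sup>2 \<le> norm (B * norm (f u))" for u
        using b[of u] norm_ge_zero[of "f u"] by (simp add: power2_eq_square abs_mult mult_right_mono order_trans[OF b abs_ge_self])
      then show "AE u in lborel. norm ((norm (f u))\<^sup>2) \<le> norm (B * norm (f u))" by simp
    qed measurable
    then have "(\<integral>\<^sup>+u. ennreal ((norm (f u))\<^sup>2) \<partial>lborel) = ennreal (LINT u|lborel. (norm (f u))\<^sup>2)"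
      by (intro nn_integral_eq_integral) auto
    also have "(LINT u|lborel. f u * cnj (f u)) = complex_of_real (LINT u|lborel. (norm (f u))\<^sup>2)"
      by (simp add: complex_norm_square[symmetric] del: of_real_power)
    then have "(LINT u|lborel. (norm (f u))\<^sup>2) = Re (LINT u|lborel. f u * cnj (f u))" by simp
    finally show ?thesis .
  qed
  have mb: "norm (?m u) \<le> (LINT s|lborel. norm (?p s))" for u
    unfolding mollify_inversion[OF g k] by (rule order_trans[OF integral_norm_bound]) (simp add: norm_mult)
  have pb: "norm (?p s) \<le> (LINT u|lborel. norm (g u))" for s
  proof -
    have "norm (?p s) \<le> norm (fourier g s) * 1"
      by (simp add: norm_mult gauss_weight_def mult_left_le)
    then show ?thesis using fourier_bounded[OF g, of s] by linarith
  qed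
  let ?F = "\<lambda>u s. ?m u * cnj (?p s) * cis (2 * pi * (u \<bullet> s))"
  have int: "integrable (lborel \<Otimes>\<^sub>M lborel) (\<lambda>(u, s). ?F u s)"
    by (rule Bochner_Integration.integrable_bound[OF integrable_pair_mult[OF im ip]]) (auto simp: norm_mult)
  have "(LINT u|lborel. ?m u * cnj (?m u)) = (LINT u|lborel. (LINT s|lborel. ?F u s))"
  proof (rule Bochner_Integration.integral_cong)
    fix u
    have "cnj (?m u) = (LINT s|lborel. cnj (?p s) * cis (2 * pi * (u \<bullet> s)))"
    proof -
      have "(LINT s|lborel. cnj (?p s) * cis (2 * pi * (u \<bullet> s))) = (LINT s|lborel. cnj (?p s * cis (- (2 * pi * (u \<bullet> s)))))"
        by (intro Bochner_Integration.integral_cong) (simp_all add: cis_cnj)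
      also have "\<dots> = cnj (LINT s|lborel. ?p s * cis (- (2 * pi * (u \<bullet> s))))"
        by (rule Bochner_Integration.integral_cnj)
      finally show ?thesis by (simp only: mollify_inversion[OF g k])
    qed
    then show "?m u * cnj (?m u) = (LINT s|lborel. ?F u s)"
      by (simp add: mult.assoc)
  qed simp
  also have "\<dots> = (LINT s|lborel. (LINT u|lborel. ?F u s))"
    by (rule lborel_pair.Fubini_integral[OF int, symmetric])
  also have "\<dots> = (LINT s|lborel. ?p s * cnj (?p s))"
  proof (rule Bochner_Integration.integral_cong)
    fix s
    have "(LINT u|lborel. ?F u s) = (LINT u|lborel. (?m u * cis (2 * pi * (u \<bullet> s))) * cnj (?p s))"
      by (intro Bochner_Integration.integral_cong) auto
    also have "\<dots> = fourier ?m s * cnj (?p s)" unfolding fourier_def by (rule integral_mult_left_zero)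
    finally show "(LINT u|lborel. ?F u s) = ?p s * cnj (?p s)" by (simp add: fourier_mollify[OF g])
  qed simp
  finally show ?thesis using sq[OF im mb] sq[OF ip pb] by simp
qed

text \<open>
  Both inequalities follow from \<open>mollify_parseval\<close> by Fatou's lemma as \<open>\<kappa>\<close> tends to zero.  For
  \<open>\<le>\<close>, the Gaussian weights tend to \<open>1\<close> and mollification does not increase the \<open>L\<^sup>2\<close> norm; for \<open>\<ge>\<close>, a
  subsequence of the mollified functions converges almost everywhere and the weights are at most \<open>1\<close>.
\<close>

theorem plancherel_L1:
  fixes g :: "'a::euclidean_space \<Rightarrow> complex"
  assumes g: "integrable lborel g"
  shows "(\<integral>\<^sup>+s. ennreal ((norm (fourier g s))\<^sup>2) \<partial>lborel) = (\<integral>\<^sup>+u. ennreal ((norm (g u))\<^sup>2) \<partial>lborel)"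
proof (rule antisym)
  have [measurable]: "g \<in> borel_measurable borel" using g by auto
  define k where "k n = 1 / real (Suc n)" for n
  have k: "0 < k n" for n by (simp add: k_def)
  have k0: "k \<longlonglongrightarrow> 0" unfolding k_def[abs_def] by (rule LIMSEQ_Suc[OF lim_1_over_n])
  let ?p = "\<lambda>n s. fourier g s * complex_of_real (gauss_weight (k n) s)"
  have m [measurable]: "mollify (k n) g \<in> borel_measurable borel" for n
    using mollify_integrable[OF g] by auto
  show "(\<integral>\<^sup>+s. ennreal ((norm (fourier g s))\<^sup>2) \<partial>lborel) \<le> (\<integral>\<^sup>+u. ennreal ((norm (g u))\<^sup>2) \<partial>lborel)"
  proof -
    have "liminf (\<lambda>n. ennreal ((norm (?p n s))\<^sup>2)) = ennreal ((norm (fourier g s))\<^sup>2)" for s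
    proof (rule lim_imp_Liminf)
      have "(\<lambda>n. gauss_weight (k n) s) \<longlonglongrightarrow> gauss_weight 0 s"
        unfolding gauss_weight_def by (intro tendsto_intros k0) auto
      then have "(\<lambda>n. gauss_weight (k n) s) \<longlonglongrightarrow> 1" by (simp add: gauss_weight_def)
      then have "(\<lambda>n. (norm (?p n s))\<^sup>2) \<longlonglongrightarrow> (norm (fourier g s * complex_of_real 1))\<^sup>2"
        by (intro tendsto_intros)
      then show "(\<lambda>n. ennreal ((norm (?p n s))\<^sup>2)) \<longlonglongrightarrow> ennreal ((norm (fourier g s))\<^sup>2)"
        by (intro tendsto_ennrealI) simp
    qed simp
    then have "(\<integral>\<^sup>+s. ennreal ((norm (fourier g s))\<^sup>2) \<partial>lborel) = (\<integral>\<^sup>+s. liminf (\<lambda>n. ennreal ((norm (?p n s))\<^sup>2)) \<partial>lborel)"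
      by simp
    also have "\<dots> \<le> liminf (\<lambda>n. \<integral>\<^sup>+s. ennreal ((norm (?p n s))\<^sup>2) \<partial>lborel)"
      by (rule nn_integral_liminf) measurable
    also have "\<dots> \<le> (\<integral>\<^sup>+u. ennreal ((norm (g u))\<^sup>2) \<partial>lborel)"
    proof -
      have "(\<integral>\<^sup>+s. ennreal ((norm (?p n s))\<^sup>2) \<partial>lborel) \<le> (\<integral>\<^sup>+u. ennreal ((norm (g u))\<^sup>2) \<partial>lborel)" for n
        using mollify_L2_le[of g "k n"] mollify_parseval[OF g k, of n] by simp
      then have "liminf (\<lambda>n. \<integral>\<^sup>+s. ennreal ((norm (?p n s))\<^sup>2) \<partial>lborel) \<le> liminf (\<lambda>n::nat. \<integral>\<^sup>+u. ennreal ((norm (g u))\<^sup>2) \<partial>lborel)"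
        by (intro Liminf_mono) simp
      then show ?thesis by (simp add: Liminf_const)
    qed
    finally show ?thesis .
  qed
  show "(\<integral>\<^sup>+u. ennreal ((norm (g u))\<^sup>2) \<partial>lborel) \<le> (\<integral>\<^sup>+s. ennreal ((norm (fourier g s))\<^sup>2) \<partial>lborel)"
  proof -
    have i: "integrable lborel (\<lambda>u. mollify (k n) g u - g u)" for n using mollify_integrable[OF g] g by auto
    have "(\<lambda>n. ennreal (LINT u|lborel. norm (mollify (k n) g u - g u))) \<longlonglongrightarrow> 0"
    proof -
      have "(\<integral>\<^sup>+u. norm (mollify (k n) g u - g u) \<partial>lborel) = ennreal (LINT u|lborel. norm (mollify (k n) g u - g u))" for n
        using i by (intro nn_integral_eq_integral) auto
      then show ?thesis using mollify_L1[OF g k0] by simp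
    qed
    then have "(\<lambda>n. LINT u|lborel. norm (mollify (k n) g u - g u)) \<longlonglongrightarrow> 0"
      by (subst (asm) ennreal_tendsto_0_iff) auto
    then obtain r where r: "strict_mono r" "AE u in lborel. (\<lambda>n. mollify (k (r n)) g u - g u) \<longlonglongrightarrow> 0"
      using tendsto_L1_AE_subseq[of lborel "\<lambda>n u. mollify (k n) g u - g u", OF i] by blast
    have "(\<integral>\<^sup>+u. ennreal ((norm (g u))\<^sup>2) \<partial>lborel) = (\<integral>\<^sup>+u. liminf (\<lambda>n. ennreal ((norm (mollify (k (r n)) g u))\<^sup>2)) \<partial>lborel)"
    proof (rule nn_integral_cong_AE)
      show "AE u in lborel. ennreal ((norm (g u))\<^sup>2) = liminf (\<lambda>n. ennreal ((norm (mollify (k (r n)) g u))\<^sup>2))"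
        using r(2)
      proof eventually_elim
        case (elim u)
        have "(\<lambda>n. mollify (k (r n)) g u) \<longlonglongrightarrow> g u" using elim by (simp add: LIM_zero_iff)
        then have "(\<lambda>n. ennreal ((norm (mollify (k (r n)) g u))\<^sup>2)) \<longlonglongrightarrow> ennreal ((norm (g u))\<^sup>2)"
          by (intro tendsto_ennrealI tendsto_intros)
        then show ?case using lim_imp_Liminf[OF sequentially_bot] by metis
      qed
    qed
    also have "\<dots> \<le> liminf (\<lambda>n. \<integral>\<^sup>+u. ennreal ((norm (mollify (k (r n)) g u))\<^sup>2) \<partial>lborel)"
      by (rule nn_integral_liminf) measurable
    also have "\<dots> \<le> (\<integral>\<^sup>+s. ennreal ((norm (fourier g s))\<^sup>2) \<partial>lborel)"
    proof -
      have "(\<integral>\<^sup>+u. ennreal ((norm (mollify (k n) g u))\<^sup>2) \<partial>lborel) \<le> (\<integral>\<^sup>+s. ennreal ((norm (fourier g s))\<^sup>2) \<partial>lborel)" for n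
        unfolding mollify_parseval[OF g k]
        by (intro nn_integral_mono ennreal_leI power_mono) (auto simp: norm_mult gauss_weight_def mult_left_le)
      then have "liminf (\<lambda>n. \<integral>\<^sup>+u. ennreal ((norm (mollify (k (r n)) g u))\<^sup>2) \<partial>lborel) \<le> liminf (\<lambda>n::nat. \<integral>\<^sup>+s. ennreal ((norm (fourier g s))\<^sup>2) \<partial>lborel)"
        by (intro Liminf_mono) simp
      then show ?thesis by (simp add: Liminf_const)
    qed
    finally show ?thesis .
  qed
qed

section \<open>Coordinates adapted to an affine span\<close>

text \<open>
  An index type with \<open>n - k\<close> elements, so that the coordinates along the spheres form a
  vector of type \<open>real ^ ('n, 'k) codim\<close>.  The disjunct \<open>i = 0\<close> keeps the type inhabited when \<open>n \<le> k\<close>.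
\<close>

typedef ('n, 'k) codim = "{i::nat. i = 0 \<or> i < CARD('n) - CARD('k)}"
  by auto

instance codim :: (type, type) finite
proof
  have "finite {i::nat. i = 0 \<or> i < CARD('a) - CARD('b)}" by simp
  then show "finite (UNIV :: ('a, 'b) codim set)"
    unfolding type_definition.univ[OF type_definition_codim] by (rule finite_imageI)
qed

lemma card_codim:
  assumes "CARD('k) < CARD('n)"
  shows "CARD(('n, 'k) codim) = CARD('n) - CARD('k)"
proof -
  have "{i::nat. i = 0 \<or> i < CARD('n) - CARD('k)} = {..<CARD('n) - CARD('k)}" using assms by auto
  then show ?thesis by (simp add: type_definition.card[OF type_definition_codim])
qed

lemma has_derivative_vecI:
  fixes f :: "'a::real_normed_vector \<Rightarrow> real ^ 'k"
  assumes "\<And>j. ((\<lambda>x. f x $ j) has_derivative (\<lambda>h. f' h $ j)) (at a)"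
  shows "(f has_derivative f') (at a)"
proof (subst has_derivative_componentwise_within, intro ballI)
  fix b :: "real ^ 'k" assume "b \<in> Basis"
  then obtain j where "b = axis j 1" by (auto simp: Basis_vec_def)
  then show "((\<lambda>x. f x \<bullet> b) has_derivative (\<lambda>h. f' h \<bullet> b)) (at a)"
    using assms[of j] by (simp add: inner_axis)
qed

lemma orthonormal_sum_inner:
  fixes b :: "'i \<Rightarrow> 'v::real_inner"
  assumes "finite I" "\<And>i j. i \<in> I \<Longrightarrow> j \<in> I \<Longrightarrow> b i \<bullet> b j = (if i = j then 1 else 0)"
  shows "(\<Sum>i\<in>I. p i *\<^sub>R b i) \<bullet> (\<Sum>j\<in>I. q j *\<^sub>R b j) = (\<Sum>i\<in>I. p i * q i)"
proof -
  have "b i \<bullet> (\<Sum>j\<in>I. q j *\<^sub>R b j) = q i" if i: "i \<in> I" for i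
  proof -
    have "b i \<bullet> (\<Sum>j\<in>I. q j *\<^sub>R b j) = (\<Sum>j\<in>I. q j * (b i \<bullet> b j))" by (simp add: inner_sum_right)
    also have "\<dots> = (\<Sum>j\<in>I. if j = i then q i else 0)" using i by (intro sum.cong) (auto simp: assms(2))
    finally show ?thesis using assms(1) i by simp
  qed
  then have "(\<Sum>i\<in>I. p i *\<^sub>R b i) \<bullet> (\<Sum>j\<in>I. q j *\<^sub>R b j) = (\<Sum>i\<in>I. p i * q i)"
    by (simp add: inner_sum_left)
  then show ?thesis .
qed

text \<open>
  An affine combination becomes \<open>x $ k0\<close> plus a linear combination of differences with free coefficients: the coefficient
  of index \<open>k0\<close> multiplies the zero vector, and in the converse direction it is the one that restores the sum \<open>1\<close>.
\<close>

lemma aff_span_eq_translate: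
  "aff_span x = (+) (x $ k0) ` range (\<lambda>a :: real ^ 'k. \<Sum>j\<in>UNIV. a $ j *\<^sub>R (x $ j - x $ k0))"
proof (intro equalityI subsetI)
  fix z assume "z \<in> aff_span x"
  then obtain l where l: "z = (\<Sum>j\<in>UNIV. l j *\<^sub>R x $ j)" "(\<Sum>j\<in>UNIV. l j) = 1"
    by (auto simp: aff_span_def)
  have "(\<Sum>j\<in>UNIV. (\<chi> j. l j) $ j *\<^sub>R (x $ j - x $ k0)) = z - (\<Sum>j\<in>UNIV. l j) *\<^sub>R x $ k0"
    by (simp add: l(1) scaleR_diff_right sum_subtractf flip: scaleR_sum_left)
  then have "z = x $ k0 + (\<Sum>j\<in>UNIV. (\<chi> j. l j) $ j *\<^sub>R (x $ j - x $ k0))" using l(2) by simp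
  then show "z \<in> (+) (x $ k0) ` range (\<lambda>a :: real ^ 'k. \<Sum>j\<in>UNIV. a $ j *\<^sub>R (x $ j - x $ k0))" by blast
next
  fix z assume "z \<in> (+) (x $ k0) ` range (\<lambda>a :: real ^ 'k. \<Sum>j\<in>UNIV. a $ j *\<^sub>R (x $ j - x $ k0))"
  then obtain a :: "real ^ 'k" where a: "z = x $ k0 + (\<Sum>j\<in>UNIV. a $ j *\<^sub>R (x $ j - x $ k0))" by blast
  define l where "l j = a $ j + (if j = k0 then 1 - (\<Sum>i\<in>UNIV. a $ i) else 0)" for j
  have "(\<Sum>j\<in>UNIV. l j) = 1" by (simp add: l_def sum.distrib)
  moreover have "(\<Sum>j\<in>UNIV. l j *\<^sub>R x $ j) = z"
  proof -
    have "l j *\<^sub>R x $ j = a $ j *\<^sub>R x $ j + (if j = k0 then (1 - (\<Sum>i\<in>UNIV. a $ i)) *\<^sub>R x $ k0 else 0)" for j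
      by (simp add: l_def scaleR_add_left)
    then show ?thesis
      by (simp add: sum.distrib a scaleR_diff_right sum_subtractf scaleR_diff_left flip: scaleR_sum_left)
  qed
  ultimately show "z \<in> aff_span x" unfolding aff_span_def by (auto intro!: exI[of _ l])
qed

text \<open>
  An orthonormal frame adapted to the affine span of the points \<open>x $ j\<close>.  For \<open>l \<noteq> k0\<close> the vectors \<open>e l\<close> span
  the direction space of the affine span, \<open>e k0\<close> is one unit normal, and \<open>E\<close> parametrizes the remaining normal
  directions.  Using the index \<open>k0\<close> of a chosen base point also for a normal vector keeps all of the \<open>k\<close>
  coordinates that matter in one vector of type \<open>real ^ 'k\<close>.  The affine independence of the points is contained in the last
  assumption, since the right-hand side has dimension \<open>k - 1\<close>.
\<close>

locale frame =
  fixes x :: "real ^ 'n ^ 'k" and k0 :: 'k and e :: "'k \<Rightarrow> real ^ 'n" and E :: "real ^ 'm \<Rightarrow> real ^ 'n"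
  assumes ee: "\<And>i j. e i \<bullet> e j = (if i = j then 1 else 0)"
    and linE: "linear E" and normE: "\<And>u. norm (E u) = norm u" and eE: "\<And>i u. e i \<bullet> E u = 0"
    and card: "CARD('n) = CARD('k) + CARD('m)"
    and direction: "range (\<lambda>a :: real ^ 'k. \<Sum>j\<in>UNIV. a $ j *\<^sub>R (x $ j - x $ k0)) = range (\<lambda>a :: real ^ 'k. \<Sum>l\<in>- {k0}. a $ l *\<^sub>R e l)"

text \<open>
  Orthonormal bases of the direction space and of its orthogonal complement; the latter has dimension
  \<open>n - k + 1\<close>, and \<open>None\<close> in the index type picks the vector that is set aside as \<open>e k0\<close>.
\<close>

lemma frame_exists:
  fixes x :: "real ^ 'n ^ 'k" and k0 :: 'k
  assumes "x \<in> Aff" and kn: "CARD('k) < CARD('n)"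
  obtains e and E :: "real ^ ('n, 'k) codim \<Rightarrow> real ^ 'n" where "frame x k0 e E"
proof -
  let ?f = "\<lambda>a :: real ^ 'k. \<Sum>j\<in>UNIV. a $ j *\<^sub>R (x $ j - x $ k0)"
  define W where "W = range ?f"
  have "linear ?f" by (rule linearI) (simp_all add: scaleR_add_left sum.distrib scaleR_sum_right)
  then have W: "subspace W" unfolding W_def by (intro linear_subspace_image) auto
  have "aff_dim (aff_span x) = aff_dim W"
    unfolding W_def aff_span_eq_translate[of x k0] by (rule aff_dim_translation_eq)
  also have "\<dots> = int (dim W)" by (rule aff_dim_subspace[OF W])
  finally have "int (dim W) = int CARD('k) - 1" using assms(1) by (simp add: Aff_def)
  then have dW: "dim W = CARD('k) - 1" by simp
  define W' where "W' = {y :: real ^ 'n. \<forall>w\<in>W. orthogonal w y}"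
  have W': "subspace W'" unfolding W'_def by (rule subspace_orthogonal_to_vectors)
  have "dim {y \<in> UNIV :: (real ^ 'n) set. \<forall>w\<in>W. orthogonal w y} + dim W = dim (UNIV :: (real ^ 'n) set)"
    by (rule dim_subspace_orthogonal_to_vectors[OF W]) auto
  then have dW': "dim W' + dim W = CARD('n)" by (simp add: W'_def)
  let ?m = "CARD(('n, 'k) codim)"
  have m: "?m = CARD('n) - CARD('k)" by (rule card_codim[OF kn])
  have "CARD('k) \<ge> 1" by (simp add: Suc_leI)
  then have dW'': "dim W' = Suc ?m" using dW dW' m kn by simp
  obtain B1 where B1: "B1 \<subseteq> W" "pairwise orthogonal B1" "\<And>b. b \<in> B1 \<Longrightarrow> norm b = 1" "independent B1"
      "card B1 = dim W" "span B1 = W"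
    using orthonormal_basis_subspace[OF W] by blast
  obtain B2 where B2: "B2 \<subseteq> W'" "pairwise orthogonal B2" "\<And>b. b \<in> B2 \<Longrightarrow> norm b = 1" "independent B2"
      "card B2 = dim W'" "span B2 = W'"
    using orthonormal_basis_subspace[OF W'] by blast
  have fin: "finite B1" "finite B2" using B1(4) B2(4) by (auto simp: independent_imp_finite)
  obtain b1 where b1: "bij_betw b1 (- {k0}) B1"
    using finite_same_card_bij[of "- {k0}" B1] fin B1(5) dW by (auto simp: Compl_eq_Diff_UNIV card_Diff_singleton)
  obtain b2 where b2: "bij_betw b2 (UNIV :: ('n, 'k) codim option set) B2"
    using finite_same_card_bij[of "UNIV :: ('n, 'k) codim option set" B2] fin B2(5) dW'' by auto
  \<comment> \<open>The bases \<open>B1\<close> and \<open>B2\<close> are distributed: \<open>B1\<close> is tangential, \<open>None\<close> gives the distinguished normal.\<close>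
  define e where "e l = (if l = k0 then b2 None else b1 l)" for l
  define E where "E u = (\<Sum>i\<in>UNIV. u $ i *\<^sub>R b2 (Some i))" for u :: "real ^ ('n, 'k) codim"
  have b1in: "b1 l \<in> B1" if "l \<noteq> k0" for l using b1 that by (auto simp: bij_betw_def)
  have b2in: "b2 i \<in> B2" for i using b2 by (auto simp: bij_betw_def)
  have o1: "b1 i \<bullet> b1 j = (if i = j then 1 else 0)" if "i \<noteq> k0" "j \<noteq> k0" for i j
  proof (cases "i = j")
    case True then show ?thesis using B1(3)[OF b1in[OF that(2)]] by (simp add: norm_eq_1)
  next
    case False
    then have "b1 i \<noteq> b1 j" using b1 that by (auto simp: bij_betw_def inj_on_def)
    then show ?thesis using B1(2) b1in that False by (simp add: pairwise_def orthogonal_def)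
  qed
  have o2: "b2 i \<bullet> b2 j = (if i = j then 1 else 0)" for i j
  proof (cases "i = j")
    case True then show ?thesis using B2(3)[OF b2in[of j]] by (simp add: norm_eq_1)
  next
    case False
    then have "b2 i \<noteq> b2 j" using b2 by (auto simp: bij_betw_def inj_on_def)
    then show ?thesis using B2(2) b2in False by (simp add: pairwise_def orthogonal_def)
  qed
  have o12: "b1 i \<bullet> b2 j = 0" if "i \<noteq> k0" for i j
    using b1in[OF that] b2in[of j] B1(1) B2(1) by (auto simp: W'_def orthogonal_def)
  have span: "W = range (\<lambda>a :: real ^ 'k. \<Sum>l\<in>- {k0}. a $ l *\<^sub>R e l)"
  proof (intro equalityI subsetI)
    fix w assume "w \<in> W"
    then have "w \<in> span B1" using B1(6) by simp
    then obtain g where "w = (\<Sum>b\<in>B1. g b *\<^sub>R b)" using fin(1) by (auto simp: span_finite)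
    also have "\<dots> = (\<Sum>l\<in>- {k0}. g (b1 l) *\<^sub>R b1 l)" by (rule sum.reindex_bij_betw[OF b1, symmetric])
    also have "\<dots> = (\<Sum>l\<in>- {k0}. (\<chi> l. g (b1 l)) $ l *\<^sub>R e l)" by (intro sum.cong) (auto simp: e_def)
    finally show "w \<in> range (\<lambda>a :: real ^ 'k. \<Sum>l\<in>- {k0}. a $ l *\<^sub>R e l)" by blast
  next
    fix w assume "w \<in> range (\<lambda>a :: real ^ 'k. \<Sum>l\<in>- {k0}. a $ l *\<^sub>R e l)"
    then obtain a :: "real ^ 'k" where "w = (\<Sum>l\<in>- {k0}. a $ l *\<^sub>R e l)" by blast
    moreover have "e l \<in> W" if "l \<in> - {k0}" for l using b1in[of l] B1(1) that by (auto simp: e_def)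
    ultimately show "w \<in> W" using W by (auto intro!: subspace_sum subspace_scale)
  qed
  have "frame x k0 e E"
  proof (rule frame.intro)
    show "e i \<bullet> e j = (if i = j then 1 else 0)" for i j
      using o1[of i j] o2[of None None] o12[of i None] o12[of j None]
      by (cases "i = k0"; cases "j = k0"; simp add: e_def inner_commute)
    show "linear E" unfolding E_def[abs_def]
      by (rule linearI) (simp_all add: scaleR_add_left sum.distrib scaleR_sum_right)
    show "norm (E u) = norm u" for u
    proof -
      have "E u \<bullet> E u = (\<Sum>i\<in>UNIV. u $ i * u $ i)"
        unfolding E_def by (rule orthonormal_sum_inner) (auto simp: o2)
      then show ?thesis by (simp add: norm_eq_sqrt_inner inner_vec_def)
    qed
    show "e i \<bullet> E u = 0" for i u
      using o2[of None] o12[of i] by (auto simp: E_def inner_sum_right e_def)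
    show "CARD('n) = CARD('k) + CARD(('n, 'k) codim)" using m kn by simp
    show "range ?f = range (\<lambda>a :: real ^ 'k. \<Sum>l\<in>- {k0}. a $ l *\<^sub>R e l)" using span by (simp add: W_def)
  qed
  then show thesis by (rule that)
qed

context frame
begin

text \<open>
  The matrix \<open>simplex_mat\<close> has the tangential coordinates of the points as rows, with a \<open>1\<close> in the
  column \<open>k0\<close>.  Its determinant is, up to sign, the volume of the parallelotope spanned by the vectors \<open>x $ j - base\<close>.
\<close>

definition base :: "real ^ 'n" where "base = x $ k0"
definition coord :: "'k \<Rightarrow> 'k \<Rightarrow> real" where "coord j l = (x $ j - base) \<bullet> e l"
definition simplex_mat :: "real ^ 'k ^ 'k" where "simplex_mat = (\<chi> j l. if l = k0 then 1 else coord j l)"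
definition simplex_vol :: real where "simplex_vol = \<bar>det simplex_mat\<bar>"

lemma sum_split_k0: "(\<Sum>l\<in>UNIV. h l) = h k0 + (\<Sum>l\<in>- {k0}. h l)" for h :: "'k \<Rightarrow> 'z::comm_monoid_add"
  by (subst sum.remove[of UNIV k0]) (auto simp: Compl_eq_Diff_UNIV)

lemma inner_e_sum: "(\<Sum>l\<in>I. a l *\<^sub>R e l) \<bullet> e i = (if i \<in> I then a i else 0)"
proof -
  have "(\<Sum>l\<in>I. a l *\<^sub>R e l) \<bullet> e i = (\<Sum>l\<in>I. a l * (if l = i then 1 else 0))"
    by (simp add: inner_sum_left ee)
  also have "\<dots> = (\<Sum>l\<in>I. if l = i then a i else 0)" by (intro sum.cong) auto
  finally show ?thesis by simp
qed

lemma x_expand: "x $ j - base = (\<Sum>l\<in>- {k0}. coord j l *\<^sub>R e l)"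
proof -
  have "x $ j - base = (\<Sum>i\<in>UNIV. axis j 1 $ i *\<^sub>R (x $ i - x $ k0))"
  proof -
    have "(\<Sum>i\<in>UNIV. axis j 1 $ i *\<^sub>R (x $ i - x $ k0)) = (\<Sum>i\<in>UNIV. if i = j then x $ i - x $ k0 else 0)"
      by (intro sum.cong) (auto simp: axis_def)
    then show ?thesis by (simp add: base_def)
  qed
  then have "x $ j - base \<in> range (\<lambda>a :: real ^ 'k. \<Sum>l\<in>- {k0}. a $ l *\<^sub>R e l)"
    unfolding direction[symmetric] by blast
  then obtain a :: "real ^ 'k" where a: "x $ j - base = (\<Sum>l\<in>- {k0}. a $ l *\<^sub>R e l)" by blast
  have "coord j l = a $ l" if "l \<in> - {k0}" for l
    using that by (simp add: coord_def a inner_e_sum)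
  then show ?thesis using a by simp
qed

lemma coord_k0 [simp]: "coord k0 l = 0" "coord j k0 = 0"
proof -
  show "coord k0 l = 0" by (simp add: coord_def base_def)
  show "coord j k0 = 0"
    using arg_cong[OF x_expand[of j], of "\<lambda>y. y \<bullet> e k0"] by (simp add: inner_e_sum flip: coord_def)
qed

text \<open>
  A kernel vector has vanishing \<open>k0\<close> component, by the row of the base point, and its other components form a
  vector of the direction space that is orthogonal to all \<open>x $ j - base\<close>.  These span the direction space, so it is zero.
\<close>

lemma det_simplex_nonzero: "det simplex_mat \<noteq> 0"
proof
  assume "det simplex_mat = 0"
  then obtain a where a: "a \<noteq> 0" "simplex_mat *v a = 0" 
    using invertible_det_nz[of simplex_mat] invertible_left_inverse[of simplex_mat] matrix_left_invertible_ker[of simplex_mat] by auto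
  have row: "a $ k0 + (\<Sum>l\<in>- {k0}. coord j l * a $ l) = 0" for j
  proof -
    have "(\<Sum>l\<in>UNIV. simplex_mat $ j $ l * a $ l) = 0" using a(2) by (simp add: matrix_vector_mult_def vec_eq_iff)
    then show ?thesis by (simp add: sum_split_k0 simplex_mat_def)
  qed
  have a0: "a $ k0 = 0" using row[of k0] by simp
  define w where "w = (\<Sum>l\<in>- {k0}. a $ l *\<^sub>R e l)"
  have orth: "(x $ j - base) \<bullet> w = 0" for j
  proof -
    have "(x $ j - base) \<bullet> w = (\<Sum>l\<in>- {k0}. coord j l * a $ l)"
      unfolding x_expand w_def by (rule orthonormal_sum_inner) (auto simp: ee)
    then show ?thesis using row[of j] a0 by simp
  qed
  have "w \<in> range (\<lambda>a :: real ^ 'k. \<Sum>j\<in>UNIV. a $ j *\<^sub>R (x $ j - x $ k0))"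
    unfolding direction w_def by blast
  then obtain b :: "real ^ 'k" where b: "w = (\<Sum>j\<in>UNIV. b $ j *\<^sub>R (x $ j - base))" unfolding base_def by blast
  have "w \<bullet> w = (\<Sum>j\<in>UNIV. b $ j *\<^sub>R (x $ j - base)) \<bullet> w" by (rule arg_cong[OF b])
  also have "\<dots> = 0" by (simp only: inner_sum_left inner_scaleR_left orth) simp
  finally have "w = 0" by simp
  have "a $ l = 0" for l
  proof (cases "l = k0")
    case False
    then have "a $ l = w \<bullet> e l" by (simp add: w_def inner_e_sum)
    then show ?thesis using \<open>w = 0\<close> by simp
  qed (use a0 in simp)
  then show False using a(1) by (simp add: vec_eq_iff)
qed

lemma simplex_vol_pos: "0 < simplex_vol"
  using det_simplex_nonzero by (simp add: simplex_vol_def)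

text \<open>
  Two matrices of the problem have this shape: \<open>s = 1\<close> and \<open>p = 2\<close> for the Jacobian matrix of the squared
  distances as functions of \<open>\<xi>\<close>, and \<open>s = r\<close>, \<open>p = 1\<close> for a square root of the Gram matrix of the vectors \<open>z - x\<^sub>j\<close>.
\<close>

definition jac :: "real \<Rightarrow> real \<Rightarrow> real ^ 'k \<Rightarrow> real ^ 'k ^ 'k" where
  "jac s p \<xi> = (\<chi> j l. if l = k0 then s else p * (\<xi> $ l - coord j l))"

text \<open>
  The matrix arises from \<open>simplex_mat\<close> by column operations: the column \<open>k0\<close> is scaled by \<open>s\<close>, every other column
  by \<open>- p\<close>, and \<open>p \<xi>\<^sub>l\<close> times the original column \<open>k0\<close> is added to the column \<open>l\<close>.  Together they are the right
  factor \<open>C\<close>, which has the determinant of the diagonal matrix \<open>A\<close> because a row operation leads from \<open>A\<close> to \<open>C\<close>.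
\<close>

lemma abs_det_jac: "\<bar>det (jac s p \<xi>)\<bar> = \<bar>s\<bar> * \<bar>p\<bar> ^ (CARD('k) - 1) * simplex_vol"
proof -
  define A :: "real ^ 'k ^ 'k" where "A = (\<chi> i l. if i = l then (if i = k0 then s else - p) else 0)"
  define y :: "real ^ 'k" where "y = (\<chi> l. if l = k0 then 1 else - \<xi> $ l)"
  define C :: "real ^ 'k ^ 'k" where "C = (\<chi> i. if i = k0 then (\<Sum>i\<in>UNIV. y $ i *s row i A) else row i A)"
  have dA: "det A = s * (- p) ^ (CARD('k) - 1)"
  proof -
    have "det A = (\<Prod>i\<in>UNIV. if i = k0 then s else - p)" unfolding A_def by (subst det_diagonal) auto
    also have "\<dots> = s * (\<Prod>i\<in>UNIV - {k0}. if i = k0 then s else - p)" by (subst prod.remove[of _ k0]) auto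
    also have "(\<Prod>i\<in>UNIV - {k0}. if i = k0 then s else - p) = (\<Prod>i\<in>UNIV - {k0}. - p)" by (intro prod.cong) auto
    finally show ?thesis by (simp add: card_Diff_singleton)
  qed
  have dC: "det C = det A" unfolding C_def by (subst cramer_lemma_transpose) (simp add: y_def)
  have Ck: "C $ k0 $ l = (if l = k0 then s else p * \<xi> $ l)" for l
  proof -
    have "C $ k0 $ l = (\<Sum>i\<in>UNIV. y $ i * A $ i $ l)" by (simp add: C_def row_def)
    also have "\<dots> = (\<Sum>i\<in>UNIV. if i = l then y $ l * A $ l $ l else 0)" by (intro sum.cong) (auto simp: A_def)
    also have "\<dots> = y $ l * A $ l $ l" by simp
    finally show ?thesis by (simp add: y_def A_def)
  qed
  have Cl: "C $ i $ l = (if i = l then - p else 0)" if "i \<noteq> k0" for i l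
    using that by (simp add: C_def row_def A_def)
  have "jac s p \<xi> = simplex_mat ** C"
  proof (simp add: vec_eq_iff, intro allI)
    fix j l
    have "(simplex_mat ** C) $ j $ l = C $ k0 $ l + (\<Sum>i\<in>- {k0}. coord j i * C $ i $ l)"
      by (simp add: matrix_matrix_mult_def sum_split_k0 simplex_mat_def)
    also have "(\<Sum>i\<in>- {k0}. coord j i * C $ i $ l) = (\<Sum>i\<in>- {k0}. if i = l then - p * coord j l else 0)"
      by (intro sum.cong) (auto simp: Cl)
    also have "\<dots> = (if l = k0 then 0 else - p * coord j l)" by simp
    finally show "jac s p \<xi> $ j $ l = (simplex_mat ** C) $ j $ l"
      by (simp add: jac_def Ck algebra_simps)
  qed
  then have "det (jac s p \<xi>) = det simplex_mat * (s * (- p) ^ (CARD('k) - 1))" by (simp add: det_mul dC dA)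
  then show ?thesis by (simp add: abs_mult power_abs simplex_vol_def)
qed

definition point :: "real ^ 'k \<Rightarrow> real ^ 'm \<Rightarrow> real ^ 'n" where
  "point \<alpha> \<beta> = base + (\<Sum>l\<in>UNIV. \<alpha> $ l *\<^sub>R e l) + E \<beta>"

text \<open>
  The tangential coordinates together with the squared distance to the affine span, in the slot \<open>k0\<close>.  These determine all distances
  to the points \<open>x $ j\<close> and are constant on the spheres.
\<close>

definition reduced :: "real ^ 'k \<Rightarrow> real ^ 'm \<Rightarrow> real ^ 'k" where
  "reduced \<alpha> \<beta> = (\<chi> l. if l = k0 then (\<alpha> $ k0)\<^sup>2 + (norm \<beta>)\<^sup>2 else \<alpha> $ l)"

text \<open>
  The squared distances to the points \<open>x $ j\<close> in terms of reduced coordinates, by Pythagoras.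
\<close>

definition sqdist :: "real ^ 'k \<Rightarrow> real ^ 'k" where
  "sqdist \<xi> = (\<chi> j. \<xi> $ k0 + (\<Sum>l\<in>- {k0}. (\<xi> $ l - coord j l)\<^sup>2))"

lemma inner_frame: "((\<Sum>l\<in>UNIV. p $ l *\<^sub>R e l) + E u) \<bullet> ((\<Sum>l\<in>UNIV. q $ l *\<^sub>R e l) + E v) = p \<bullet> q + E u \<bullet> E v"
proof -
  have "(\<Sum>l\<in>UNIV. p $ l *\<^sub>R e l) \<bullet> (\<Sum>l\<in>UNIV. q $ l *\<^sub>R e l) = (\<Sum>l\<in>UNIV. p $ l * q $ l)"
    by (rule orthonormal_sum_inner) (auto simp: ee)
  moreover have "(\<Sum>l\<in>UNIV. p $ l *\<^sub>R e l) \<bullet> E v = 0" "E u \<bullet> (\<Sum>l\<in>UNIV. q $ l *\<^sub>R e l) = 0"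
    by (simp_all add: inner_sum_left inner_sum_right eE inner_commute[of "E u"])
  moreover have "p \<bullet> q = (\<Sum>l\<in>UNIV. p $ l * q $ l)" by (simp add: inner_vec_def)
  ultimately show ?thesis by (simp only: inner_add_left inner_add_right)
qed

lemma E_inner: "E u \<bullet> E u = (norm u)\<^sup>2"
  by (simp add: normE flip: power2_norm_eq_inner)

lemma point_minus_x: "point \<alpha> \<beta> - x $ j = (\<Sum>l\<in>UNIV. (\<chi> l. \<alpha> $ l - coord j l) $ l *\<^sub>R e l) + E \<beta>"
proof -
  have "(\<Sum>l\<in>UNIV. coord j l *\<^sub>R e l) = x $ j - base" by (simp add: sum_split_k0 x_expand)
  then show ?thesis by (simp add: point_def scaleR_diff_left sum_subtractf)
qed

lemma inner_point_minus_x: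
  "(point \<alpha> \<beta> - x $ i) \<bullet> (point \<alpha> \<beta> - x $ j) = reduced \<alpha> \<beta> $ k0 + (\<Sum>l\<in>- {k0}. (\<alpha> $ l - coord i l) * (\<alpha> $ l - coord j l))"
  unfolding point_minus_x inner_frame E_inner
  by (simp add: inner_vec_def sum_split_k0 reduced_def power2_eq_square)

text \<open>
  By Pythagoras, the squared distance splits into a tangential part and the squared distance to the affine span.
\<close>

lemma dist_point: "(norm (x $ j - point \<alpha> \<beta>))\<^sup>2 = sqdist (reduced \<alpha> \<beta>) $ j"
  unfolding norm_minus_commute[of "x $ j"] power2_norm_eq_inner inner_point_minus_x
  by (simp add: sqdist_def reduced_def power2_eq_square)

lemma point_isometry:
  "linear (\<lambda>p. (\<Sum>l\<in>UNIV. fst p $ l *\<^sub>R e l) + E (snd p))"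
  "norm ((\<Sum>l\<in>UNIV. fst p $ l *\<^sub>R e l) + E (snd p)) = norm p"
proof -
  have "linear (\<lambda>p. E (snd p))" using linear_compose[OF linear_snd linE] by (simp add: o_def)
  moreover have "linear (\<lambda>p. \<Sum>l\<in>UNIV. fst p $ l *\<^sub>R e l)"
    by (rule linearI) (simp_all add: scaleR_add_left sum.distrib scaleR_sum_right)
  ultimately have "linear (\<lambda>p. \<Sum>l\<in>UNIV. fst p $ l *\<^sub>R e l)" "linear (\<lambda>p. E (snd p))" by blast+
  then show "linear (\<lambda>p. (\<Sum>l\<in>UNIV. fst p $ l *\<^sub>R e l) + E (snd p))" by (rule linear_compose_add)
  show "norm ((\<Sum>l\<in>UNIV. fst p $ l *\<^sub>R e l) + E (snd p)) = norm p"
    by (simp add: norm_eq_sqrt_inner[of "_ + _"] inner_frame E_inner norm_prod_def power2_norm_eq_inner)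
qed

lemma point_surj: obtains \<alpha> \<beta> where "z = point \<alpha> \<beta>"
proof -
  let ?T = "\<lambda>p :: (real ^ 'k) \<times> (real ^ 'm). (\<Sum>l\<in>UNIV. fst p $ l *\<^sub>R e l) + E (snd p)"
  have "inj ?T"
  proof (rule linear_injective_0[OF point_isometry(1), THEN iffD2], intro allI impI)
    fix p assume "?T p = 0"
    then show "p = 0" using point_isometry(2)[of p] by (metis norm_eq_zero)
  qed
  then have "dim (range ?T) = dim (UNIV :: ((real ^ 'k) \<times> (real ^ 'm)) set)"
    by (intro dim_image_eq[OF point_isometry(1)]) auto
  then have "dim (range ?T) = dim (UNIV :: (real ^ 'n) set)" using card by simp
  then have "range ?T = UNIV"
    using subspace_dim_equal[of "range ?T" UNIV] linear_subspace_image[OF point_isometry(1) subspace_UNIV] by auto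
  then have "z - base \<in> range ?T" by (simp only: UNIV_I)
  then obtain p where "z - base = ?T p" by (rule imageE)
  then have "z = point (fst p) (snd p)" by (simp add: point_def algebra_simps)
  then show thesis by (rule that)
qed

lemma point_in_aff_span: "\<alpha> $ k0 = 0 \<Longrightarrow> point \<alpha> 0 \<in> aff_span x"
  unfolding aff_span_eq_translate[of x k0] direction
  using linear_0[OF linE] by (auto simp: point_def base_def sum_split_k0)

lemma aff_span_point:
  assumes "z \<in> aff_span x" obtains \<alpha> where "z = point \<alpha> 0" "\<alpha> $ k0 = 0"
proof -
  obtain a :: "real ^ 'k" where a: "z = base + (\<Sum>l\<in>- {k0}. a $ l *\<^sub>R e l)"
    using assms unfolding aff_span_eq_translate[of x k0] direction by (auto simp: base_def)
  let ?a = "\<chi> l. if l = k0 then 0 else a $ l"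
  have "(\<Sum>l\<in>- {k0}. ?a $ l *\<^sub>R e l) = (\<Sum>l\<in>- {k0}. a $ l *\<^sub>R e l)" by (intro sum.cong) auto
  then have "z = point ?a 0" using a linear_0[OF linE] by (simp add: point_def sum_split_k0)
  then show thesis by (rule that) simp
qed

definition offset :: "real ^ 'k" where "offset = (\<chi> j. \<Sum>l\<in>- {k0}. (coord j l)\<^sup>2)"

text \<open>
  Expanding the squares in \<open>sqdist \<xi>\<close> shows that it is the affine map \<open>simplex_mat *v z + offset\<close> in the variables
  \<open>z\<^sub>k\<^sub>0 = \<xi>\<^sub>k\<^sub>0 + \<Sum> \<xi>\<^sub>l\<^sup>2\<close> and \<open>z\<^sub>l = - 2 \<xi>\<^sub>l\<close>; solving first for \<open>z\<close> and then for \<open>\<xi>\<close> inverts it.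
\<close>

definition sqdist_inv :: "real ^ 'k \<Rightarrow> real ^ 'k" where
  "sqdist_inv w = (let z = matrix_inv simplex_mat *v (w - offset) in
     \<chi> l. if l = k0 then z $ k0 - (\<Sum>i\<in>- {k0}. (z $ i / 2)\<^sup>2) else - z $ l / 2)"

lemma sqdist_eq: "sqdist \<xi> = simplex_mat *v (\<chi> l. if l = k0 then \<xi> $ k0 + (\<Sum>i\<in>- {k0}. (\<xi> $ i)\<^sup>2) else - 2 * \<xi> $ l) + offset"
proof (simp add: vec_eq_iff, intro allI)
  fix j
  let ?z = "\<chi> l. if l = k0 then \<xi> $ k0 + (\<Sum>i\<in>- {k0}. (\<xi> $ i)\<^sup>2) else - 2 * \<xi> $ l"
  have "(simplex_mat *v ?z) $ j = \<xi> $ k0 + (\<Sum>i\<in>- {k0}. (\<xi> $ i)\<^sup>2) + (\<Sum>l\<in>- {k0}. coord j l * (- 2 * \<xi> $ l))"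
    by (simp add: matrix_vector_mult_def sum_split_k0 simplex_mat_def)
  moreover have "(\<Sum>l\<in>- {k0}. (\<xi> $ l - coord j l)\<^sup>2) = (\<Sum>i\<in>- {k0}. (\<xi> $ i)\<^sup>2) + (\<Sum>l\<in>- {k0}. coord j l * (- 2 * \<xi> $ l)) + offset $ j"
    by (simp add: offset_def sum.distrib[symmetric] power2_diff algebra_simps)
  ultimately show "sqdist \<xi> $ j = (simplex_mat *v ?z) $ j + offset $ j" by (simp add: sqdist_def)
qed

lemma simplex_mat_inv: "matrix_inv simplex_mat ** simplex_mat = mat 1" "simplex_mat ** matrix_inv simplex_mat = mat 1"
proof -
  have "\<exists>A'. simplex_mat ** A' = mat 1 \<and> A' ** simplex_mat = mat 1"
    using det_simplex_nonzero invertible_det_nz[of simplex_mat] by (simp add: invertible_def)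
  from someI_ex[OF this] show "matrix_inv simplex_mat ** simplex_mat = mat 1" "simplex_mat ** matrix_inv simplex_mat = mat 1"
    unfolding matrix_inv_def by blast+
qed

lemma sqdist_inv_sqdist [simp]: "sqdist_inv (sqdist \<xi>) = \<xi>"
proof -
  let ?z = "\<chi> l. if l = k0 then \<xi> $ k0 + (\<Sum>i\<in>- {k0}. (\<xi> $ i)\<^sup>2) else - 2 * \<xi> $ l"
  have "matrix_inv simplex_mat *v (sqdist \<xi> - offset) = ?z"
    by (simp add: sqdist_eq matrix_vector_mul_assoc simplex_mat_inv)
  moreover have "(\<Sum>i\<in>- {k0}. (?z $ i / 2)\<^sup>2) = (\<Sum>i\<in>- {k0}. (\<xi> $ i)\<^sup>2)" by (intro sum.cong) auto
  ultimately show ?thesis by (simp add: sqdist_inv_def Let_def vec_eq_iff)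
qed

lemma sqdist_sqdist_inv [simp]: "sqdist (sqdist_inv w) = w"
proof -
  define z where "z = matrix_inv simplex_mat *v (w - offset)"
  let ?x = "sqdist_inv w"
  have "(\<chi> l. if l = k0 then ?x $ k0 + (\<Sum>i\<in>- {k0}. (?x $ i)\<^sup>2) else - 2 * ?x $ l) = z"
  proof -
    have "(\<Sum>i\<in>- {k0}. (?x $ i)\<^sup>2) = (\<Sum>i\<in>- {k0}. (z $ i / 2)\<^sup>2)"
      by (intro sum.cong) (auto simp: sqdist_inv_def Let_def z_def)
    then show ?thesis by (auto simp: vec_eq_iff sqdist_inv_def Let_def z_def)
  qed
  then have "sqdist ?x = simplex_mat *v z + offset" using sqdist_eq[of ?x] by simp
  also have "\<dots> = w" by (simp add: z_def matrix_vector_mul_assoc simplex_mat_inv)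
  finally show ?thesis .
qed

lemma continuous_sqdist: "continuous_on UNIV sqdist"
  unfolding sqdist_def[abs_def] by (intro continuous_intros)

lemma continuous_sqdist_inv: "continuous_on UNIV sqdist_inv"
proof -
  have "continuous_on UNIV (\<lambda>w. matrix_inv simplex_mat *v (w - offset))"
    by (intro continuous_on_compose2[OF linear_continuous_on[OF matrix_vector_mul_bounded_linear]] continuous_intros) auto
  then have cc: "continuous_on UNIV (\<lambda>w. (matrix_inv simplex_mat *v (w - offset)) $ l)" for l by (rule continuous_on_component)
  show ?thesis unfolding sqdist_inv_def[abs_def] Let_def
  proof (intro continuous_on_vec_lambda)
    fix l
    show "continuous_on UNIV (\<lambda>w. if l = k0 then (matrix_inv simplex_mat *v (w - offset)) $ k0 - (\<Sum>i\<in>- {k0}. ((matrix_inv simplex_mat *v (w - offset)) $ i / 2)\<^sup>2)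
        else - (matrix_inv simplex_mat *v (w - offset)) $ l / 2)"
      by (cases "l = k0") (auto intro!: continuous_intros cc)
  qed
qed

lemma sqdist_has_derivative: "(sqdist has_derivative (\<lambda>h. jac 1 2 \<xi> *v h)) (at \<xi>)"
proof (rule has_derivative_vecI)
  fix j
  have d: "((\<lambda>\<xi>. sqdist \<xi> $ j) has_derivative (\<lambda>h. h $ k0 + (\<Sum>l\<in>- {k0}. 2 * (\<xi> $ l - coord j l) * h $ l))) (at \<xi>)"
    unfolding sqdist_def vec_lambda_beta
  proof (intro has_derivative_add has_derivative_sum)
    have vn: "((\<lambda>x. x $ l) has_derivative (\<lambda>h. h $ l)) (at \<xi>)" for l :: 'k
      by (rule bounded_linear_imp_has_derivative[OF bounded_linear_vec_nth])
    show "((\<lambda>x. x $ k0) has_derivative (\<lambda>h. h $ k0)) (at \<xi>)" by (rule vn)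
    show "((\<lambda>x. (x $ l - coord j l)\<^sup>2) has_derivative (\<lambda>h. 2 * (\<xi> $ l - coord j l) * h $ l)) (at \<xi>)" for l
      by (rule derivative_eq_intros vn refl | simp add: mult_ac)+
  qed
  have "(jac 1 2 \<xi> *v h) $ j = h $ k0 + (\<Sum>l\<in>- {k0}. 2 * (\<xi> $ l - coord j l) * h $ l)" for h
    by (simp add: matrix_vector_mult_def sum_split_k0 jac_def)
  then show "((\<lambda>\<xi>. sqdist \<xi> $ j) has_derivative (\<lambda>h. (jac 1 2 \<xi> *v h) $ j)) (at \<xi>)" using d by simp
qed

end

section \<open>Averages over spheres as densities\<close>

context frame
begin

lemma distr_point: "distr (lborel \<Otimes>\<^sub>M lborel) borel (\<lambda>p. point (fst p) (snd p)) = lborel"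
proof -
  let ?T = "\<lambda>p :: (real ^ 'k) \<times> (real ^ 'm). (\<Sum>l\<in>UNIV. fst p $ l *\<^sub>R e l) + E (snd p)"
  have T: "distr lborel borel ?T = lborel"
    by (rule distr_lborel_linear_isometry[OF point_isometry]) (use card in simp)
  have m: "?T \<in> borel \<rightarrow>\<^sub>M borel"
    using point_isometry(1)
    by (intro borel_measurable_continuous_onI linear_continuous_on) (simp add: linear_conv_bounded_linear)
  have "distr (lborel \<Otimes>\<^sub>M lborel) borel (\<lambda>p. point (fst p) (snd p)) = distr lborel borel ((+) base \<circ> ?T)"
    by (simp add: lborel_prod point_def o_def add.assoc)
  also have "\<dots> = distr (distr lborel borel ?T) borel ((+) base)"
    using m by (intro distr_distr[symmetric]) auto
  also have "\<dots> = lborel" unfolding T by (rule lborel_distr_plus)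
  finally show ?thesis .
qed

text \<open>
  The coordinates \<open>\<alpha>\<close> of the point over \<open>\<beta>\<close> with reduced coordinates \<open>\<xi>\<close>, on the side of the affine span chosen by the
  sign \<open>\<sigma>\<close>.
\<close>

definition lift :: "real \<Rightarrow> real ^ 'k \<Rightarrow> real ^ 'm \<Rightarrow> real ^ 'k" where
  "lift \<sigma> \<xi> \<beta> = (\<chi> l. if l = k0 then \<sigma> * sqrt (\<xi> $ k0 - (norm \<beta>)\<^sup>2) else \<xi> $ l)"

definition sheet :: "real \<Rightarrow> real ^ 'k \<Rightarrow> real ^ 'm \<Rightarrow> real ^ 'n" where
  "sheet \<sigma> \<xi> \<beta> = point (lift \<sigma> \<xi> \<beta>) \<beta>"

text \<open>
  The inverse of the Jacobian \<open>2 |\<alpha>\<^sub>k\<^sub>0|\<close> of the passage from \<open>\<alpha>\<close> to \<open>\<xi>\<close> at fixed \<open>\<beta>\<close>.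
\<close>

definition sheet_density :: "real ^ 'k \<Rightarrow> real ^ 'm \<Rightarrow> real" where
  "sheet_density \<xi> \<beta> = (if (norm \<beta>)\<^sup>2 < \<xi> $ k0 then 1 / (2 * sqrt (\<xi> $ k0 - (norm \<beta>)\<^sup>2)) else 0)"

lemma sheet_density_nonneg [simp]: "0 \<le> sheet_density \<xi> \<beta>"
  by (simp add: sheet_density_def)

lemma continuous_E: "continuous_on A E"
  using linE by (simp add: linear_continuous_on linear_conv_bounded_linear)

lemma continuous_point: 
  assumes "continuous_on A f" "continuous_on A g" shows "continuous_on A (\<lambda>p. point (f p) (g p))"
  unfolding point_def using assms
  by (intro continuous_intros continuous_on_compose2[OF continuous_E[of UNIV] assms(2)]) auto

lemma continuous_lift: "continuous_on UNIV (\<lambda>p. lift \<sigma> (fst p) (snd p))"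
  unfolding lift_def
proof (rule continuous_on_vec_lambda)
  fix l
  show "continuous_on UNIV (\<lambda>p. if l = k0 then \<sigma> * sqrt (fst p $ k0 - (norm (snd p))\<^sup>2) else fst p $ l)"
    by (cases "l = k0") (auto intro!: continuous_intros)
qed

lemma continuous_sheet: "continuous_on UNIV (\<lambda>p. sheet \<sigma> (fst p) (snd p))"
  unfolding sheet_def by (intro continuous_point continuous_lift continuous_intros)

lemma continuous_sheet1: "continuous_on UNIV (\<lambda>\<xi>. sheet \<sigma> \<xi> \<beta>)"
proof -
  have "continuous_on UNIV (\<lambda>\<xi> :: real ^ 'k. (\<xi>, \<beta>))" by (intro continuous_intros)
  from continuous_on_compose2[OF continuous_sheet[of \<sigma>] this] show ?thesis by simp
qed

lemma measurable_sheet: "(\<lambda>p. sheet \<sigma> (fst p) (snd p)) \<in> borel \<rightarrow>\<^sub>M borel"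
  by (rule borel_measurable_continuous_onI[OF continuous_sheet])

lemma measurable_sheet_density: "(\<lambda>p. sheet_density (fst p) (snd p)) \<in> borel_measurable borel"
proof -
  have "continuous_on UNIV (\<lambda>p :: (real ^ 'k) \<times> (real ^ 'm). fst p $ k0 - (norm (snd p))\<^sup>2)" by (intro continuous_intros)
  then have [measurable]: "(\<lambda>p :: (real ^ 'k) \<times> (real ^ 'm). fst p $ k0 - (norm (snd p))\<^sup>2) \<in> borel_measurable borel"
    by (rule borel_measurable_continuous_onI)
  have "(\<lambda>p :: (real ^ 'k) \<times> (real ^ 'm). if 0 < fst p $ k0 - (norm (snd p))\<^sup>2 then 1 / (2 * sqrt (fst p $ k0 - (norm (snd p))\<^sup>2)) else 0) \<in> borel_measurable borel"
    by measurable
  then show ?thesis by (simp add: sheet_density_def)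
qed

lemma measurable_sheet_density1: "(\<lambda>\<xi>. sheet_density \<xi> \<beta>) \<in> borel_measurable borel"
proof -
  have "(\<lambda>\<xi> :: real ^ 'k. (\<xi>, \<beta>)) \<in> borel \<rightarrow>\<^sub>M borel" by (intro borel_measurable_continuous_onI continuous_intros)
  from measurable_compose[OF this measurable_sheet_density] show ?thesis by simp
qed

lemma reduced_has_derivative:
  "((\<lambda>\<alpha>. reduced \<alpha> \<beta>) has_derivative (\<lambda>h. \<chi> l. (if l = k0 then 2 * \<alpha> $ k0 else 1) * h $ l)) (at \<alpha>)"
proof (rule has_derivative_vecI)
  fix l
  have vn: "((\<lambda>x. x $ l) has_derivative (\<lambda>h. h $ l)) (at \<alpha>)" for l :: 'k
    by (rule bounded_linear_imp_has_derivative[OF bounded_linear_vec_nth])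
  show "((\<lambda>\<alpha>. reduced \<alpha> \<beta> $ l) has_derivative (\<lambda>h. (\<chi> l. (if l = k0 then 2 * \<alpha> $ k0 else 1) * h $ l) $ l)) (at \<alpha>)"
  proof (cases "l = k0")
    case True
    have "((\<lambda>\<alpha>. (\<alpha> $ k0)\<^sup>2 + (norm \<beta>)\<^sup>2) has_derivative (\<lambda>h. 2 * \<alpha> $ k0 * h $ k0)) (at \<alpha>)"
      by (rule derivative_eq_intros vn refl | simp add: mult_ac)+
    then show ?thesis using True by (simp add: reduced_def)
  next
    case False
    then show ?thesis using vn[of l] by (simp add: reduced_def)
  qed
qed

text \<open>
  Only the coordinate \<open>k0\<close> changes: \<open>\<alpha>\<^sub>k\<^sub>0\<close> is replaced by \<open>\<alpha>\<^sub>k\<^sub>0\<^sup>2 + |\<beta>|\<^sup>2\<close>, which is injective once the sign is fixed.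
\<close>

lemma nn_integral_slice:
  assumes \<sigma>: "\<sigma> = 1 \<or> \<sigma> = - 1" and F [measurable]: "F \<in> borel_measurable borel"
  shows "(\<integral>\<^sup>+\<alpha>. F (point \<alpha> \<beta>) * indicator {\<alpha>. 0 < \<sigma> * \<alpha> $ k0} \<alpha> \<partial>lborel) = (\<integral>\<^sup>+\<xi>. ennreal (sheet_density \<xi> \<beta>) * F (sheet \<sigma> \<xi> \<beta>) \<partial>lborel)"
proof -
  let ?S = "{\<alpha> :: real ^ 'k. 0 < \<sigma> * \<alpha> $ k0}" and ?g = "\<lambda>\<alpha>. reduced \<alpha> \<beta>"
  let ?F = "\<lambda>\<xi>. ennreal (sheet_density \<xi> \<beta>) * F (sheet \<sigma> \<xi> \<beta>)"
  have s2: "\<sigma> * \<sigma> = 1" "\<bar>\<sigma>\<bar> = 1" using \<sigma> by auto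
  have lift_reduced: "lift \<sigma> (reduced \<alpha> \<beta>) \<beta> = \<alpha>" if "\<alpha> \<in> ?S" for \<alpha>
  proof -
    have "\<sigma> * \<bar>\<alpha> $ k0\<bar> = \<alpha> $ k0" using that \<sigma> by auto
    then show ?thesis by (simp add: lift_def reduced_def vec_eq_iff)
  qed
  have reduced_lift: "reduced (lift \<sigma> \<xi> \<beta>) \<beta> = \<xi>" if "(norm \<beta>)\<^sup>2 < \<xi> $ k0" for \<xi>
    using that \<sigma> by (auto simp: lift_def reduced_def vec_eq_iff power_mult_distrib)
  have img: "?g ` ?S = {\<xi>. (norm \<beta>)\<^sup>2 < \<xi> $ k0}"
  proof (intro equalityI subsetI)
    fix \<xi> assume "\<xi> \<in> {\<xi>. (norm \<beta>)\<^sup>2 < \<xi> $ k0}"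
    then have x: "(norm \<beta>)\<^sup>2 < \<xi> $ k0" by simp
    then have "lift \<sigma> \<xi> \<beta> \<in> ?S" by (simp add: lift_def s2 flip: mult.assoc)
    then show "\<xi> \<in> ?g ` ?S" using reduced_lift[OF x] by (intro image_eqI[of _ _ "lift \<sigma> \<xi> \<beta>"]) auto
  qed (auto simp: reduced_def)
  have wm [measurable]: "(\<lambda>\<xi>. sheet_density \<xi> \<beta>) \<in> borel_measurable borel" by (rule measurable_sheet_density1)
  have sm [measurable]: "(\<lambda>\<xi>. sheet \<sigma> \<xi> \<beta>) \<in> borel \<rightarrow>\<^sub>M borel" by (rule borel_measurable_continuous_onI[OF continuous_sheet1])
  have "(\<integral>\<^sup>+\<xi>. ?F \<xi> \<partial>lborel) = (\<integral>\<^sup>+\<xi>. ?F \<xi> * indicator (?g ` ?S) \<xi> \<partial>lborel)"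
    unfolding img by (intro nn_integral_cong) (auto simp: indicator_def sheet_density_def)
  also have "\<dots> = (\<integral>\<^sup>+\<alpha>. ennreal (2 * \<bar>\<alpha> $ k0\<bar>) * ?F (?g \<alpha>) * indicator ?S \<alpha> \<partial>lborel)"
  proof (rule nn_integral_change_of_variables[where g' = "\<lambda>\<alpha> h. \<chi> l. (if l = k0 then 2 * \<alpha> $ k0 else 1) * h $ l"])
    show "open ?S" by (intro open_Collect_less continuous_intros)
    show "inj_on ?g ?S" by (rule inj_on_inverseI[of _ "\<lambda>\<xi>. lift \<sigma> \<xi> \<beta>"]) (rule lift_reduced)
    show "((\<lambda>\<alpha>. reduced \<alpha> \<beta>) has_derivative (\<lambda>h. \<chi> l. (if l = k0 then 2 * \<alpha> $ k0 else 1) * h $ l)) (at \<alpha>)" for \<alpha>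
      by (rule reduced_has_derivative)
    show "\<bar>det (matrix (\<lambda>h :: real ^ 'k. \<chi> l. (if l = k0 then 2 * \<alpha> $ k0 else 1) * h $ l))\<bar> = 2 * \<bar>\<alpha> $ k0\<bar>" for \<alpha> :: "real ^ 'k"
      by (simp only: det_scale_coordinate abs_mult abs_numeral)
    have "continuous_on UNIV (\<lambda>\<alpha>. reduced \<alpha> \<beta> $ l)" for l
      by (cases "l = k0") (auto simp: reduced_def intro!: continuous_intros)
    then have "continuous_on UNIV ?g" by (subst continuous_on_componentwise) (auto simp: Basis_real_vec inner_axis)
    then show "?g \<in> borel \<rightarrow>\<^sub>M borel" by (rule borel_measurable_continuous_onI)
  qed measurable
  also have "\<dots> = (\<integral>\<^sup>+\<alpha>. F (point \<alpha> \<beta>) * indicator ?S \<alpha> \<partial>lborel)"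
  proof (intro nn_integral_cong)
    fix \<alpha> :: "real ^ 'k"
    show "ennreal (2 * \<bar>\<alpha> $ k0\<bar>) * ?F (?g \<alpha>) * indicator ?S \<alpha> = F (point \<alpha> \<beta>) * indicator ?S \<alpha>"
    proof (cases "\<alpha> \<in> ?S")
      case True
      then have a: "\<alpha> $ k0 \<noteq> 0" by auto
      have "sheet_density (?g \<alpha>) \<beta> = 1 / (2 * \<bar>\<alpha> $ k0\<bar>)" using a by (simp add: sheet_density_def reduced_def)
      moreover have "sheet \<sigma> (?g \<alpha>) \<beta> = point \<alpha> \<beta>" by (simp add: sheet_def lift_reduced[OF True])
      moreover have "ennreal (2 * \<bar>\<alpha> $ k0\<bar>) * ennreal (1 / (2 * \<bar>\<alpha> $ k0\<bar>)) = 1"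
        using a by (simp flip: ennreal_mult)
      ultimately show ?thesis by (simp add: mult.assoc[symmetric])
    qed simp
  qed
  finally show ?thesis by simp
qed

definition half_space :: "real \<Rightarrow> (real ^ 'n) set" where
  "half_space \<sigma> = {z. 0 < \<sigma> * ((z - base) \<bullet> e k0)}"

lemma half_space_borel: "half_space \<sigma> \<in> sets borel"
  unfolding half_space_def by measurable

lemma point_in_half_space: "point \<alpha> \<beta> \<in> half_space \<sigma> \<longleftrightarrow> 0 < \<sigma> * \<alpha> $ k0"
proof -
  have "(point \<alpha> \<beta> - base) \<bullet> e k0 = \<alpha> $ k0"
    by (simp add: point_def inner_add_left inner_e_sum eE inner_commute[of "E \<beta>"])
  then show ?thesis by (simp add: half_space_def)
qed

text \<open>
  The coarea formula for the map \<open>z \<mapsto> \<xi>\<close> on one half space: \<open>nn_integral_slice\<close> for each \<open>\<beta>\<close>, integrated over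
  \<open>\<beta>\<close>, since \<open>point\<close> is an isometry.
\<close>

lemma half_space_measure_eq:
  assumes \<sigma>: "\<sigma> = 1 \<or> \<sigma> = - 1"
  shows "density lborel (\<lambda>z. ennreal (indicator (half_space \<sigma>) z)) =
    distr (density (lborel \<Otimes>\<^sub>M lborel) (\<lambda>p. ennreal (sheet_density (fst p) (snd p)))) borel (\<lambda>p. sheet \<sigma> (fst p) (snd p))"
proof (rule measure_eqI)
  fix B assume "B \<in> sets (density lborel (\<lambda>z. ennreal (indicator (half_space \<sigma>) z)))"
  then have B [measurable]: "B \<in> sets borel" by simp
  note [measurable] = half_space_borel[of \<sigma>]
  let ?h = "\<lambda>z. indicator (half_space \<sigma>) z * indicator B z :: ennreal"
  let ?Q = "density (lborel \<Otimes>\<^sub>M lborel) (\<lambda>p. ennreal (sheet_density (fst p) (snd p)))"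
  have mL: "(\<lambda>p. point (fst p) (snd p)) \<in> borel \<rightarrow>\<^sub>M borel"
    by (intro borel_measurable_continuous_onI continuous_point continuous_intros)
  have mh: "?h \<in> borel_measurable borel" by measurable
  have mhL: "(\<lambda>p. ?h (point (fst p) (snd p))) \<in> borel_measurable (lborel \<Otimes>\<^sub>M lborel)"
    using measurable_compose[OF mL mh] by (simp add: lborel_prod)
  have mB: "(indicator B :: _ \<Rightarrow> ennreal) \<in> borel_measurable borel" by measurable
  have wm: "(\<lambda>p. ennreal (sheet_density (fst p) (snd p))) \<in> borel_measurable (lborel \<Otimes>\<^sub>M lborel)"
    using measurable_sheet_density by (simp add: lborel_prod)
  have sm: "(\<lambda>p. indicator B (sheet \<sigma> (fst p) (snd p)) :: ennreal) \<in> borel_measurable (lborel \<Otimes>\<^sub>M lborel)"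
    using measurable_compose[OF measurable_sheet[of \<sigma>] mB] by (simp add: lborel_prod)
  have "emeasure (density lborel (\<lambda>z. ennreal (indicator (half_space \<sigma>) z))) B = (\<integral>\<^sup>+z. ?h z \<partial>lborel)"
    by (simp add: emeasure_density ennreal_indicator)
  also have "\<dots> = (\<integral>\<^sup>+p. ?h (point (fst p) (snd p)) \<partial>(lborel \<Otimes>\<^sub>M lborel))"
    by (subst distr_point[symmetric], rule nn_integral_distr) (use mL mh in \<open>simp_all add: lborel_prod\<close>)
  also have "\<dots> = (\<integral>\<^sup>+\<beta>. (\<integral>\<^sup>+\<alpha>. ?h (point \<alpha> \<beta>) \<partial>lborel) \<partial>lborel)"
    using lborel_pair.nn_integral_snd[OF mhL] by simp
  also have "\<dots> = (\<integral>\<^sup>+\<beta>. (\<integral>\<^sup>+\<alpha>. indicator B (point \<alpha> \<beta>) * indicator {\<alpha>. 0 < \<sigma> * \<alpha> $ k0} \<alpha> \<partial>lborel) \<partial>lborel)"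
    by (intro nn_integral_cong) (simp add: indicator_def point_in_half_space)
  also have "\<dots> = (\<integral>\<^sup>+\<beta>. (\<integral>\<^sup>+\<xi>. ennreal (sheet_density \<xi> \<beta>) * indicator B (sheet \<sigma> \<xi> \<beta>) \<partial>lborel) \<partial>lborel)"
    by (intro nn_integral_cong nn_integral_slice \<sigma> mB)
  also have "\<dots> = (\<integral>\<^sup>+p. ennreal (sheet_density (fst p) (snd p)) * indicator B (sheet \<sigma> (fst p) (snd p)) \<partial>(lborel \<Otimes>\<^sub>M lborel))"
    using lborel_pair.nn_integral_snd[OF borel_measurable_times_ennreal[OF wm sm]] by simp
  also have "\<dots> = (\<integral>\<^sup>+p. indicator B (sheet \<sigma> (fst p) (snd p)) \<partial>?Q)"
    by (rule nn_integral_density[symmetric, OF wm sm])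
  also have "\<dots> = (\<integral>\<^sup>+z. indicator B z \<partial>distr ?Q borel (\<lambda>p. sheet \<sigma> (fst p) (snd p)))"
    by (rule nn_integral_distr[symmetric]) (use measurable_sheet[of \<sigma>] mB in \<open>simp_all add: lborel_prod\<close>)
  finally show "emeasure (density lborel (\<lambda>z. ennreal (indicator (half_space \<sigma>) z))) B =
      emeasure (distr (density (lborel \<Otimes>\<^sub>M lborel) (\<lambda>p. ennreal (sheet_density (fst p) (snd p)))) borel (\<lambda>p. sheet \<sigma> (fst p) (snd p))) B"
    by simp
qed simp

text \<open>
  The density at \<open>\<xi>\<close> of the image of \<open>F dz\<close>, restricted to one half space, under \<open>z \<mapsto> \<xi>\<close>.
\<close>

definition fiber :: "(real ^ 'n \<Rightarrow> complex) \<Rightarrow> real \<Rightarrow> real ^ 'k \<Rightarrow> complex" where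
  "fiber F \<sigma> \<xi> = (LINT \<beta>|lborel. sheet_density \<xi> \<beta> *\<^sub>R F (sheet \<sigma> \<xi> \<beta>))"

lemma half_space_integral:
  fixes F :: "real ^ 'n \<Rightarrow> complex"
  assumes \<sigma>: "\<sigma> = 1 \<or> \<sigma> = - 1" and F: "integrable lborel F"
  shows "integrable (lborel \<Otimes>\<^sub>M lborel) (\<lambda>(\<xi>, \<beta>). sheet_density \<xi> \<beta> *\<^sub>R F (sheet \<sigma> \<xi> \<beta>))"
    and "(LINT z|lborel. indicator (half_space \<sigma>) z *\<^sub>R F z) = (LINT \<xi>|lborel. fiber F \<sigma> \<xi>)"
proof -
  note [measurable] = half_space_borel[of \<sigma>]
  have Fm [measurable]: "F \<in> borel_measurable borel" using F by auto
  let ?Q = "density (lborel \<Otimes>\<^sub>M lborel) (\<lambda>p. ennreal (sheet_density (fst p) (snd p)))"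
  let ?s = "\<lambda>p. sheet \<sigma> (fst p) (snd p)" and ?w = "\<lambda>p. sheet_density (fst p) (snd p)"
  have sm: "?s \<in> ?Q \<rightarrow>\<^sub>M borel" using measurable_sheet[of \<sigma>] by (simp add: lborel_prod)
  have wm: "?w \<in> borel_measurable (lborel \<Otimes>\<^sub>M lborel)" using measurable_sheet_density by (simp add: lborel_prod)
  have Fsm: "(\<lambda>p. F (?s p)) \<in> borel_measurable (lborel \<Otimes>\<^sub>M lborel)"
    using measurable_compose[OF measurable_sheet[of \<sigma>] Fm] by (simp add: lborel_prod)
  have "integrable lborel (\<lambda>z. indicator (half_space \<sigma>) z *\<^sub>R F z)"
    by (rule integrable_mult_indicator[OF _ F]) (simp add: half_space_borel)
  then have "integrable (density lborel (\<lambda>z. ennreal (indicator (half_space \<sigma>) z))) F"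
    by (subst integrable_density) auto
  then have "integrable ?Q (\<lambda>p. F (?s p))"
    unfolding half_space_measure_eq[OF \<sigma>] by (subst (asm) integrable_distr_eq[OF sm]) auto
  then have i: "integrable (lborel \<Otimes>\<^sub>M lborel) (\<lambda>p. ?w p *\<^sub>R F (?s p))"
    by (subst (asm) integrable_density[OF Fsm wm]) auto
  then show i': "integrable (lborel \<Otimes>\<^sub>M lborel) (\<lambda>(\<xi>, \<beta>). sheet_density \<xi> \<beta> *\<^sub>R F (sheet \<sigma> \<xi> \<beta>))"
    by (simp add: split_def)
  have "(LINT z|lborel. indicator (half_space \<sigma>) z *\<^sub>R F z) = integral\<^sup>L (density lborel (\<lambda>z. ennreal (indicator (half_space \<sigma>) z))) F"
    by (rule integral_density[symmetric]) auto
  also have "\<dots> = integral\<^sup>L ?Q (\<lambda>p. F (?s p))"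
    unfolding half_space_measure_eq[OF \<sigma>] by (rule integral_distr[OF sm]) simp
  also have "\<dots> = (LINT p|(lborel \<Otimes>\<^sub>M lborel). ?w p *\<^sub>R F (?s p))"
    by (rule integral_density[OF Fsm wm]) simp
  also have "\<dots> = (LINT \<xi>|lborel. (LINT \<beta>|lborel. sheet_density \<xi> \<beta> *\<^sub>R F (sheet \<sigma> \<xi> \<beta>)))"
    using lborel_pair.integral_fst'[OF i] by simp
  finally show "(LINT z|lborel. indicator (half_space \<sigma>) z *\<^sub>R F z) = (LINT \<xi>|lborel. fiber F \<sigma> \<xi>)"
    by (simp add: fiber_def)
qed

lemma fiber_integrable:
  assumes "\<sigma> = 1 \<or> \<sigma> = - 1" "integrable lborel F"
  shows "integrable lborel (fiber F \<sigma>)"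
    and "AE \<xi> in lborel. integrable lborel (\<lambda>\<beta>. sheet_density \<xi> \<beta> *\<^sub>R F (sheet \<sigma> \<xi> \<beta>))"
  using lborel_pair.integrable_fst[OF half_space_integral(1)[OF assms]] lborel_pair.AE_integrable_fst[OF half_space_integral(1)[OF assms]]
  by (simp_all add: fiber_def[abs_def])

lemma equatorial_null: "AE z in lborel. (z - base) \<bullet> e k0 \<noteq> 0"
proof -
  have "e k0 \<noteq> 0" using ee[of k0 k0] by auto
  then have "negligible {z. e k0 \<bullet> z = e k0 \<bullet> base}" by (intro negligible_hyperplane) simp
  moreover have "{z. e k0 \<bullet> z = e k0 \<bullet> base} = {z. (z - base) \<bullet> e k0 = 0}"
    by (auto simp: inner_commute[of _ "e k0"] inner_diff_right)
  ultimately have "{z. (z - base) \<bullet> e k0 = 0} \<in> null_sets lebesgue" by (simp add: negligible_iff_null_sets)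
  then have "{z. (z - base) \<bullet> e k0 = 0} \<in> null_sets lborel"
    by (subst (asm) null_sets_completion_iff) auto
  then show ?thesis by (rule AE_I') auto
qed

text \<open>
  The two half spaces exhaust the space up to a hyperplane, which is a null set.
\<close>

lemma integral_fibers:
  fixes F :: "real ^ 'n \<Rightarrow> complex"
  assumes F: "integrable lborel F"
  shows "(LINT z|lborel. F z) = (LINT \<xi>|lborel. fiber F 1 \<xi> + fiber F (- 1) \<xi>)"
proof -
  have i: "integrable lborel (\<lambda>z. indicator (half_space \<sigma>) z *\<^sub>R F z)" for \<sigma>
    by (rule integrable_mult_indicator[OF _ F]) (simp add: half_space_borel)
  have Fm [measurable]: "F \<in> borel_measurable borel" using F by auto
  note [measurable] = half_space_borel
  have "(LINT z|lborel. F z) = (LINT z|lborel. indicator (half_space 1) z *\<^sub>R F z + indicator (half_space (- 1)) z *\<^sub>R F z)"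
  proof (rule integral_cong_AE)
    show "AE z in lborel. F z = indicator (half_space 1) z *\<^sub>R F z + indicator (half_space (- 1)) z *\<^sub>R F z"
      using equatorial_null by eventually_elim (auto simp: half_space_def indicator_def)
  qed auto
  also have "\<dots> = (LINT z|lborel. indicator (half_space 1) z *\<^sub>R F z) + (LINT z|lborel. indicator (half_space (- 1)) z *\<^sub>R F z)"
    by (rule Bochner_Integration.integral_add[OF i i])
  also have "\<dots> = (LINT \<xi>|lborel. fiber F 1 \<xi>) + (LINT \<xi>|lborel. fiber F (- 1) \<xi>)"
    by (simp add: half_space_integral(2)[OF _ F])
  also have "\<dots> = (LINT \<xi>|lborel. fiber F 1 \<xi> + fiber F (- 1) \<xi>)"
    by (rule Bochner_Integration.integral_add[symmetric]) (auto intro!: fiber_integrable F)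
  finally show ?thesis .
qed

text \<open>
  The distances as functions of the reduced coordinates; the nondegenerate spheres are those with radii \<open>\<tau> \<xi>\<close>, where
  \<open>\<xi>\<^sub>k\<^sub>0 > 0\<close>.
\<close>

definition \<tau> :: "real ^ 'k \<Rightarrow> real ^ 'k" where "\<tau> \<xi> = (\<chi> j. sqrt (sqdist \<xi> $ j))"

lemma sqdist_pos: "0 < \<xi> $ k0 \<Longrightarrow> 0 < sqdist \<xi> $ j"
  by (simp add: sqdist_def add_pos_nonneg sum_nonneg)

lemma inj_sqdist: "sqdist \<xi> = sqdist \<xi>' \<Longrightarrow> \<xi> = \<xi>'"
  by (metis sqdist_inv_sqdist)

lemma mem_sph_iff:
  assumes "0 \<le> \<xi> $ k0"
  shows "point \<alpha> \<beta> \<in> sph x (\<tau> \<xi>) \<longleftrightarrow> reduced \<alpha> \<beta> = \<xi>"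
proof -
  have "norm (x $ j - point \<alpha> \<beta>) = \<tau> \<xi> $ j \<longleftrightarrow> sqdist (reduced \<alpha> \<beta>) $ j = sqdist \<xi> $ j" for j
  proof -
    have "norm (x $ j - point \<alpha> \<beta>) = sqrt (sqdist (reduced \<alpha> \<beta>) $ j)" by (simp flip: dist_point)
    then show ?thesis by (simp add: \<tau>_def)
  qed
  then have "point \<alpha> \<beta> \<in> sph x (\<tau> \<xi>) \<longleftrightarrow> sqdist (reduced \<alpha> \<beta>) = sqdist \<xi>" by (simp add: sph_def vec_eq_iff)
  then show ?thesis using inj_sqdist by auto
qed

lemma dist_map_point: "dist_map x (point \<alpha> \<beta>) = \<tau> (reduced \<alpha> \<beta>)"
proof -
  have "norm (x $ j - point \<alpha> \<beta>) = sqrt (sqdist (reduced \<alpha> \<beta>) $ j)" for j by (simp flip: dist_point)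
  then show ?thesis by (simp add: dist_map_def \<tau>_def vec_eq_iff)
qed

lemma \<tau>_notin_C_Z:
  assumes \<xi>: "0 < \<xi> $ k0" shows "\<tau> \<xi> \<notin> C_set x \<union> Z_set x"
proof -
  have "\<tau> \<xi> \<notin> C_set x"
  proof
    assume "\<tau> \<xi> \<in> C_set x"
    then obtain z where z: "z \<in> aff_span x" "\<tau> \<xi> = dist_map x z" by (auto simp: C_set_def)
    obtain \<alpha> where a: "z = point \<alpha> 0" "\<alpha> $ k0 = 0" using aff_span_point[OF z(1)] by metis
    have "point \<alpha> 0 \<in> sph x (\<tau> \<xi>)" using z(2) a(1) by (simp add: sph_def dist_map_def)
    then have "reduced \<alpha> 0 = \<xi>" using mem_sph_iff[of \<xi> \<alpha> 0] \<xi> by simp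
    then have "\<xi> $ k0 = 0" using a(2) by (auto simp: reduced_def)
    then show False using \<xi> by simp
  qed
  moreover have "\<tau> \<xi> \<notin> Z_set x"
  proof -
    have "reduced (lift 1 \<xi> 0) 0 = \<xi>" using \<xi> by (simp add: reduced_def lift_def vec_eq_iff)
    then have "point (lift 1 \<xi> 0) 0 \<in> sph x (\<tau> \<xi>)" using mem_sph_iff[of \<xi>] \<xi> by simp
    then show ?thesis by (auto simp: Z_set_def)
  qed
  ultimately show ?thesis by simp
qed

text \<open>
  A nonempty sphere with radii \<open>t\<close> that are not of this form consists of a single point of the affine span, and that point is
  none of the centres because all radii are positive; so \<open>t\<close> lies in the set where the average is set to zero.
\<close>

lemma avg_op_zero:
  assumes t: "t \<in> pos_orthant" and nt: "t \<notin> \<tau> ` {\<xi>. 0 < \<xi> $ k0}"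
  shows "avg_op t f x = 0"
proof (cases "sph x t = {}")
  case True
  then show ?thesis using t by (simp add: avg_op_def Z_set_def)
next
  case False
  then obtain z where z: "z \<in> sph x t" by blast
  obtain \<alpha> \<beta> where ab: "z = point \<alpha> \<beta>" by (rule point_surj)
  have tz: "t = dist_map x z" using z by (simp add: sph_def dist_map_def vec_eq_iff)
  then have "t = \<tau> (reduced \<alpha> \<beta>)" by (simp add: ab dist_map_point)
  then have "\<not> 0 < reduced \<alpha> \<beta> $ k0" using nt by blast
  then have "(\<alpha> $ k0)\<^sup>2 + (norm \<beta>)\<^sup>2 \<le> 0" by (simp add: reduced_def)
  then have "\<alpha> $ k0 = 0" "\<beta> = 0" by (simp_all add: sum_power2_le_zero_iff)
  then have za: "z \<in> aff_span x" by (simp add: ab point_in_aff_span)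
  have "z \<notin> range (\<lambda>j. x $ j)"
  proof
    assume "z \<in> range (\<lambda>j. x $ j)"
    then obtain j where "z = x $ j" by blast
    then have "t $ j = 0" using tz by (simp add: dist_map_def)
    moreover have "0 < t $ j" using t by (simp add: pos_orthant_def)
    ultimately show False by simp
  qed
  then have "t \<in> C_set x" using za tz by (auto simp: C_set_def)
  then show ?thesis by (simp add: avg_op_def)
qed

text \<open>
  The rows of the Jacobian of the distance map are the unit vectors from the centres to \<open>z\<close>.  Their Gram matrix involves only the
  inner products computed in \<open>inner_point_minus_x\<close>, and these show that it is the Gram matrix of the rows of
  \<open>jac r 1 \<xi>\<close> divided by the distances, a square matrix with known determinant.
\<close>

lemma D_fun_point:
  assumes \<xi>: "0 < reduced \<alpha> \<beta> $ k0"
  shows "D_fun x (point \<alpha> \<beta>) = sqrt (reduced \<alpha> \<beta> $ k0) * simplex_vol / (\<Prod>j\<in>UNIV. \<tau> (reduced \<alpha> \<beta>) $ j)"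
proof -
  let ?z = "point \<alpha> \<beta>" and ?t = "\<tau> (reduced \<alpha> \<beta>)" and ?r = "sqrt (reduced \<alpha> \<beta> $ k0)"
  have nt: "norm (x $ j - ?z) = ?t $ j" for j by (simp add: \<tau>_def flip: dist_point)
  have tp: "0 < ?t $ j" for j using sqdist_pos[OF \<xi>] by (simp add: \<tau>_def)
  define J where "J = (\<chi> j i. (?z - x $ j) $ i / ?t $ j)"
  have der: "(dist_map x has_derivative (\<lambda>h. J *v h)) (at ?z)"
  proof (rule has_derivative_vecI)
    fix j
    have ne: "x $ j - ?z \<noteq> 0" using tp[of j] nt[of j] by auto
    have d1: "((\<lambda>z. x $ j - z) has_derivative (\<lambda>h. - h)) (at ?z)" by (auto intro!: derivative_eq_intros)
    have "((\<lambda>z. norm (x $ j - z)) has_derivative (\<lambda>h. sgn (x $ j - ?z) \<bullet> (- h))) (at ?z)"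
      using has_derivative_compose[OF d1 has_derivative_norm[OF ne]] by (simp add: inner_commute)
    moreover have "(J *v h) $ j = sgn (x $ j - ?z) \<bullet> (- h)" for h
    proof -
      have "(J *v h) $ j = (\<Sum>i\<in>UNIV. (?z - x $ j) $ i * h $ i) / ?t $ j"
        by (simp add: matrix_vector_mult_def J_def sum_divide_distrib)
      also have "\<dots> = ((?z - x $ j) \<bullet> h) / ?t $ j" by (simp add: inner_vec_def)
      also have "\<dots> = sgn (x $ j - ?z) \<bullet> (- h)"
      proof -
        have "sgn (x $ j - ?z) \<bullet> (- h) = - (((x $ j - ?z) \<bullet> h) / ?t $ j)"
          by (simp add: sgn_div_norm nt divide_inverse mult.commute)
        moreover have "(?z - x $ j) \<bullet> h = - ((x $ j - ?z) \<bullet> h)" by (simp add: inner_diff_left)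
        ultimately show ?thesis by simp
      qed
      finally show ?thesis .
    qed
    ultimately show "((\<lambda>z. dist_map x z $ j) has_derivative (\<lambda>h. (J *v h) $ j)) (at ?z)"
      by (simp add: dist_map_def)
  qed
  have jac: "jacobian (dist_map x) (at ?z) = J"
    unfolding jacobian_def frechet_derivative_at[OF der, symmetric] by (simp add: matrix_of_matrix_vector_mul)
  \<comment> \<open>The square matrix that replaces the \<open>k \<times> n\<close> Jacobian without changing the Gram matrix.\<close>
  define Q where "Q = (\<chi> j. (1 / ?t $ j) *s (jac ?r 1 (reduced \<alpha> \<beta>)) $ j)"
  have "J ** transpose J = Q ** transpose Q"
  proof (simp add: vec_eq_iff, intro allI)
    fix i j
    have r2: "?r * ?r = reduced \<alpha> \<beta> $ k0" using \<xi> by simp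
    have "(J ** transpose J) $ i $ j = (\<Sum>l\<in>UNIV. (?z - x $ i) $ l * (?z - x $ j) $ l) / (?t $ i * ?t $ j)"
      by (simp add: matrix_matrix_mult_def transpose_def J_def sum_divide_distrib)
    also have "(\<Sum>l\<in>UNIV. (?z - x $ i) $ l * (?z - x $ j) $ l) = (?z - x $ i) \<bullet> (?z - x $ j)"
      by (simp add: inner_vec_def)
    also have "\<dots> = ?r * ?r + (\<Sum>l\<in>- {k0}. (\<alpha> $ l - coord i l) * (\<alpha> $ l - coord j l))"
      unfolding r2 by (rule inner_point_minus_x)
    also have "\<dots> = (\<Sum>l\<in>UNIV. jac ?r 1 (reduced \<alpha> \<beta>) $ i $ l * jac ?r 1 (reduced \<alpha> \<beta>) $ j $ l)"
      by (simp add: sum_split_k0 jac_def reduced_def)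
    also have "\<dots> / (?t $ i * ?t $ j) = (Q ** transpose Q) $ i $ j"
      by (simp add: matrix_matrix_mult_def transpose_def Q_def sum_divide_distrib)
    finally show "(J ** transpose J) $ i $ j = (Q ** transpose Q) $ i $ j" .
  qed
  then have "D_fun x ?z = sqrt ((det Q)\<^sup>2)"
    by (simp add: D_fun_def jac det_mul det_transpose power2_eq_square)
  also have "\<dots> = \<bar>det Q\<bar>" by simp
  also have "det Q = (\<Prod>j\<in>UNIV. 1 / ?t $ j) * det (jac ?r 1 (reduced \<alpha> \<beta>))"
    unfolding Q_def by (subst det_rows_mul) (simp add: vec_lambda_eta)
  also have "\<bar>\<dots>\<bar> = (\<Prod>j\<in>UNIV. 1 / ?t $ j) * (?r * simplex_vol)"
  proof -
    have "\<bar>\<Prod>j\<in>UNIV. 1 / ?t $ j\<bar> = (\<Prod>j\<in>UNIV. 1 / ?t $ j)"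
      using tp by (intro abs_of_nonneg prod_nonneg) (auto intro: less_imp_le)
    then show ?thesis using \<xi> by (simp add: abs_mult abs_det_jac)
  qed
  finally show ?thesis by (simp add: prod_dividef)
qed

text \<open>
  The sphere consists of two hemispheres and a null equator.  On each hemisphere the surface density
  \<open>r / height\<close> is \<open>2 r\<close> times \<open>sheet_density\<close>, and \<open>D_fun\<close> is constant by \<open>D_fun_point\<close>; the radius cancels.
\<close>

lemma avg_op_fiber:
  assumes \<xi>: "0 < \<xi> $ k0" and fm: "f \<in> borel_measurable borel"
    and int: "\<And>\<sigma>. \<sigma> = 1 \<or> \<sigma> = - 1 \<Longrightarrow> integrable lborel (\<lambda>\<beta>. sheet_density \<xi> \<beta> *\<^sub>R f (sheet \<sigma> \<xi> \<beta>))"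
  shows "avg_op (\<tau> \<xi>) f x = (2 * (\<Prod>j\<in>UNIV. \<tau> \<xi> $ j) / simplex_vol) *\<^sub>R (fiber f 1 \<xi> + fiber f (- 1) \<xi>)"
proof -
  let ?r = "sqrt (\<xi> $ k0)" and ?centre = "base + (\<Sum>l\<in>- {k0}. \<xi> $ l *\<^sub>R e l)"
  let ?H = "hausdorff_measure CARD('m) :: (real ^ 'n) measure"
  have r: "0 < ?r" "?r\<^sup>2 = \<xi> $ k0" using \<xi> by auto
  have hemi: "hemisphere E (e k0) ?r \<sigma>" if "\<sigma> = 1 \<or> \<sigma> = - 1" for \<sigma>
    by (rule hemisphere.intro) (use linE normE eE ee r that in \<open>auto simp: norm_eq_1\<close>)
  have G: "hemisphere.graph E (e k0) ?centre ?r \<sigma> = sheet \<sigma> \<xi>" if s: "\<sigma> = 1 \<or> \<sigma> = - 1" for \<sigma>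
  proof
    fix \<beta>
    have "(\<Sum>l\<in>- {k0}. lift \<sigma> \<xi> \<beta> $ l *\<^sub>R e l) = (\<Sum>l\<in>- {k0}. \<xi> $ l *\<^sub>R e l)"
      by (intro sum.cong) (auto simp: lift_def)
    then show "hemisphere.graph E (e k0) ?centre ?r \<sigma> \<beta> = sheet \<sigma> \<xi> \<beta>"
      by (simp add: hemisphere.graph_def[OF hemi[OF s]] hemisphere.height_def[OF hemi[OF s]] r(2) sheet_def point_def sum_split_k0)
         (simp add: lift_def)
  qed
  have ball: "\<beta> \<in> ball 0 ?r \<longleftrightarrow> (norm \<beta>)\<^sup>2 < \<xi> $ k0" for \<beta> :: "real ^ 'm"
    using r by (metis dist_0_norm dist_commute mem_ball norm_ge_zero power2_less_imp_less power_strict_mono less_imp_le pos2 r(2))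
  have Jw: "hemisphere.stretch ?r \<beta> * indicator (ball 0 ?r) \<beta> = (2 * ?r) * sheet_density \<xi> \<beta>" for \<beta> :: "real ^ 'm"
    using ball[of \<beta>] by (simp add: hemisphere.stretch_def[OF hemi[of 1, simplified]] hemisphere.height_def[OF hemi[of 1, simplified]] r(2) sheet_density_def indicator_def)
  define S where "S \<sigma> = sheet \<sigma> \<xi> ` ball 0 ?r" for \<sigma>
  have intS: "(LINT y : S \<sigma> | ?H. f y) = (2 * ?r) *\<^sub>R fiber f \<sigma> \<xi>" "set_integrable ?H (S \<sigma>) f" if s: "\<sigma> = 1 \<or> \<sigma> = - 1" for \<sigma>
  proof -
    interpret h: hemisphere E "e k0" ?centre ?r \<sigma> by (rule hemi[OF s])
    have eq: "(h.stretch \<beta> * indicator (ball 0 ?r) \<beta>) *\<^sub>R f (h.graph \<beta>) = (2 * ?r) *\<^sub>R (sheet_density \<xi> \<beta> *\<^sub>R f (sheet \<sigma> \<xi> \<beta>))" for \<beta>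
      by (simp only: Jw G[OF s] scaleR_scaleR)
    have SG: "S \<sigma> = h.graph ` ball 0 ?r" by (simp only: S_def G[OF s])
    have "(LINT y : S \<sigma> | ?H. f y) = (LINT \<beta>|lborel. (h.stretch \<beta> * indicator (ball 0 ?r) \<beta>) *\<^sub>R f (h.graph \<beta>))"
      unfolding SG by (rule h.integral_hemisphere(1)[OF fm])
    also have "\<dots> = (LINT \<beta>|lborel. (2 * ?r) *\<^sub>R (sheet_density \<xi> \<beta> *\<^sub>R f (sheet \<sigma> \<xi> \<beta>)))" by (simp only: eq)
    also have "\<dots> = (2 * ?r) *\<^sub>R fiber f \<sigma> \<xi>" unfolding fiber_def by (rule integral_scaleR_right) 
    finally show "(LINT y : S \<sigma> | ?H. f y) = (2 * ?r) *\<^sub>R fiber f \<sigma> \<xi>" .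
    have "integrable lborel (\<lambda>\<beta>. (h.stretch \<beta> * indicator (ball 0 ?r) \<beta>) *\<^sub>R f (h.graph \<beta>))"
      unfolding eq using int[OF s] by (rule integrable_scaleR_right)
    then show "set_integrable ?H (S \<sigma>) f"
      unfolding SG using h.integral_hemisphere(2)[OF fm] by blast
  qed
  define S0 where "S0 = (\<lambda>u. ?centre + E u) ` sphere 0 ?r"
  have SB: "S \<sigma> \<in> sets borel" if s: "\<sigma> = 1 \<or> \<sigma> = - 1" for \<sigma>
    using hemisphere.graph_image_borel[OF hemi[OF s], of "ball 0 ?r" ?centre] unfolding S_def G[OF s] by simp
  have S0B: "S0 \<in> sets borel"
  proof -
    have "compact S0" unfolding S0_def
      by (intro compact_continuous_image continuous_intros continuous_E) auto
    then show ?thesis by (simp add: borel_closed compact_imp_closed)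
  qed
  have "emeasure ?H S0 = 0"
    using hemisphere.equator_null[OF hemi[of 1, simplified], of ?centre] S0B by (simp add: emeasure_hausdorff_measure S0_def)
  then have S0n: "S0 \<in> null_sets ?H" using S0B by (simp add: null_sets_def)
  \<comment> \<open>The hemispheres lie strictly on different sides of the hyperplane normal to \<open>e k0\<close> through the base point.\<close>
  have disj: "S 1 \<inter> S (- 1) = {}"
  proof -
    have "S 1 \<subseteq> half_space 1" "S (- 1) \<subseteq> half_space (- 1)"
      using ball by (auto simp: S_def sheet_def point_in_half_space lift_def)
    moreover have "half_space 1 \<inter> half_space (- 1) = {}" by (auto simp: half_space_def)
    ultimately show ?thesis by blast
  qed
  have sph: "sph x (\<tau> \<xi>) = (S 1 \<union> S (- 1)) \<union> S0"
  proof (intro equalityI subsetI)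
    fix z assume z: "z \<in> sph x (\<tau> \<xi>)"
    obtain \<alpha> \<beta> where ab: "z = point \<alpha> \<beta>" by (rule point_surj)
    have x: "reduced \<alpha> \<beta> = \<xi>" using z mem_sph_iff[of \<xi> \<alpha> \<beta>] \<xi> by (simp add: ab)
    then have xk: "(\<alpha> $ k0)\<^sup>2 + (norm \<beta>)\<^sup>2 = \<xi> $ k0" and xl: "\<And>l. l \<noteq> k0 \<Longrightarrow> \<alpha> $ l = \<xi> $ l"
      by (auto simp: reduced_def)
    show "z \<in> (S 1 \<union> S (- 1)) \<union> S0"
    proof (cases "\<alpha> $ k0 = 0")
      case True
      then have "(norm \<beta>)\<^sup>2 = ?r\<^sup>2" using xk r by simp
      then have "norm \<beta> = ?r" by (rule power2_eq_imp_eq) (use r in auto)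
      moreover have "z = ?centre + E \<beta>"
      proof -
        have "(\<Sum>l\<in>- {k0}. \<alpha> $ l *\<^sub>R e l) = (\<Sum>l\<in>- {k0}. \<xi> $ l *\<^sub>R e l)" by (intro sum.cong) (auto simp: xl)
        then show ?thesis using True by (simp add: ab point_def sum_split_k0)
      qed
      ultimately show ?thesis by (auto simp: S0_def)
    next
      case False
      then have b: "(norm \<beta>)\<^sup>2 < \<xi> $ k0" using xk by (smt (verit) zero_less_power2)
      define \<sigma> :: real where "\<sigma> = sgn (\<alpha> $ k0)"
      have s: "\<sigma> = 1 \<or> \<sigma> = - 1" using False by (auto simp: \<sigma>_def sgn_if)
      have "\<xi> $ k0 - (norm \<beta>)\<^sup>2 = (\<alpha> $ k0)\<^sup>2" using xk by simp
      then have "lift \<sigma> \<xi> \<beta> = \<alpha>" using xl by (simp add: lift_def vec_eq_iff \<sigma>_def sgn_mult_abs)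
      then have "z = sheet \<sigma> \<xi> \<beta>" by (simp add: sheet_def ab)
      then have "z \<in> S \<sigma>" using b ball[of \<beta>] by (auto simp: S_def)
      then show ?thesis using s by auto
    qed
  next
    fix z assume "z \<in> (S 1 \<union> S (- 1)) \<union> S0"
    then consider \<sigma> where "\<sigma> = 1 \<or> \<sigma> = - 1" "z \<in> S \<sigma>" | "z \<in> S0" by blast
    then show "z \<in> sph x (\<tau> \<xi>)"
    proof cases
      case 1
      then obtain \<beta> where b: "\<beta> \<in> ball 0 ?r" "z = sheet \<sigma> \<xi> \<beta>" by (auto simp: S_def)
      then have "reduced (lift \<sigma> \<xi> \<beta>) \<beta> = \<xi>"
        using ball[of \<beta>] 1(1) by (auto simp: reduced_def lift_def vec_eq_iff)
      then show ?thesis using mem_sph_iff[of \<xi> "lift \<sigma> \<xi> \<beta>" \<beta>] \<xi> by (simp add: b sheet_def)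
    next
      case 2
      then obtain \<beta> where b: "norm \<beta> = ?r" "z = ?centre + E \<beta>" by (auto simp: S0_def)
      define \<alpha> :: "real ^ 'k" where "\<alpha> = (\<chi> l. if l = k0 then 0 else \<xi> $ l)"
      have "(\<Sum>l\<in>- {k0}. \<alpha> $ l *\<^sub>R e l) = (\<Sum>l\<in>- {k0}. \<xi> $ l *\<^sub>R e l)" by (intro sum.cong) (auto simp: \<alpha>_def)
      then have "z = point \<alpha> \<beta>" by (simp add: b point_def sum_split_k0) (simp add: \<alpha>_def)
      moreover have "reduced \<alpha> \<beta> = \<xi>" using b(1) r(2) by (simp add: reduced_def vec_eq_iff \<alpha>_def)
      ultimately show ?thesis using mem_sph_iff[of \<xi> \<alpha> \<beta>] \<xi> by simp
    qed
  qed
  define D where "D = ?r * simplex_vol / (\<Prod>j\<in>UNIV. \<tau> \<xi> $ j)"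
  have D: "D_fun x y = D" if "y \<in> sph x (\<tau> \<xi>)" for y
  proof -
    obtain \<alpha> \<beta> where ab: "y = point \<alpha> \<beta>" by (rule point_surj)
    then have "reduced \<alpha> \<beta> = \<xi>" using that mem_sph_iff[of \<xi> \<alpha> \<beta>] \<xi> by simp
    then show ?thesis using D_fun_point[of \<alpha> \<beta>] \<xi> by (simp add: ab D_def)
  qed
  have split: "(LINT y : sph x (\<tau> \<xi>) | ?H. f y) = (LINT y : S 1 | ?H. f y) + (LINT y : S (- 1) | ?H. f y)"
  proof -
    have iU: "set_integrable ?H (S 1 \<union> S (- 1)) f"
      using intS(2)[of 1] intS(2)[of "- 1"] SB[of 1] SB[of "- 1"] by (intro set_integrable_Un) auto
    have "(LINT y : sph x (\<tau> \<xi>) | ?H. f y) = (LINT y : S 1 \<union> S (- 1) | ?H. f y)"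
      unfolding set_lebesgue_integral_def
    proof (rule integral_cong_AE)
      have fH: "f \<in> borel_measurable ?H" using fm by (simp cong: measurable_cong_sets)
      have "sph x (\<tau> \<xi>) \<in> sets ?H" "S 1 \<union> S (- 1) \<in> sets ?H"
        using SB[of 1] SB[of "- 1"] S0B by (auto simp: sph)
      then show "(\<lambda>y. indicat_real (sph x (\<tau> \<xi>)) y *\<^sub>R f y) \<in> borel_measurable ?H"
        "(\<lambda>y. indicat_real (S 1 \<union> S (- 1)) y *\<^sub>R f y) \<in> borel_measurable ?H"
        using fH by (auto intro!: borel_measurable_scaleR borel_measurable_indicator)
      show "AE y in ?H. indicat_real (sph x (\<tau> \<xi>)) y *\<^sub>R f y = indicat_real (S 1 \<union> S (- 1)) y *\<^sub>R f y"
        by (rule AE_I'[OF S0n]) (auto simp: sph indicator_def)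
    qed
    also have "\<dots> = (LINT y : S 1 | ?H. f y) + (LINT y : S (- 1) | ?H. f y)"
      using intS(2)[of 1] intS(2)[of "- 1"] disj by (intro set_integral_Un) auto
    finally show ?thesis .
  qed
  have nm: "CARD('n) - CARD('k) = CARD('m)" using card by simp
  have "avg_op (\<tau> \<xi>) f x = (LINT y : sph x (\<tau> \<xi>) | ?H. f y / complex_of_real (D_fun x y))"
    using \<tau>_notin_C_Z[OF \<xi>] by (simp add: avg_op_def nm)
  also have "\<dots> = (LINT y : sph x (\<tau> \<xi>) | ?H. f y * complex_of_real (1 / D))"
    unfolding set_lebesgue_integral_def
    by (intro Bochner_Integration.integral_cong) (auto simp: indicator_def D)
  also have "\<dots> = (LINT y : sph x (\<tau> \<xi>) | ?H. f y) * complex_of_real (1 / D)"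
    by (rule set_integral_mult_left)
  also have "\<dots> = (1 / D) *\<^sub>R ((2 * ?r) *\<^sub>R fiber f 1 \<xi> + (2 * ?r) *\<^sub>R fiber f (- 1) \<xi>)"
    by (simp add: split intS(1) scaleR_conv_of_real mult_ac)
  also have "\<dots> = (2 * ?r / D) *\<^sub>R (fiber f 1 \<xi> + fiber f (- 1) \<xi>)" by (simp add: scaleR_add_right)
  also have "2 * ?r / D = 2 * (\<Prod>j\<in>UNIV. \<tau> \<xi> $ j) / simplex_vol" using r simplex_vol_pos by (simp add: D_def)
  finally show ?thesis .
qed

definition sq :: "real ^ 'k \<Rightarrow> real ^ 'k" where "sq t = (\<chi> j. (t $ j)\<^sup>2)"

lemma sqdist_inv_sq_\<tau>: "0 < \<xi> $ k0 \<Longrightarrow> sqdist_inv (sq (\<tau> \<xi>)) = \<xi>"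
proof -
  assume "0 < \<xi> $ k0"
  then have "sq (\<tau> \<xi>) = sqdist \<xi>" by (simp add: sq_def \<tau>_def vec_eq_iff sqdist_pos less_imp_le)
  then show ?thesis by simp
qed

lemma measurable_sqdist_inv_sq: "(\<lambda>t. sqdist_inv (sq t)) \<in> borel \<rightarrow>\<^sub>M borel"
proof -
  have "continuous_on UNIV sq" unfolding sq_def[abs_def] by (intro continuous_intros)
  from continuous_on_compose2[OF continuous_sqdist_inv this] show ?thesis by (intro borel_measurable_continuous_onI) simp
qed

lemma abs_det_scaled_rows:
  "\<bar>det (matrix (\<lambda>h. \<chi> j. \<rho> j * (jac 1 2 \<xi> *v h) $ j))\<bar> = (\<Prod>j\<in>UNIV. \<bar>\<rho> j\<bar>) * (2 ^ (CARD('k) - 1) * simplex_vol)"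
proof -
  have "(\<lambda>h. \<chi> j. \<rho> j * (jac 1 2 \<xi> *v h) $ j) = (\<lambda>h. (\<chi> j. \<rho> j *s jac 1 2 \<xi> $ j) *v h)"
    by (simp add: fun_eq_iff vec_eq_iff matrix_vector_mult_def sum_distrib_left mult.assoc)
  then have "matrix (\<lambda>h. \<chi> j. \<rho> j * (jac 1 2 \<xi> *v h) $ j) = (\<chi> j. \<rho> j *s jac 1 2 \<xi> $ j)"
    by (simp add: matrix_of_matrix_vector_mul)
  then have "det (matrix (\<lambda>h. \<chi> j. \<rho> j * (jac 1 2 \<xi> *v h) $ j)) = (\<Prod>j\<in>UNIV. \<rho> j) * det (jac 1 2 \<xi>)"
    by (simp add: det_rows_mul vec_lambda_eta)
  then show ?thesis by (simp add: abs_mult abs_det_jac abs_prod)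
qed

lemma sqdist_component_derivative: "((\<lambda>\<xi>. sqdist \<xi> $ j) has_derivative (\<lambda>h. (jac 1 2 \<xi> *v h) $ j)) (at \<xi>)"
  using has_derivative_compose[OF sqdist_has_derivative bounded_linear_imp_has_derivative[OF bounded_linear_vec_nth[of j]]] by simp

text \<open>
  By \<open>abs_det_scaled_rows\<close>: the squared distances contribute \<open>2\<^sup>k\<^sup>-\<^sup>1 V\<close>, and taking roots divides the row \<open>j\<close> by
  \<open>2 \<tau>\<^sub>j\<close>.
\<close>

lemma nn_integral_\<tau>:
  assumes F: "F \<in> borel_measurable borel"
  shows "(\<integral>\<^sup>+t. F t * indicator (\<tau> ` {\<xi>. 0 < \<xi> $ k0}) t \<partial>lborel) =
    (\<integral>\<^sup>+\<xi>. ennreal (simplex_vol / (2 * (\<Prod>j\<in>UNIV. \<tau> \<xi> $ j))) * F (\<tau> \<xi>) * indicator {\<xi>. 0 < \<xi> $ k0} \<xi> \<partial>lborel)"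
proof (rule nn_integral_change_of_variables[where g' = "\<lambda>\<xi> h. \<chi> j. (1 / (2 * \<tau> \<xi> $ j)) * (jac 1 2 \<xi> *v h) $ j"])
  show "open {\<xi> :: real ^ 'k. 0 < \<xi> $ k0}" by (intro open_Collect_less continuous_intros)
  show "inj_on \<tau> {\<xi>. 0 < \<xi> $ k0}"
    by (rule inj_on_inverseI[of _ "\<lambda>t. sqdist_inv (sq t)"]) (simp add: sqdist_inv_sq_\<tau>)
  have ct: "continuous_on UNIV \<tau>"
    unfolding \<tau>_def[abs_def]
    by (intro continuous_on_vec_lambda continuous_on_real_sqrt continuous_on_component continuous_sqdist)
  then show tm: "\<tau> \<in> borel \<rightarrow>\<^sub>M borel" by (rule borel_measurable_continuous_onI)
  have "continuous_on UNIV (\<lambda>\<xi>. 2 * (\<Prod>j\<in>UNIV. \<tau> \<xi> $ j))"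
    by (intro continuous_intros continuous_on_component ct)
  then have "(\<lambda>\<xi>. 2 * (\<Prod>j\<in>UNIV. \<tau> \<xi> $ j)) \<in> borel_measurable borel" by (rule borel_measurable_continuous_onI)
  then show "(\<lambda>\<xi>. simplex_vol / (2 * (\<Prod>j\<in>UNIV. \<tau> \<xi> $ j))) \<in> borel_measurable borel" by measurable
  show "F \<in> borel_measurable borel" by fact
  fix \<xi> :: "real ^ 'k" assume "\<xi> \<in> {\<xi>. 0 < \<xi> $ k0}"
  then have \<xi>: "0 < \<xi> $ k0" by simp
  show "(\<tau> has_derivative (\<lambda>h. \<chi> j. 1 / (2 * \<tau> \<xi> $ j) * (jac 1 2 \<xi> *v h) $ j)) (at \<xi>)"
  proof (rule has_derivative_vecI)
    fix j
    have t: "(\<lambda>\<xi>. \<tau> \<xi> $ j) = (\<lambda>\<xi>. sqrt (sqdist \<xi> $ j))" by (simp add: \<tau>_def)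
    have d: "(\<lambda>h. (\<chi> j. 1 / (2 * \<tau> \<xi> $ j) * (jac 1 2 \<xi> *v h) $ j) $ j)
        = (\<lambda>h. (jac 1 2 \<xi> *v h) $ j * (inverse (sqrt (sqdist \<xi> $ j)) / 2))"
      by (rule ext) (simp add: \<tau>_def field_simps)
    show "((\<lambda>\<xi>. \<tau> \<xi> $ j) has_derivative (\<lambda>h. (\<chi> j. 1 / (2 * \<tau> \<xi> $ j) * (jac 1 2 \<xi> *v h) $ j) $ j)) (at \<xi>)"
      unfolding t d by (rule has_derivative_real_sqrt[OF sqdist_pos[OF \<xi>] sqdist_component_derivative])
  qed
  have tp: "0 < \<tau> \<xi> $ j" for j using sqdist_pos[OF \<xi>] by (simp add: \<tau>_def)
  have "(\<Prod>j\<in>UNIV. \<bar>1 / (2 * \<tau> \<xi> $ j)\<bar>) = 1 / (2 ^ CARD('k) * (\<Prod>j\<in>UNIV. \<tau> \<xi> $ j))"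
  proof -
    have "(\<Prod>j\<in>UNIV. \<bar>1 / (2 * \<tau> \<xi> $ j)\<bar>) = (\<Prod>j\<in>UNIV. 1 / (2 * \<tau> \<xi> $ j))" using tp by (intro prod.cong) (auto simp: less_imp_le)
    then show ?thesis by (simp add: prod_dividef prod.distrib)
  qed
  moreover have "(2::real) ^ CARD('k) = 2 * 2 ^ (CARD('k) - 1)" by (metis Suc_diff_1 power_Suc zero_less_card_finite)
  ultimately show "\<bar>det (matrix (\<lambda>h. \<chi> j. 1 / (2 * \<tau> \<xi> $ j) * (jac 1 2 \<xi> *v h) $ j))\<bar> = simplex_vol / (2 * (\<Prod>j\<in>UNIV. \<tau> \<xi> $ j))"
    unfolding abs_det_scaled_rows by simp
qed

text \<open>
  The frequency vector \<open>v\<close> that multiplies \<open>s\<close> in the phase, in terms of reduced coordinates: an affine function of each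
  squared distance.
\<close>

definition phase_vec :: "real ^ 'k \<Rightarrow> real ^ 'k" where
  "phase_vec \<xi> = (\<chi> j. (sqdist \<xi> $ j - (norm (x $ j))\<^sup>2) / (4 * (norm (x $ j))\<^sup>2))"

definition phase_vec_inv :: "real ^ 'k \<Rightarrow> real ^ 'k" where
  "phase_vec_inv v = sqdist_inv (\<chi> j. 4 * (norm (x $ j))\<^sup>2 * v $ j + (norm (x $ j))\<^sup>2)"

text \<open>
  The Jacobian determinant of \<open>phase_vec\<close>, which is constant.
\<close>

definition \<kappa> :: real where
  "\<kappa> = (\<Prod>j\<in>UNIV. 1 / (4 * (norm (x $ j))\<^sup>2)) * (2 ^ (CARD('k) - 1) * simplex_vol)"

context
  assumes x0: "\<And>j. x $ j \<noteq> 0"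
begin

lemma \<kappa>_pos: "0 < \<kappa>"
  unfolding \<kappa>_def using x0 simplex_vol_pos by (intro mult_pos_pos prod_pos) auto

lemma phase_vec_inv_phase_vec [simp]: "phase_vec_inv (phase_vec \<xi>) = \<xi>"
proof -
  have "(\<chi> j. 4 * (norm (x $ j))\<^sup>2 * phase_vec \<xi> $ j + (norm (x $ j))\<^sup>2) = sqdist \<xi>"
    using x0 by (simp add: phase_vec_def vec_eq_iff)
  then show ?thesis by (simp add: phase_vec_inv_def)
qed

lemma phase_vec_phase_vec_inv [simp]: "phase_vec (phase_vec_inv v) = v"
  using x0 by (simp add: phase_vec_inv_def phase_vec_def vec_eq_iff)

lemma continuous_phase_vec: "continuous_on UNIV phase_vec" and continuous_phase_vec_inv: "continuous_on UNIV phase_vec_inv"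
proof -
  show "continuous_on UNIV phase_vec"
    unfolding phase_vec_def[abs_def]
    by (intro continuous_on_vec_lambda continuous_intros continuous_on_component continuous_sqdist) (use x0 in simp)
  have "continuous_on UNIV (\<lambda>v :: real ^ 'k. \<chi> j. 4 * (norm (x $ j))\<^sup>2 * v $ j + (norm (x $ j))\<^sup>2)"
    by (intro continuous_on_vec_lambda continuous_intros)
  from continuous_on_compose2[OF continuous_sqdist_inv this] show "continuous_on UNIV phase_vec_inv"
    unfolding phase_vec_inv_def[abs_def] by simp
qed

lemma nn_integral_phase_vec:
  assumes F: "F \<in> borel_measurable borel"
  shows "(\<integral>\<^sup>+v. F v \<partial>lborel) = (\<integral>\<^sup>+\<xi>. ennreal \<kappa> * F (phase_vec \<xi>) \<partial>lborel)"
proof -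
  have "phase_vec ` UNIV = UNIV" using phase_vec_phase_vec_inv by (metis surjI)
  then have "(\<integral>\<^sup>+v. F v \<partial>lborel) = (\<integral>\<^sup>+v. F v * indicator (phase_vec ` UNIV) v \<partial>lborel)" by simp
  also have "\<dots> = (\<integral>\<^sup>+\<xi>. ennreal \<kappa> * F (phase_vec \<xi>) * indicator UNIV \<xi> \<partial>lborel)"
  proof (rule nn_integral_change_of_variables[where g' = "\<lambda>\<xi> h. \<chi> j. (1 / (4 * (norm (x $ j))\<^sup>2)) * (jac 1 2 \<xi> *v h) $ j"])
    show "inj phase_vec" by (metis injI phase_vec_inv_phase_vec)
    show "phase_vec \<in> borel \<rightarrow>\<^sub>M borel" by (rule borel_measurable_continuous_onI[OF continuous_phase_vec])
    show "F \<in> borel_measurable borel" by fact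
    show "(phase_vec has_derivative (\<lambda>h. \<chi> j. 1 / (4 * (norm (x $ j))\<^sup>2) * (jac 1 2 \<xi> *v h) $ j)) (at \<xi>)" for \<xi>
    proof (rule has_derivative_vecI)
      fix j
      have "((\<lambda>\<xi>. 1 / (4 * (norm (x $ j))\<^sup>2) * (sqdist \<xi> $ j - (norm (x $ j))\<^sup>2)) has_derivative
          (\<lambda>h. 1 / (4 * (norm (x $ j))\<^sup>2) * ((jac 1 2 \<xi> *v h) $ j - 0))) (at \<xi>)"
        by (intro has_derivative_mult_right has_derivative_diff sqdist_component_derivative has_derivative_const)
      then show "((\<lambda>\<xi>. phase_vec \<xi> $ j) has_derivative (\<lambda>h. (\<chi> j. 1 / (4 * (norm (x $ j))\<^sup>2) * (jac 1 2 \<xi> *v h) $ j) $ j)) (at \<xi>)"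
        by (simp add: phase_vec_def)
    qed
    show "\<bar>det (matrix (\<lambda>h. \<chi> j. 1 / (4 * (norm (x $ j))\<^sup>2) * (jac 1 2 \<xi> *v h) $ j))\<bar> = \<kappa>" for \<xi>
      unfolding abs_det_scaled_rows \<kappa>_def by simp
  qed auto
  finally show ?thesis by simp
qed

lemma distr_phase_vec: "distr (density lborel (\<lambda>_. ennreal \<kappa>)) borel phase_vec = lborel"
proof (rule measure_eqI)
  fix A assume "A \<in> sets (distr (density lborel (\<lambda>_. ennreal \<kappa>)) borel phase_vec)"
  then have A: "A \<in> sets borel" by simp
  have um: "phase_vec \<in> borel \<rightarrow>\<^sub>M borel" by (rule borel_measurable_continuous_onI[OF continuous_phase_vec])
  have "emeasure lborel A = (\<integral>\<^sup>+v. indicator A v \<partial>lborel)" using A by simp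
  also have "\<dots> = (\<integral>\<^sup>+\<xi>. ennreal \<kappa> * indicator A (phase_vec \<xi>) \<partial>lborel)"
    by (rule nn_integral_phase_vec) (use A in simp)
  also have "\<dots> = (\<integral>\<^sup>+\<xi>. indicator A (phase_vec \<xi>) \<partial>density lborel (\<lambda>_. ennreal \<kappa>))"
    by (rule nn_integral_density[symmetric]) (use A um in measurable)
  also have "\<dots> = (\<integral>\<^sup>+v. indicator A v \<partial>distr (density lborel (\<lambda>_. ennreal \<kappa>)) borel phase_vec)"
    by (rule nn_integral_distr[symmetric]) (use A um in simp_all)
  finally show "emeasure (distr (density lborel (\<lambda>_. ennreal \<kappa>)) borel phase_vec) A = emeasure lborel A" using A by simp
qed simp

lemma integral_phase_vec:
  fixes F :: "real ^ 'k \<Rightarrow> complex"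
  assumes F: "F \<in> borel_measurable borel"
  shows "(LINT v|lborel. F v) = (LINT \<xi>|lborel. \<kappa> *\<^sub>R F (phase_vec \<xi>))"
    and "integrable lborel F \<longleftrightarrow> integrable lborel (\<lambda>\<xi>. \<kappa> *\<^sub>R F (phase_vec \<xi>))"
proof -
  have um: "phase_vec \<in> borel \<rightarrow>\<^sub>M borel" by (rule borel_measurable_continuous_onI[OF continuous_phase_vec])
  then have um': "phase_vec \<in> density lborel (\<lambda>_. ennreal \<kappa>) \<rightarrow>\<^sub>M borel" by simp
  have Fu: "(\<lambda>\<xi>. F (phase_vec \<xi>)) \<in> borel_measurable lborel" using measurable_compose[OF um F] by simp
  have "(LINT v|lborel. F v) = integral\<^sup>L (density lborel (\<lambda>_. ennreal \<kappa>)) (\<lambda>\<xi>. F (phase_vec \<xi>))"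
    by (subst distr_phase_vec[symmetric]) (rule integral_distr[OF um' F])
  also have "\<dots> = (LINT \<xi>|lborel. \<kappa> *\<^sub>R F (phase_vec \<xi>))"
    by (rule integral_density[OF Fu]) (use \<kappa>_pos in auto)
  finally show "(LINT v|lborel. F v) = (LINT \<xi>|lborel. \<kappa> *\<^sub>R F (phase_vec \<xi>))" .
  have "integrable lborel F \<longleftrightarrow> integrable (density lborel (\<lambda>_. ennreal \<kappa>)) (\<lambda>\<xi>. F (phase_vec \<xi>))"
    by (subst distr_phase_vec[symmetric]) (rule integrable_distr_eq[OF um' F])
  also have "\<dots> \<longleftrightarrow> integrable lborel (\<lambda>\<xi>. \<kappa> *\<^sub>R F (phase_vec \<xi>))"
    by (rule integrable_density[OF Fu]) (use \<kappa>_pos in auto)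
  finally show "integrable lborel F \<longleftrightarrow> integrable lborel (\<lambda>\<xi>. \<kappa> *\<^sub>R F (phase_vec \<xi>))" .
qed

text \<open>
  The phase of the extension operator at \<open>\<Sum>\<^sub>j s\<^sub>j \<pi>\<^sup>-\<^sup>1(x\<^sub>j)\<close> after completing the squares; see \<open>extension_op_eq\<close>.
\<close>

definition phase :: "real ^ 'k \<Rightarrow> real ^ 'n \<Rightarrow> real" where
  "phase s z = (\<Sum>j\<in>UNIV. s $ j * (((norm (x $ j - z))\<^sup>2 - (norm (x $ j))\<^sup>2) / (4 * (norm (x $ j))\<^sup>2)))"

lemma phase_sheet:
  assumes \<sigma>: "\<sigma> = 1 \<or> \<sigma> = - 1" and b: "(norm \<beta>)\<^sup>2 < \<xi> $ k0"
  shows "phase s (sheet \<sigma> \<xi> \<beta>) = phase_vec \<xi> \<bullet> s"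
proof -
  have "reduced (lift \<sigma> \<xi> \<beta>) \<beta> = \<xi>"
    using b \<sigma> by (auto simp: lift_def reduced_def vec_eq_iff power_mult_distrib)
  then have "(norm (x $ j - sheet \<sigma> \<xi> \<beta>))\<^sup>2 = sqdist \<xi> $ j" for j by (simp add: sheet_def dist_point)
  then show ?thesis by (simp add: phase_def phase_vec_def inner_vec_def mult.commute)
qed

lemma extension_op_eq:
  assumes f0: "\<And>z. z \<notin> ball 0 1 \<Longrightarrow> f z = 0"
  shows "extension_op f (\<Sum>j\<in>UNIV. s $ j *\<^sub>R pi_inv (x $ j)) = (LINT z|lborel. f z * cis (2 * pi * phase s z))"
proof -
  let ?p = "\<Sum>j\<in>UNIV. s $ j *\<^sub>R pi_inv (x $ j)"
  have ph: "fst ?p \<bullet> z + snd ?p * (norm z)\<^sup>2 = phase s z" for z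
  proof -
    have "fst ?p \<bullet> z + snd ?p * (norm z)\<^sup>2 = (\<Sum>j\<in>UNIV. s $ j * ((- 1 / (2 * (norm (x $ j))\<^sup>2)) * (x $ j \<bullet> z)) + s $ j * (1 / (4 * (norm (x $ j))\<^sup>2)) * (norm z)\<^sup>2)"
    proof -
      have "fst ?p \<bullet> z = (\<Sum>j\<in>UNIV. s $ j * ((- 1 / (2 * (norm (x $ j))\<^sup>2)) * (x $ j \<bullet> z)))"
        unfolding fst_sum inner_sum_left by (simp add: pi_inv_def)
      moreover have "snd ?p * (norm z)\<^sup>2 = (\<Sum>j\<in>UNIV. s $ j * (1 / (4 * (norm (x $ j))\<^sup>2)) * (norm z)\<^sup>2)"
        unfolding snd_sum sum_distrib_right by (simp add: pi_inv_def)
      ultimately show ?thesis by (simp only: sum.distrib)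
    qed
    also have "\<dots> = phase s z"
      unfolding phase_def
    proof (rule sum.cong)
      fix j
      have n: "norm (x $ j) \<noteq> 0" using x0 by simp
      have h: "(norm (x $ j - z))\<^sup>2 = (norm (x $ j))\<^sup>2 - 2 * (x $ j \<bullet> z) + (norm z)\<^sup>2"
        by (simp add: power2_norm_eq_inner inner_diff_left inner_diff_right inner_commute)
      show "s $ j * ((- 1 / (2 * (norm (x $ j))\<^sup>2)) * (x $ j \<bullet> z)) + s $ j * (1 / (4 * (norm (x $ j))\<^sup>2)) * (norm z)\<^sup>2
          = s $ j * (((norm (x $ j - z))\<^sup>2 - (norm (x $ j))\<^sup>2) / (4 * (norm (x $ j))\<^sup>2))"
        unfolding h using n by (simp add: field_simps)
    qed simp
    finally show ?thesis .
  qed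
  have cis: "exp (2 * complex_of_real pi * \<i> * complex_of_real r) = cis (2 * pi * r)" for r
    by (simp add: cis_conv_exp mult_ac)
  have "extension_op f ?p = (LINT z : ball 0 1 | lborel. f z * cis (2 * pi * phase s z))"
    unfolding extension_op_def case_prod_beta ph cis by (rule refl)
  also have "\<dots> = (LINT z|lborel. f z * cis (2 * pi * phase s z))"
    unfolding set_lebesgue_integral_def
    by (intro Bochner_Integration.integral_cong) (auto simp: indicator_def f0)
  finally show ?thesis .
qed

text \<open>
  Write \<open>K\<close> for the density in reduced coordinates and \<open>g\<close> for the density in the phase variable, so that
  \<open>K = \<kappa> g\<close>.  The right-hand side is \<open>\<integral> |g|\<^sup>2 dv = \<integral> |K|\<^sup>2 / \<kappa> d\<xi>\<close> by Plancherel.  On the left, \<open>\<A>\<^sub>t f = (2 \<Prod> t\<^sub>j / V) K\<close> and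
  \<open>dt = V / (2 \<Prod> t\<^sub>j) d\<xi>\<close>, so the integrand becomes \<open>(2 \<Prod> t\<^sub>j / V) W |K|\<^sup>2\<close>, and \<open>W\<close> is the weight
  for which the first two factors multiply to \<open>1 / \<kappa>\<close>.
\<close>

theorem averages_extension_identity:
  assumes f: "integrable lborel f" and fm: "f \<in> borel_measurable borel" and f0: "\<And>z. z \<notin> ball 0 1 \<Longrightarrow> f z = 0"
  shows "(\<integral>\<^sup>+ t \<in> pos_orthant. ennreal ((cmod (avg_op t f x))\<^sup>2 * weight x t) \<partial>lborel) =
         (\<integral>\<^sup>+ s. ennreal ((cmod (extension_op f (\<Sum>j\<in>UNIV. s $ j *\<^sub>R pi_inv (x $ j))))\<^sup>2) \<partial>(lborel :: (real ^ 'k) measure))"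
proof -
  define K where "K \<xi> = fiber f 1 \<xi> + fiber f (- 1) \<xi>" for \<xi>
  have Ki: "integrable lborel K" unfolding K_def[abs_def] by (intro Bochner_Integration.integrable_add fiber_integrable f) auto
  then have Km [measurable]: "K \<in> borel_measurable borel" by auto
  \<comment> \<open>The squared distance to the affine span is nonnegative, so the image measure lives on \<open>\<xi>\<^sub>k\<^sub>0 > 0\<close>.\<close>
  have K0: "K \<xi> = 0" if "\<not> 0 < \<xi> $ k0" for \<xi>
  proof -
    have "sheet_density \<xi> \<beta> = 0" for \<beta> using that by (auto simp: sheet_density_def) (smt (verit) zero_le_power2)
    then show ?thesis by (simp add: K_def fiber_def)
  qed
  define g where "g v = (1 / \<kappa>) *\<^sub>R K (phase_vec_inv v)" for v
  have uim: "phase_vec_inv \<in> borel \<rightarrow>\<^sub>M borel" by (rule borel_measurable_continuous_onI[OF continuous_phase_vec_inv])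
  have gm [measurable]: "g \<in> borel_measurable borel"
    unfolding g_def[abs_def] using measurable_compose[OF uim Km] by (intro borel_measurable_scaleR) auto
  have gu: "\<kappa> *\<^sub>R g (phase_vec \<xi>) = K \<xi>" for \<xi> using \<kappa>_pos by (simp add: g_def)
  have gi: "integrable lborel g" using integral_phase_vec(2)[OF gm] Ki by (simp add: gu)
  have ext: "extension_op f (\<Sum>j\<in>UNIV. s $ j *\<^sub>R pi_inv (x $ j)) = fourier g s" for s :: "real ^ 'k"
  proof -
    let ?F = "\<lambda>z. f z * cis (2 * pi * phase s z)"
    have pm [measurable]: "phase s \<in> borel_measurable borel" unfolding phase_def[abs_def] by measurable
    have Fi: "integrable lborel ?F"
      by (rule Bochner_Integration.integrable_bound[OF f]) (use fm in \<open>auto simp: norm_mult\<close>)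
    \<comment> \<open>The phase is constant on fibres and can be taken out of the fibre integral.\<close>
    have fib: "fiber ?F \<sigma> \<xi> = fiber f \<sigma> \<xi> * cis (2 * pi * (phase_vec \<xi> \<bullet> s))" if s: "\<sigma> = 1 \<or> \<sigma> = - 1" for \<sigma> \<xi>
    proof -
      have "sheet_density \<xi> \<beta> *\<^sub>R ?F (sheet \<sigma> \<xi> \<beta>) = (sheet_density \<xi> \<beta> *\<^sub>R f (sheet \<sigma> \<xi> \<beta>)) * cis (2 * pi * (phase_vec \<xi> \<bullet> s))" for \<beta>
        using phase_sheet[OF s, of \<beta> \<xi>] by (cases "(norm \<beta>)\<^sup>2 < \<xi> $ k0") (auto simp: sheet_density_def)
      then show ?thesis unfolding fiber_def by (simp only: integral_mult_left_zero)
    qed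
    have "extension_op f (\<Sum>j\<in>UNIV. s $ j *\<^sub>R pi_inv (x $ j)) = (LINT z|lborel. ?F z)"
      by (rule extension_op_eq[OF f0])
    also have "\<dots> = (LINT \<xi>|lborel. fiber ?F 1 \<xi> + fiber ?F (- 1) \<xi>)" by (rule integral_fibers[OF Fi])
    also have "\<dots> = (LINT \<xi>|lborel. K \<xi> * cis (2 * pi * (phase_vec \<xi> \<bullet> s)))"
      by (simp add: fib K_def distrib_right)
    also have "\<dots> = (LINT \<xi>|lborel. \<kappa> *\<^sub>R (g (phase_vec \<xi>) * cis (2 * pi * (phase_vec \<xi> \<bullet> s))))"
      by (simp flip: gu)
    also have "\<dots> = (LINT v|lborel. g v * cis (2 * pi * (v \<bullet> s)))"
      by (rule integral_phase_vec(1)[symmetric]) measurable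
    finally show ?thesis by (simp add: fourier_def)
  qed
  have "(\<integral>\<^sup>+ s. ennreal ((cmod (extension_op f (\<Sum>j\<in>UNIV. s $ j *\<^sub>R pi_inv (x $ j))))\<^sup>2) \<partial>(lborel :: (real ^ 'k) measure))
      = (\<integral>\<^sup>+ v. ennreal ((cmod (g v))\<^sup>2) \<partial>lborel)"
    unfolding ext by (rule plancherel_L1[OF gi])
  also have "\<dots> = (\<integral>\<^sup>+ \<xi>. ennreal \<kappa> * ennreal ((cmod (g (phase_vec \<xi>)))\<^sup>2) \<partial>lborel)"
    by (rule nn_integral_phase_vec) measurable
  also have "\<dots> = (\<integral>\<^sup>+ \<xi>. ennreal ((cmod (K \<xi>))\<^sup>2 / \<kappa>) * indicator {\<xi>. 0 < \<xi> $ k0} \<xi> \<partial>lborel)"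
  proof (intro nn_integral_cong)
    fix \<xi>
    have "g (phase_vec \<xi>) = (1 / \<kappa>) *\<^sub>R K \<xi>" by (simp add: g_def)
    then have "\<kappa> * (cmod (g (phase_vec \<xi>)))\<^sup>2 = (cmod (K \<xi>))\<^sup>2 / \<kappa>"
      using \<kappa>_pos by (simp add: power_divide power2_eq_square field_simps)
    then have "ennreal \<kappa> * ennreal ((cmod (g (phase_vec \<xi>)))\<^sup>2) = ennreal ((cmod (K \<xi>))\<^sup>2 / \<kappa>)"
      using \<kappa>_pos by (simp flip: ennreal_mult)
    then show "ennreal \<kappa> * ennreal ((cmod (g (phase_vec \<xi>)))\<^sup>2) = ennreal ((cmod (K \<xi>))\<^sup>2 / \<kappa>) * indicator {\<xi>. 0 < \<xi> $ k0} \<xi>"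
      using K0[of \<xi>] by (auto simp: indicator_def)
  qed
  finally have rhs: "(\<integral>\<^sup>+ s. ennreal ((cmod (extension_op f (\<Sum>j\<in>UNIV. s $ j *\<^sub>R pi_inv (x $ j))))\<^sup>2) \<partial>(lborel :: (real ^ 'k) measure))
      = (\<integral>\<^sup>+ \<xi>. ennreal ((cmod (K \<xi>))\<^sup>2 / \<kappa>) * indicator {\<xi>. 0 < \<xi> $ k0} \<xi> \<partial>lborel)" .

  let ?T = "\<tau> ` {\<xi>. 0 < \<xi> $ k0}"
  \<comment> \<open>The average, as a Borel function of \<open>t\<close> built from \<open>K\<close>; it is the true average for almost every \<open>t\<close>.\<close>
  define A where "A t = (2 * (\<Prod>j\<in>UNIV. t $ j) / simplex_vol) *\<^sub>R K (sqdist_inv (sq t))" for t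
  define \<Phi> where "\<Phi> t = ennreal ((cmod (A t))\<^sup>2 * weight x t)" for t
  have Koim [measurable]: "(\<lambda>t. K (sqdist_inv (sq t))) \<in> borel_measurable borel"
    by (rule measurable_compose[OF measurable_sqdist_inv_sq Km])
  have cp: "continuous_on UNIV (\<lambda>t :: real ^ 'k. \<Prod>j\<in>UNIV. t $ j)" by (intro continuous_intros)
  have pm [measurable]: "(\<lambda>t :: real ^ 'k. \<Prod>j\<in>UNIV. t $ j) \<in> borel_measurable borel"
    by (rule borel_measurable_continuous_onI[OF cp])
  have \<Phi>m: "\<Phi> \<in> borel_measurable borel"
    unfolding \<Phi>_def[abs_def] A_def weight_def by measurable
  have tpos: "0 < \<tau> \<xi> $ j" if "0 < \<xi> $ k0" for \<xi> j using sqdist_pos[OF that] by (simp add: \<tau>_def)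
  have Tpos: "?T \<subseteq> pos_orthant" using tpos by (auto simp: pos_orthant_def)
  have good: "AE \<xi> in lborel. \<forall>\<sigma>. \<sigma> = 1 \<or> \<sigma> = - 1 \<longrightarrow> integrable lborel (\<lambda>\<beta>. sheet_density \<xi> \<beta> *\<^sub>R f (sheet \<sigma> \<xi> \<beta>))"
  proof -
    have "AE \<xi> in lborel. integrable lborel (\<lambda>\<beta>. sheet_density \<xi> \<beta> *\<^sub>R f (sheet 1 \<xi> \<beta>))"
      "AE \<xi> in lborel. integrable lborel (\<lambda>\<beta>. sheet_density \<xi> \<beta> *\<^sub>R f (sheet (- 1) \<xi> \<beta>))"
      by (rule fiber_integrable(2)[OF _ f]; simp)+
    then show ?thesis by eventually_elim auto
  qed
  \<comment> \<open>The set \<open>N\<close> contains the \<open>\<xi>\<close> over which the integral along the fibre may fail to exist; its image under \<open>\<tau>\<close> is null as well.\<close>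
  obtain N where N0: "N \<in> null_sets lborel"
      "\<And>\<xi>. \<xi> \<in> space lborel - N \<Longrightarrow> \<forall>\<sigma>. \<sigma> = 1 \<or> \<sigma> = - 1 \<longrightarrow> integrable lborel (\<lambda>\<beta>. sheet_density \<xi> \<beta> *\<^sub>R f (sheet \<sigma> \<xi> \<beta>))"
    by (rule AE_E3[OF good]) (rule that)
  have N: "N \<in> null_sets lborel"
      "\<And>\<xi> \<sigma>. \<xi> \<notin> N \<Longrightarrow> \<sigma> = 1 \<or> \<sigma> = - 1 \<Longrightarrow> integrable lborel (\<lambda>\<beta>. sheet_density \<xi> \<beta> *\<^sub>R f (sheet \<sigma> \<xi> \<beta>))"
    by (rule N0(1)) (rule N0(2)[THEN spec, THEN mp], simp_all)
  have NB [measurable]: "N \<in> sets borel" using N(1) by auto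
  have ae: "AE t in lborel. t \<in> ?T \<longrightarrow> sqdist_inv (sq t) \<notin> N"
  proof -
    have iN: "(\<lambda>t. indicator N (sqdist_inv (sq t)) :: ennreal) \<in> borel_measurable borel"
      by (rule measurable_compose[OF measurable_sqdist_inv_sq]) measurable
    have "AE \<xi> in lborel. \<xi> \<notin> N" using N(1) by (rule AE_not_in)
    then have "(\<integral>\<^sup>+\<xi>. ennreal (simplex_vol / (2 * (\<Prod>j\<in>UNIV. \<tau> \<xi> $ j))) * indicator N (sqdist_inv (sq (\<tau> \<xi>))) * indicator {\<xi>. 0 < \<xi> $ k0} \<xi> \<partial>lborel) = (\<integral>\<^sup>+\<xi>. 0 \<partial>(lborel :: (real ^ 'k) measure))"
    proof (rule nn_integral_cong_AE[OF eventually_mono])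
      fix \<xi> assume "\<xi> \<notin> N"
      then show "ennreal (simplex_vol / (2 * (\<Prod>j\<in>UNIV. \<tau> \<xi> $ j))) * indicator N (sqdist_inv (sq (\<tau> \<xi>))) * indicator {\<xi>. 0 < \<xi> $ k0} \<xi> = 0"
        by (cases "0 < \<xi> $ k0") (simp_all add: sqdist_inv_sq_\<tau>)
    qed
    then have z: "(\<integral>\<^sup>+t. indicator N (sqdist_inv (sq t)) * indicator ?T t \<partial>lborel) = 0"
      using nn_integral_\<tau>[OF iN] by simp
    have TB: "?T \<in> sets borel"
    proof -
      \<comment> \<open>A description of the image by continuous functions shows that it is a Borel set.\<close>
      have "?T = {t. 0 < sqdist_inv (sq t) $ k0 \<and> \<tau> (sqdist_inv (sq t)) = t}"
      proof (intro equalityI subsetI)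
        fix t assume "t \<in> {t. 0 < sqdist_inv (sq t) $ k0 \<and> \<tau> (sqdist_inv (sq t)) = t}"
        then show "t \<in> ?T" by (intro image_eqI[of t \<tau> "sqdist_inv (sq t)"]) simp_all
      qed (auto simp: sqdist_inv_sq_\<tau>)
      moreover have "continuous_on UNIV (\<lambda>t. sqdist_inv (sq t))"
      proof -
        have "continuous_on UNIV sq" unfolding sq_def[abs_def] by (intro continuous_intros)
        from continuous_on_compose2[OF continuous_sqdist_inv this] show ?thesis by simp
      qed
      moreover have ct: "continuous_on UNIV \<tau>"
        unfolding \<tau>_def[abs_def] by (intro continuous_on_vec_lambda continuous_on_real_sqrt continuous_on_component continuous_sqdist)
      ultimately have cont: "continuous_on UNIV (\<lambda>t. sqdist_inv (sq t) $ k0)" "continuous_on UNIV (\<lambda>t. \<tau> (sqdist_inv (sq t)))"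
          and T: "?T = {t. 0 < sqdist_inv (sq t) $ k0 \<and> \<tau> (sqdist_inv (sq t)) = t}"
        using continuous_on_compose2[OF ct, of UNIV "\<lambda>t. sqdist_inv (sq t)"] by (simp_all add: continuous_on_component)
      have "open {t. 0 < sqdist_inv (sq t) $ k0}" by (rule open_Collect_less[OF continuous_on_const cont(1)])
      moreover have "closed {t. \<tau> (sqdist_inv (sq t)) = t}" by (rule closed_Collect_eq[OF cont(2) continuous_on_id])
      ultimately have "{t. 0 < sqdist_inv (sq t) $ k0} \<inter> {t. \<tau> (sqdist_inv (sq t)) = t} \<in> sets borel"
        by (intro sets.Int borel_open borel_closed)
      then show ?thesis unfolding T Collect_conj_eq .
    qed
    have "(\<lambda>t. indicator N (sqdist_inv (sq t)) * indicator ?T t :: ennreal) \<in> borel_measurable lborel"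
      using iN TB by (intro borel_measurable_times_ennreal) auto
    then have "AE t in lborel. indicator N (sqdist_inv (sq t)) * indicator ?T t = (0 :: ennreal)"
      using z by (subst (asm) nn_integral_0_iff_AE) auto
    then show ?thesis by eventually_elim (auto simp: indicator_def)
  qed
  have "(\<integral>\<^sup>+ t \<in> pos_orthant. ennreal ((cmod (avg_op t f x))\<^sup>2 * weight x t) \<partial>lborel) = (\<integral>\<^sup>+t. \<Phi> t * indicator ?T t \<partial>lborel)"
  proof (rule nn_integral_cong_AE)
    show "AE t in lborel. ennreal ((cmod (avg_op t f x))\<^sup>2 * weight x t) * indicator pos_orthant t = \<Phi> t * indicator ?T t"
      using ae
    proof eventually_elim
      case (elim t)
      show ?case
      proof (cases "t \<in> ?T")
        case True
        then obtain \<xi> where \<xi>: "0 < \<xi> $ k0" "t = \<tau> \<xi>" by blast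
        have o: "sqdist_inv (sq t) = \<xi>" using \<xi> by (simp add: sqdist_inv_sq_\<tau>)
        then have "\<xi> \<notin> N" using elim True by simp
        then have "avg_op (\<tau> \<xi>) f x = (2 * (\<Prod>j\<in>UNIV. \<tau> \<xi> $ j) / simplex_vol) *\<^sub>R (fiber f 1 \<xi> + fiber f (- 1) \<xi>)"
          by (intro avg_op_fiber[OF \<xi>(1) fm] N(2))
        then have "avg_op t f x = A t" by (simp add: A_def o \<xi>(2)[symmetric] K_def)
        then show ?thesis using True Tpos by (auto simp: \<Phi>_def indicator_def)
      next
        case False
        then show ?thesis by (cases "t \<in> pos_orthant") (simp_all add: avg_op_zero)
      qed
    qed
  qed
  also have "\<dots> = (\<integral>\<^sup>+\<xi>. ennreal (simplex_vol / (2 * (\<Prod>j\<in>UNIV. \<tau> \<xi> $ j))) * \<Phi> (\<tau> \<xi>) * indicator {\<xi>. 0 < \<xi> $ k0} \<xi> \<partial>lborel)"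
    by (rule nn_integral_\<tau>[OF \<Phi>m])
  also have "\<dots> = (\<integral>\<^sup>+ \<xi>. ennreal ((cmod (K \<xi>))\<^sup>2 / \<kappa>) * indicator {\<xi>. 0 < \<xi> $ k0} \<xi> \<partial>lborel)"
  proof (intro nn_integral_cong)
    fix \<xi>
    show "ennreal (simplex_vol / (2 * (\<Prod>j\<in>UNIV. \<tau> \<xi> $ j))) * \<Phi> (\<tau> \<xi>) * indicator {\<xi>. 0 < \<xi> $ k0} \<xi>
        = ennreal ((cmod (K \<xi>))\<^sup>2 / \<kappa>) * indicator {\<xi>. 0 < \<xi> $ k0} \<xi>"
    proof (cases "0 < \<xi> $ k0")
      case True
      define P where "P = (\<Prod>j\<in>UNIV. \<tau> \<xi> $ j)"
      define Q where "Q = (\<Prod>j\<in>UNIV. (norm (x $ j))\<^sup>2)"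
      define n where "n = (cmod (K \<xi>))\<^sup>2"
      have P: "0 < P" unfolding P_def using tpos[OF True] by (intro prod_pos) auto
      have Q: "0 < Q" unfolding Q_def using x0 by (intro prod_pos) auto
      have AA: "(cmod (A (\<tau> \<xi>)))\<^sup>2 = (2 * P / simplex_vol)\<^sup>2 * n"
        using P simplex_vol_pos by (simp add: A_def sqdist_inv_sq_\<tau>[OF True] P_def[symmetric] n_def power_mult_distrib power_divide)
      have W: "weight x (\<tau> \<xi>) = 2 ^ CARD('k) * Q / P" by (simp add: weight_def P_def Q_def)
      have k: "\<kappa> = 2 ^ (CARD('k) - 1) * simplex_vol / (4 ^ CARD('k) * Q)"
        by (simp add: \<kappa>_def Q_def prod_dividef prod.distrib)
      have c2: "(2::real) ^ CARD('k) = 2 * 2 ^ (CARD('k) - 1)" by (metis Suc_diff_1 power_Suc zero_less_card_finite)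
      have c4: "(4::real) ^ CARD('k) = 2 ^ CARD('k) * 2 ^ CARD('k)" by (simp flip: power_mult_distrib)
      have "simplex_vol / (2 * P) * ((2 * P / simplex_vol)\<^sup>2 * n * (2 ^ CARD('k) * Q / P)) = n / \<kappa>"
        unfolding k c4 c2 using P Q simplex_vol_pos by (simp add: field_simps power2_eq_square)
      then have "ennreal (simplex_vol / (2 * P)) * \<Phi> (\<tau> \<xi>) = ennreal (n / \<kappa>)"
        unfolding \<Phi>_def AA W using P Q simplex_vol_pos by (simp add: n_def flip: ennreal_mult)
      then show ?thesis by (simp add: P_def n_def)
    qed simp
  qed
  finally show ?thesis using rhs by simp
qed

end

end

lemma C0_infty_continuous: "f \<in> C0_infty U \<Longrightarrow> continuous_on UNIV f"
  unfolding C0_infty_def by (simp, metis C_diff.simps(1))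

lemma C0_infty_integrable:
  fixes f :: "'a::euclidean_space \<Rightarrow> complex"
  assumes f: "f \<in> C0_infty U" shows "integrable lborel f"
proof -
  let ?K = "closure {z. f z \<noteq> 0}"
  have "compact ?K" using f by (simp add: C0_infty_def)
  then have "integrable lborel (\<lambda>z. indicator ?K z *\<^sub>R f z)"
    by (rule borel_integrable_compact) (use C0_infty_continuous[OF f] in \<open>auto intro: continuous_on_subset\<close>)
  moreover have "indicator ?K z *\<^sub>R f z = f z" for z
    using closure_subset[of "{z. f z \<noteq> 0}"] by (auto simp: indicator_def)
  ultimately show ?thesis by simp
qed

theorem lemma2p8:
  fixes x :: "real ^ 'n ^ 'k"
    and y :: "'k \<Rightarrow> (real ^ 'n) \<times> real"
    and f :: "real ^ 'n \<Rightarrow> complex"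
  assumes "CARD('n) \<ge> 2"
    and "1 \<le> CARD('k)"
    and "CARD('k) < CARD('n)"
    and "x \<in> Aff"
    and "\<And>i. x $ i \<noteq> 0"
    and "\<And>j. y j = pi_inv (x $ j)"
    and "f \<in> C0_infty (ball 0 1)"
  shows "(\<integral>\<^sup>+ t \<in> pos_orthant. ennreal ((cmod (avg_op t f x))\<^sup>2 * weight x t) \<partial>lborel) =
         (\<integral>\<^sup>+ s. ennreal ((cmod (extension_op f (\<Sum>j\<in>UNIV. s $ j *\<^sub>R y j)))\<^sup>2) \<partial>(lborel :: (real ^ 'k) measure))"
proof -
  obtain k0 :: 'k where True by simp
  obtain e and E :: "real ^ ('n, 'k) codim \<Rightarrow> real ^ 'n" where "frame x k0 e E"
    by (rule frame_exists[OF assms(4,3), of k0]) (rule that)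
  then interpret frame x k0 e E .
  have fm: "f \<in> borel_measurable borel"
    by (rule borel_measurable_continuous_onI[OF C0_infty_continuous[OF assms(7)]])
  have f0: "f z = 0" if "z \<notin> ball 0 1" for z
  proof (rule ccontr)
    assume "f z \<noteq> 0"
    then have "z \<in> {z. f z \<noteq> 0}" by simp
    then have "z \<in> closure {z. f z \<noteq> 0}" by (rule closure_subset[THEN subsetD])
    then show False using that assms(7) by (auto simp: C0_infty_def)
  qed
  show ?thesis
    unfolding assms(6) by (rule averages_extension_identity[OF assms(5) C0_infty_integrable[OF assms(7)] fm f0])
qed

end
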